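(* Let $T\in C^8(\mathbb{S}^1\to\mathbb{S}^1)$ be an expanding map, i.e. there is $\alpha$ with $|T'(x)|\ge \alpha^{-1}>1$ for all $x\in\mathbb{S}^1$. Let $\rho\in BV([-1,1])$ be a probability density with zero average, $\int_{-1}^1 x\rho(x)\,dx=0$, and let $\sigma^2(\rho)=\int_{-1}^1 x^2\rho(x)\,dx$. For $\delta\in(0,1]$ let $\rho_\delta(x)=\frac1\delta\rho(x/\delta)$ and $L_\delta=\rho_\delta * L_T$, and let $L_0=L_T$. For each $\delta$ let $h_\delta\in W^{7,1}(\mathbb{S}^1)$ be the unique probability density fixed by $L_\delta$. Then $$\left\|\frac{h_\delta-h_0}{\delta^2}-\frac{\sigma^2(\rho)}{2}(Id-L_T)^{-1}h_0''\right\|_{W^{1,1}}\longrightarrow 0\qquad\text{as }\delta\to 0.$$ In particular $\delta\mapsto h_\delta$ has an order two Taylor expansion at $\delta=0$ in $W^{1,1}(\mathbb{S}^1)$.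
   Context: $\mathbb{S}^1=\mathbb{R}/\mathbb{Z}$. $L_T$ is the transfer (pushforward) operator $(L_T\mu)(A)=\mu(T^{-1}(A))$ on finite signed Borel measures on $\mathbb{S}^1$, identified with its action on densities. The convolution is on the circle: $(\rho_\delta * f)(x)=\int_{-\delta}^{\delta}\rho_\delta(y)f(x-y)\,dy$. $W^{k,1}(\mathbb{S}^1)$ is the Sobolev space with norm $\|f\|_{W^{k,1}}=\sum_{i=0}^k\|f^{(i)}\|_{L^1}$. $(Id-L_T)^{-1}=\sum_{i\ge 0}L_T^i$ denotes the resolvent operator acting on the space of zero-average functions $\{g\in W^{1,1}(\mathbb{S}^1):\int g=0\}$, on which it is bounded. *)

theory Defs
  imports "HOL-Analysis.Analysis"
begin

(* Functions on the circle R/Z are 1-periodic functions on the reals, Borel subsets of the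
   circle are 1-periodic Borel sets of reals, and integration over the circle is integration
   over the fundamental domain [0,1).  Elements of L^1 and of Sobolev spaces are represented by
   functions, and operators between them are determined up to null sets. *)

definition circle_fun :: "(real \<Rightarrow> 'a) \<Rightarrow> bool" where
  "circle_fun f \<longleftrightarrow> (\<forall>x. f (x + 1) = f x)"

definition circle_borel :: "real set set" where
  "circle_borel = {A \<in> sets borel. \<forall>x. x + 1 \<in> A \<longleftrightarrow> x \<in> A}"

(* A C^k self-map of the circle is given by a C^k lift to the reals, determined up to an
   additive integer.  The degree is arbitrary. *)
definition circle_lift :: "(real \<Rightarrow> real) \<Rightarrow> bool" where
  "circle_lift T \<longleftrightarrow> (\<forall>x. T (x + 1) - T x \<in> \<int>)"

definition C_class :: "nat \<Rightarrow> (real \<Rightarrow> real) \<Rightarrow> bool" where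
  "C_class k f \<longleftrightarrow> (\<forall>i<k. \<forall>x. (deriv ^^ i) f differentiable at x)
     \<and> continuous_on UNIV ((deriv ^^ k) f)"

definition expanding :: "(real \<Rightarrow> real) \<Rightarrow> bool" where
  "expanding T \<longleftrightarrow> (\<exists>\<alpha>. inverse \<alpha> > 1 \<and> (\<forall>x. \<bar>deriv T x\<bar> \<ge> inverse \<alpha>))"

definition circle_L1 :: "(real \<Rightarrow> real) set" where
  "circle_L1 = {f. circle_fun f \<and> f \<in> borel_measurable borel \<and> set_integrable lborel {0..<1} f}"

definition circle_density :: "(real \<Rightarrow> real) \<Rightarrow> bool" where
  "circle_density f \<longleftrightarrow> f \<in> circle_L1 \<and> (AE x in lborel. 0 \<le> f x)
     \<and> (LINT x:{0..<1}|lborel. f x) = 1"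

definition has_weak_deriv :: "nat \<Rightarrow> (real \<Rightarrow> real) \<Rightarrow> (real \<Rightarrow> real) \<Rightarrow> bool" where
  "has_weak_deriv k f g \<longleftrightarrow> f \<in> circle_L1 \<and> g \<in> circle_L1 \<and>
     (\<forall>\<phi>. circle_fun \<phi> \<and> (\<forall>n. C_class n \<phi>) \<longrightarrow>
        (LINT x:{0..<1}|lborel. f x * (deriv ^^ k) \<phi> x)
          = (-1) ^ k * (LINT x:{0..<1}|lborel. g x * \<phi> x))"

definition weak_deriv :: "nat \<Rightarrow> (real \<Rightarrow> real) \<Rightarrow> real \<Rightarrow> real" where
  "weak_deriv k f = (SOME g. has_weak_deriv k f g)"

(* W^{k,1} and its norm; the norm is meaningful only on members of the space. *)
definition sobolev :: "nat \<Rightarrow> (real \<Rightarrow> real) set" where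
  "sobolev k = {f \<in> circle_L1. \<forall>i\<le>k. \<exists>g. has_weak_deriv i f g}"

definition sobolev_norm :: "nat \<Rightarrow> (real \<Rightarrow> real) \<Rightarrow> real" where
  "sobolev_norm k f = (\<Sum>i\<le>k. LINT x:{0..<1}|lborel. \<bar>weak_deriv i f x\<bar>)"

(* The finite signed measure on the circle with density f. *)
definition signed_measure :: "(real \<Rightarrow> real) \<Rightarrow> real set \<Rightarrow> real" where
  "signed_measure f A = (LINT x:({0..<1} \<inter> A)|lborel. f x)"

(* The density, determined almost everywhere, of the pushforward under T of the signed measure
   with density f.  T -` A is the preimage of A on the circle since T is a lift. *)
definition transfer :: "(real \<Rightarrow> real) \<Rightarrow> (real \<Rightarrow> real) \<Rightarrow> real \<Rightarrow> real" where
  "transfer T f = (SOME g. g \<in> circle_L1 \<and>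
     (\<forall>A\<in>circle_borel. signed_measure g A = signed_measure f (T -` A)))"

definition zero_average_W11 :: "(real \<Rightarrow> real) set" where
  "zero_average_W11 = {g \<in> sobolev 1. (LINT x:{0..<1}|lborel. g x) = 0}"

definition neumann_sum :: "(real \<Rightarrow> real) \<Rightarrow> (real \<Rightarrow> real) \<Rightarrow> nat \<Rightarrow> real \<Rightarrow> real" where
  "neumann_sum T g n x = (\<Sum>i<n. (transfer T ^^ i) g x)"

(* u is the sum of the Neumann series of g, with convergence in W^{1,1} on the space of
   zero-average functions. *)
definition is_resolvent :: "(real \<Rightarrow> real) \<Rightarrow> (real \<Rightarrow> real) \<Rightarrow> (real \<Rightarrow> real) \<Rightarrow> bool" where
  "is_resolvent T g u \<longleftrightarrow> g \<in> zero_average_W11 \<and> u \<in> zero_average_W11 \<and>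
     (\<forall>n. neumann_sum T g n \<in> zero_average_W11) \<and>
     (\<lambda>n. sobolev_norm 1 (\<lambda>x. neumann_sum T g n x - u x)) \<longlonglongrightarrow> 0"

definition resolvent :: "(real \<Rightarrow> real) \<Rightarrow> (real \<Rightarrow> real) \<Rightarrow> real \<Rightarrow> real" where
  "resolvent T g = (SOME u. is_resolvent T g u)"

definition bounded_variation_on :: "real \<Rightarrow> real \<Rightarrow> (real \<Rightarrow> real) \<Rightarrow> bool" where
  "bounded_variation_on a b f \<longleftrightarrow>
     (\<exists>B. \<forall>n t. mono_on {..n} t \<and> t ` {..n} \<subseteq> {a..b} \<longrightarrow>
        (\<Sum>i<n. \<bar>f (t (Suc i)) - f (t i)\<bar>) \<le> B)"

(* BV([a,b]) as a space of classes modulo null sets; values outside [a,b] are irrelevant. *)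
definition BV_space :: "real \<Rightarrow> real \<Rightarrow> (real \<Rightarrow> real) set" where
  "BV_space a b = {f. set_integrable lborel {a..b} f \<and>
     (\<exists>g. bounded_variation_on a b g \<and> (AE x\<in>{a..b} in lborel. f x = g x))}"

definition variance_of :: "(real \<Rightarrow> real) \<Rightarrow> real" where
  "variance_of \<rho> = (LINT x:{-1..1}|lborel. x\<^sup>2 * \<rho> x)"

definition rescale :: "(real \<Rightarrow> real) \<Rightarrow> real \<Rightarrow> real \<Rightarrow> real" where
  "rescale \<rho> \<delta> x = (1 / \<delta>) * \<rho> (x / \<delta>)"

definition circle_conv ::
    "(real \<Rightarrow> real) \<Rightarrow> real \<Rightarrow> (real \<Rightarrow> real) \<Rightarrow> real \<Rightarrow> real" where
  "circle_conv \<rho> \<delta> f x = (LINT y:{-\<delta>..\<delta>}|lborel. rescale \<rho> \<delta> y * f (x - y))"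

definition noisy_transfer ::
    "(real \<Rightarrow> real) \<Rightarrow> (real \<Rightarrow> real) \<Rightarrow> real \<Rightarrow> (real \<Rightarrow> real) \<Rightarrow> real \<Rightarrow> real" where
  "noisy_transfer T \<rho> \<delta> f =
     (if \<delta> = 0 then transfer T f else circle_conv \<rho> \<delta> (transfer T f))"

definition unique_fixed_density ::
    "((real \<Rightarrow> real) \<Rightarrow> real \<Rightarrow> real) \<Rightarrow> (real \<Rightarrow> real) \<Rightarrow> bool" where
  "unique_fixed_density L h \<longleftrightarrow>
     circle_density h \<and> (AE x in lborel. L h x = h x) \<and>
     (\<forall>f. circle_density f \<and> (AE x in lborel. L f x = f x) \<longrightarrow> (AE x in lborel. f x = h x))"

definition second_order_expansion :: "nat \<Rightarrow> (real \<Rightarrow> real \<Rightarrow> real) \<Rightarrow> bool" where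
  "second_order_expansion k h \<longleftrightarrow>
     (\<exists>c1\<in>sobolev k. \<exists>c2\<in>sobolev k.
        ((\<lambda>\<delta>. sobolev_norm k (\<lambda>x. h \<delta> x - (h 0 x + \<delta> * c1 x + \<delta>\<^sup>2 * c2 x)) / \<delta>\<^sup>2)
          \<longlongrightarrow> 0) (at_right 0))"

end

theory Submission
  imports Defs "HOL-Probability.Probability_Measure" "HOL-Real_Asymp.Real_Asymp"
begin

text \<open>
Consider the operators Q_\<delta> f = \<rho>_\<delta> * L_T f for 0 \<le> \<delta>, with Q_0 = L_T. The proof works with smooth
representatives and C^k norms, and passes to Sobolev classes only at the end.

The operator L_T is a sum of f / |T'| over the inverse branches of T, so that (L_T f)' = L_T ((f / T')'), and
convolutions commute with differentiation. Hence the j-th derivative of Q_\<delta> f comes from a differential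
expression in f whose leading coefficient is the j-th power of 1 / T' and has modulus less than 1 when j > 0. For a rapidly increasing
sequence \<kappa> the cones of all f with |f^(j)| \<le> \<kappa> j * f for j \<le> k are therefore mapped strictly into themselves,
with the same constants for all \<delta> (\<open>cone_parameters\<close>). The condition for j = 1 is a Harnack inequality: a
function in the cone is bounded below by a fixed fraction of its mean. So after each application of Q_\<delta> a constant
can be subtracted without leaving the cone (\<open>cone_split_constant\<close>), and this constant depends on the mean only.
It follows that differences of functions with equal means decay exponentially in C^k, uniformly in \<delta>
(\<open>Q_iterate_decay\<close>). The Neumann series thus inverts Id - Q_\<delta> on functions with mean zero, and Q_\<delta> has a fixed
density H_\<delta> in the cone (\<open>fixed_point_in_cone\<close>), which bounds H_\<delta> in C^4 uniformly in \<delta>.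

Put G = L_T H_\<delta>. Subtracting the fixed point equations gives
(Id - L_T) (H_\<delta> - H_0) = \<rho>_\<delta> * G - G. The right-hand side is of order \<delta> in C^3, and so are H_\<delta> - H_0 and
G - H_0. Since \<rho> is centred, a second order Taylor expansion shows that (\<rho>_\<delta> * G - G) / \<delta>^2 differs from
\<sigma>^2(\<rho>) / 2 * G'', and hence from \<sigma>^2(\<rho>) / 2 * H_0'', by a term of order \<delta> in C^1. Applying the inverse of
Id - L_T yields the expansion with an error of order \<delta> (\<open>smooth_second_order_response\<close>).

Finally, h_\<delta> equals H_\<delta> almost everywhere, because fixed densities are unique. The weak derivatives, the transfer
operator and the resolvent, which are choices from almost everywhere classes, agree with their smooth counterparts
by the fundamental lemma of the calculus of variations (\<open>fundamental_lemma_circle\<close>) and by the uniqueness of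
densities (\<open>transfer_represents\<close>) and of limits (\<open>is_resolvent_unique\<close>).
\<close>

section \<open>Periodic functions of class C^k\<close>

lemma C_class_0: "C_class 0 f \<longleftrightarrow> continuous_on UNIV f"
  by (simp add: C_class_def)

lemma C_class_Suc:
  "C_class (Suc k) f \<longleftrightarrow> (\<forall>x. f differentiable at x) \<and> C_class k (deriv f)"
proof -
  have "(\<forall>i<Suc k. P i) \<longleftrightarrow> P 0 \<and> (\<forall>i<k. P (Suc i))" for P
    by (metis less_Suc_eq_0_disj not_less_eq zero_less_Suc)
  then show ?thesis
    unfolding C_class_def by (simp add: funpow_Suc_right del: funpow.simps)
qed

lemma C_class_DERIV:
  assumes "C_class (Suc k) f"
  shows "(f has_real_derivative deriv f x) (at x)"
  using assms unfolding C_class_Suc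
  by (simp add: DERIV_deriv_iff_real_differentiable)

lemma C_class_deriv: "C_class (Suc k) f \<Longrightarrow> C_class k (deriv f)"
  by (simp add: C_class_Suc)

text \<open>Together with the preceding equivalence this turns membership in C^k into a recursion on k, so that the
closure properties below are inductions whose step is one differentiation rule.\<close>

lemma C_class_SucI:
  assumes "\<And>x. (f has_real_derivative f' x) (at x)" and "C_class k f'"
  shows "C_class (Suc k) f"
proof -
  have "deriv f = f'" using assms(1) by (auto intro: DERIV_imp_deriv)
  then show ?thesis
    using assms by (auto simp: C_class_Suc real_differentiable_def)
qed

lemma C_class_le:
  assumes "C_class m f" and "k \<le> m"
  shows "C_class k f"
proof -
  have step: "C_class k f" if "C_class (Suc k) f" for k
    using that
  proof (induction k arbitrary: f)
    case 0
    then show ?case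
      using DERIV_isCont[OF C_class_DERIV[OF 0]]
      by (simp add: C_class_0 continuous_at_imp_continuous_on)
  next
    case (Suc k)
    then show ?case using C_class_Suc[of k f] C_class_Suc[of "Suc k" f] by blast
  qed
  show ?thesis by (rule inc_induct[OF assms(2)]) (use step assms(1) in auto)
qed

lemma C_class_SucD: "C_class (Suc k) f \<Longrightarrow> C_class k f"
  by (erule C_class_le) simp

lemma C_class_continuous: "C_class k f \<Longrightarrow> continuous_on A f"
  using C_class_le[of k f 0] by (auto simp: C_class_0 intro: continuous_on_subset)

lemma C_class_const: "C_class k (\<lambda>x. c)"
  by (induction k arbitrary: c)
     (auto simp: C_class_0 intro!: C_class_SucI[where f' = "\<lambda>x. 0"] derivative_eq_intros)

lemma C_class_add: "C_class k f \<Longrightarrow> C_class k g \<Longrightarrow> C_class k (\<lambda>x. f x + g x)"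
proof (induction k arbitrary: f g)
  case 0
  then show ?case by (auto simp: C_class_0 intro: continuous_intros)
next
  case (Suc k)
  have "C_class k (\<lambda>x. deriv f x + deriv g x)"
    using Suc by (auto intro: C_class_deriv)
  moreover have "((\<lambda>x. f x + g x) has_real_derivative deriv f x + deriv g x) (at x)" for x
    using Suc.prems by (intro DERIV_add C_class_DERIV)
  ultimately show ?case by (intro C_class_SucI)
qed

lemma C_class_mult: "C_class k f \<Longrightarrow> C_class k g \<Longrightarrow> C_class k (\<lambda>x. f x * g x)"
proof (induction k arbitrary: f g)
  case 0
  then show ?case by (auto simp: C_class_0 intro: continuous_intros)
next
  case (Suc k)
  have "C_class k f" "C_class k g" using Suc.prems by (auto intro: C_class_SucD)
  then have "C_class k (\<lambda>x. deriv f x * g x + f x * deriv g x)"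
    using Suc by (intro C_class_add) (auto intro: C_class_deriv)
  moreover have "((\<lambda>x. f x * g x) has_real_derivative deriv f x * g x + f x * deriv g x) (at x)" for x
    by (auto intro!: derivative_eq_intros C_class_DERIV[OF Suc.prems(1)] C_class_DERIV[OF Suc.prems(2)])
  ultimately show ?case by (intro C_class_SucI)
qed

lemma C_class_lincomb: "C_class k f \<Longrightarrow> C_class k g \<Longrightarrow> C_class k (\<lambda>x. a * f x + b * g x)"
  by (intro C_class_add C_class_mult C_class_const)

lemma C_class_sum: "(\<And>i. i \<in> I \<Longrightarrow> C_class k (f i)) \<Longrightarrow> C_class k (\<lambda>x. \<Sum>i\<in>I. f i x)"
  by (induction I rule: infinite_finite_induct) (auto intro: C_class_const C_class_add)

lemma C_class_inverse:
  assumes "C_class k f" and "\<And>x. f x \<noteq> 0"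
  shows "C_class k (\<lambda>x. inverse (f x))"
  using assms(1)
proof (induction k)
  case 0
  then show ?case using assms(2) by (auto simp: C_class_0 intro: continuous_intros)
next
  case (Suc k)
  have inv: "C_class k (\<lambda>x. inverse (f x))" using Suc by (auto intro: C_class_SucD)
  have "C_class k (\<lambda>x. (-1) * (inverse (f x) * deriv f x * inverse (f x)))"
    using Suc.prems inv by (intro C_class_mult C_class_const) (auto intro: C_class_deriv)
  moreover have "((\<lambda>x. inverse (f x)) has_real_derivative
      (-1) * (inverse (f x) * deriv f x * inverse (f x))) (at x)" for x
    using assms(2) by (auto intro!: derivative_eq_intros C_class_DERIV[OF Suc.prems])
  ultimately show ?case by (intro C_class_SucI)
qed

lemma C_class_exp: "C_class k f \<Longrightarrow> C_class k (\<lambda>x. exp (f x))"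
proof (induction k)
  case 0
  then show ?case by (auto simp: C_class_0 intro: continuous_intros)
next
  case (Suc k)
  have "C_class k (\<lambda>x. exp (f x))" using Suc by (auto intro: C_class_SucD)
  then have "C_class k (\<lambda>x. exp (f x) * deriv f x)"
    using Suc.prems by (intro C_class_mult) (auto intro: C_class_deriv)
  moreover have "((\<lambda>x. exp (f x)) has_real_derivative exp (f x) * deriv f x) (at x)" for x
    by (auto intro!: derivative_eq_intros C_class_DERIV[OF Suc.prems])
  ultimately show ?case by (intro C_class_SucI)
qed

lemma deriv_lincomb:
  assumes "C_class (Suc k) f" "C_class (Suc k) g"
  shows "deriv (\<lambda>x. a * f x + b * g x) = (\<lambda>x. a * deriv f x + b * deriv g x)"
  by (rule ext, rule DERIV_imp_deriv)
     (auto intro!: derivative_eq_intros C_class_DERIV[OF assms(1)] C_class_DERIV[OF assms(2)])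

lemma deriv_iterate_lincomb:
  assumes "C_class k f" "C_class k g" "j \<le> k"
  shows "(deriv ^^ j) (\<lambda>x. a * f x + b * g x) = (\<lambda>x. a * (deriv ^^ j) f x + b * (deriv ^^ j) g x)"
  using assms
proof (induction j arbitrary: f g k)
  case (Suc j)
  then obtain k' where k: "k = Suc k'" by (cases k) auto
  show ?case
    using Suc.IH[of k' "deriv f" "deriv g"] Suc.prems
    by (simp add: funpow_Suc_right deriv_lincomb[of k'] k C_class_deriv del: funpow.simps)
qed simp

lemma deriv_iterate_const: "(deriv ^^ j) (\<lambda>x. c) = (\<lambda>x. if j = 0 then c else 0)"
proof (induction j)
  case (Suc j)
  have "deriv (\<lambda>x::real. c') = (\<lambda>x. 0)" for c' :: real
    by (auto intro: DERIV_imp_deriv)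
  then show ?case by (simp add: Suc)
qed simp

lemma circle_fun_shift_int:
  assumes "circle_fun f"
  shows "f (x + of_int n) = f x"
proof (induction n rule: int_induct[where k = 0])
  case (step1 i)
  have "f (x + of_int i + 1) = f (x + of_int i)"
    using assms by (simp add: circle_fun_def)
  then show ?case using step1 by (simp add: add.assoc)
next
  case (step2 i)
  have "f (x + of_int (i - 1) + 1) = f (x + of_int (i - 1))"
    using assms by (simp only: circle_fun_def)
  moreover have "x + of_int (i - 1) + 1 = x + of_int i" by simp
  ultimately show ?case using step2 by metis
qed simp

lemma circle_fun_frac: "circle_fun f \<Longrightarrow> f (frac x) = f x"
  using circle_fun_shift_int[of f "frac x" "\<lfloor>x\<rfloor>"] by (simp add: frac_def)

lemma circle_fun_deriv: "circle_fun f \<Longrightarrow> circle_fun (deriv f)"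
proof -
  assume f: "circle_fun f"
  have shift: "(\<lambda>x. f (x + 1)) = f"
    using f by (auto simp: circle_fun_def)
  have "(f has_field_derivative D) (at (x + 1)) \<longleftrightarrow> (f has_field_derivative D) (at x)" for x D
    using DERIV_shift[of f D x 1] by (simp only: shift)
  then show ?thesis by (simp only: circle_fun_def deriv_def) simp
qed

definition periodic_C :: "nat \<Rightarrow> (real \<Rightarrow> real) set" where
  "periodic_C k = {f. circle_fun f \<and> C_class k f}"

lemma periodic_C_lincomb:
  "f \<in> periodic_C k \<Longrightarrow> g \<in> periodic_C k \<Longrightarrow> (\<lambda>x. a * f x + b * g x) \<in> periodic_C k"
  by (auto simp: periodic_C_def circle_fun_def intro: C_class_lincomb)

lemma periodic_C_const: "(\<lambda>x. c) \<in> periodic_C k"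
  by (auto simp: periodic_C_def circle_fun_def intro: C_class_const)

lemma periodic_C_add:
  "f \<in> periodic_C k \<Longrightarrow> g \<in> periodic_C k \<Longrightarrow> (\<lambda>x. f x + g x) \<in> periodic_C k"
  using periodic_C_lincomb[of f k g 1 1] by simp

lemma periodic_C_diff:
  "f \<in> periodic_C k \<Longrightarrow> g \<in> periodic_C k \<Longrightarrow> (\<lambda>x. f x - g x) \<in> periodic_C k"
  using periodic_C_lincomb[of f k g 1 "-1"] by simp

lemma periodic_C_cmult: "f \<in> periodic_C k \<Longrightarrow> (\<lambda>x. a * f x) \<in> periodic_C k"
  using periodic_C_lincomb[of f k f a 0] by simp

lemma periodic_C_mult:
  "f \<in> periodic_C k \<Longrightarrow> g \<in> periodic_C k \<Longrightarrow> (\<lambda>x. f x * g x) \<in> periodic_C k"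
  by (auto simp: periodic_C_def circle_fun_def intro: C_class_mult)

lemma periodic_C_sum:
  "(\<And>i. i \<in> I \<Longrightarrow> f i \<in> periodic_C k) \<Longrightarrow> (\<lambda>x. \<Sum>i\<in>I. f i x) \<in> periodic_C k"
  by (auto simp: periodic_C_def circle_fun_def intro: C_class_sum)

lemma periodic_C_le: "f \<in> periodic_C m \<Longrightarrow> k \<le> m \<Longrightarrow> f \<in> periodic_C k"
  by (auto simp: periodic_C_def intro: C_class_le)

lemma periodic_C_deriv: "f \<in> periodic_C (Suc k) \<Longrightarrow> deriv f \<in> periodic_C k"
  by (auto simp: periodic_C_def intro: C_class_deriv circle_fun_deriv)

lemma periodic_C_deriv_iterate: "f \<in> periodic_C m \<Longrightarrow> j + k \<le> m \<Longrightarrow> (deriv ^^ j) f \<in> periodic_C k"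
proof (induction j arbitrary: k)
  case 0
  then show ?case by (auto intro: periodic_C_le)
next
  case (Suc j)
  then show ?case using periodic_C_deriv by auto
qed

lemma periodic_C_deriv_iterate_lincomb:
  assumes "f \<in> periodic_C k" "g \<in> periodic_C k" "j \<le> k"
  shows "(deriv ^^ j) (\<lambda>x. a * f x + b * g x) x = a * (deriv ^^ j) f x + b * (deriv ^^ j) g x"
  using assms deriv_iterate_lincomb[of k f g j a b] by (simp add: periodic_C_def)

lemma periodic_C_deriv_iterate_diff:
  assumes "f \<in> periodic_C k" "g \<in> periodic_C k" "j \<le> k"
  shows "(deriv ^^ j) (\<lambda>x. f x - g x) x = (deriv ^^ j) f x - (deriv ^^ j) g x"
  using periodic_C_deriv_iterate_lincomb[OF assms, of 1 "-1"] by simp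

lemma periodic_C_continuous: "f \<in> periodic_C k \<Longrightarrow> continuous_on A f"
  by (auto simp: periodic_C_def intro: C_class_continuous)

lemma periodic_C_measurable [measurable_dest]: "f \<in> periodic_C k \<Longrightarrow> f \<in> borel_measurable borel"
  by (intro borel_measurable_continuous_onI periodic_C_continuous)

lemma periodic_C_DERIV: "f \<in> periodic_C k \<Longrightarrow> j < k \<Longrightarrow>
  ((deriv ^^ j) f has_real_derivative (deriv ^^ Suc j) f x) (at x)"
  using periodic_C_deriv_iterate[of f k j 1] C_class_DERIV[of 0 "(deriv ^^ j) f"]
  by (simp add: periodic_C_def)

lemma periodic_C_circle: "f \<in> periodic_C k \<Longrightarrow> circle_fun f"
  by (simp add: periodic_C_def)

text \<open>Every value is attained on the compact interval [0,1].\<close>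

lemma periodic_C_bounded:
  assumes "f \<in> periodic_C k"
  obtains M where "0 \<le> M" "\<And>x. \<bar>f x\<bar> \<le> M"
proof -
  have "bounded (f ` {0..1})"
    by (intro compact_imp_bounded compact_continuous_image periodic_C_continuous[OF assms]
        compact_Icc)
  then obtain M where M: "\<And>x. x \<in> {0..1} \<Longrightarrow> \<bar>f x\<bar> \<le> M"
    unfolding bounded_iff by force
  have "\<bar>f x\<bar> \<le> M" for x
    using M[of "frac x"] circle_fun_frac[of f x] periodic_C_circle[OF assms]
    by (simp add: less_imp_le frac_lt_1)
  then show ?thesis using that[of "max M 0"] by (simp add: le_max_iff_disj)
qed

lemma periodic_C_norm_bounded:
  assumes "f \<in> periodic_C k"
  obtains M where "0 \<le> M" "\<And>j x. j \<le> k \<Longrightarrow> \<bar>(deriv ^^ j) f x\<bar> \<le> M"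
proof -
  have "\<exists>M\<ge>0. \<forall>x. \<bar>(deriv ^^ j) f x\<bar> \<le> M" if "j \<le> k" for j
    using periodic_C_bounded[of "(deriv ^^ j) f" 0] periodic_C_deriv_iterate[OF assms, of j 0] that
    by (metis add.right_neutral)
  then have "\<forall>j. \<exists>M. j \<le> k \<longrightarrow> M\<ge>0 \<and> (\<forall>x. \<bar>(deriv ^^ j) f x\<bar> \<le> M)" by blast
  then obtain N where N: "\<And>j. j \<le> k \<Longrightarrow> 0 \<le> N j" "\<And>j x. j \<le> k \<Longrightarrow> \<bar>(deriv ^^ j) f x\<bar> \<le> N j"
    unfolding choice_iff by blast
  have le: "N j \<le> (\<Sum>j\<le>k. N j)" if "j \<le> k" for j
    using that N(1) by (intro member_le_sum) auto
  show ?thesis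
  proof (rule that[of "\<Sum>j\<le>k. N j"])
    show "0 \<le> (\<Sum>j\<le>k. N j)" using N(1) by (auto intro: sum_nonneg)
    show "\<bar>(deriv ^^ j) f x\<bar> \<le> (\<Sum>j\<le>k. N j)" if "j \<le> k" for j x
      using N(2)[OF that, of x] le[OF that] by linarith
  qed
qed

section \<open>Contraction of invariant cones\<close>

definition circle_mean :: "(real \<Rightarrow> real) \<Rightarrow> real" where
  "circle_mean f = (LINT x:{0..<1}|lborel. f x)"

lemma periodic_C_integrable:
  assumes "f \<in> periodic_C k" shows "set_integrable lborel {0..<1} f"
proof (rule set_integrable_subset)
  show "set_integrable lborel {0..1} f"
    by (intro borel_integrable_atLeastAtMost' periodic_C_continuous[OF assms])
qed auto

lemma circle_mean_const: "circle_mean (\<lambda>x. c) = c"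
  by (simp add: circle_mean_def set_lebesgue_integral_def)

lemma circle_mean_lincomb:
  assumes "f \<in> periodic_C k" "g \<in> periodic_C l"
  shows "circle_mean (\<lambda>x. a * f x + b * g x) = a * circle_mean f + b * circle_mean g"
  unfolding circle_mean_def
  using periodic_C_integrable[OF assms(1)] periodic_C_integrable[OF assms(2)]
  by (subst set_integral_add(2)) auto

lemma circle_mean_diff:
  assumes "f \<in> periodic_C k" "g \<in> periodic_C l"
  shows "circle_mean (\<lambda>x. f x - g x) = circle_mean f - circle_mean g"
  using circle_mean_lincomb[OF assms, of 1 "-1"] by simp

lemma circle_mean_add:
  assumes "f \<in> periodic_C k" "g \<in> periodic_C l"
  shows "circle_mean (\<lambda>x. f x + g x) = circle_mean f + circle_mean g"
  using circle_mean_lincomb[OF assms, of 1 1] by simp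

lemma circle_mean_mono:
  assumes "f \<in> periodic_C k" "g \<in> periodic_C l" "\<And>x. f x \<le> g x"
  shows "circle_mean f \<le> circle_mean g"
  unfolding circle_mean_def
  by (intro set_integral_mono periodic_C_integrable[OF assms(1)] periodic_C_integrable[OF assms(2)] assms(3))

lemma circle_mean_abs_le:
  assumes "f \<in> periodic_C k" "\<And>x. \<bar>f x\<bar> \<le> M"
  shows "\<bar>circle_mean f\<bar> \<le> M"
proof -
  have "circle_mean f \<le> M"
    using circle_mean_mono[OF assms(1) periodic_C_const[of M 0] abs_le_D1[OF assms(2)]]
    by (simp add: circle_mean_const)
  moreover have "- M \<le> circle_mean f"
    using circle_mean_mono[OF periodic_C_const[of "- M" 0] assms(1)] abs_le_D2[OF assms(2)]
    by (simp add: circle_mean_const minus_le_iff)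
  ultimately show ?thesis by linarith
qed

text \<open>A bound on the C^k norm, kept as a relation so that no supremum has to be formed.\<close>

definition C_norm_le :: "nat \<Rightarrow> (real \<Rightarrow> real) \<Rightarrow> real \<Rightarrow> bool" where
  "C_norm_le k f M \<longleftrightarrow> (\<forall>j\<le>k. \<forall>x. \<bar>(deriv ^^ j) f x\<bar> \<le> M)"

lemma C_norm_le_exists:
  assumes "f \<in> periodic_C k" obtains M where "C_norm_le k f M"
  using periodic_C_norm_bounded[OF assms] unfolding C_norm_le_def by metis

lemma C_norm_leD: "C_norm_le k f M \<Longrightarrow> j \<le> k \<Longrightarrow> \<bar>(deriv ^^ j) f x\<bar> \<le> M"
  by (simp add: C_norm_le_def)

lemma C_norm_le_0: "C_norm_le k f M \<Longrightarrow> \<bar>f x\<bar> \<le> M"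
  using C_norm_leD[of k f M 0] by simp

lemma C_norm_le_nonneg: "C_norm_le k f M \<Longrightarrow> 0 \<le> M"
  using C_norm_le_0[of k f M 0] by linarith

lemma C_norm_le_mono: "C_norm_le k f M \<Longrightarrow> j \<le> k \<Longrightarrow> M \<le> N \<Longrightarrow> C_norm_le j f N"
  unfolding C_norm_le_def by (intro allI impI) (rule order_trans[of _ M], simp_all)

lemma C_norm_le_lincomb:
  assumes "f \<in> periodic_C k" "g \<in> periodic_C k" "C_norm_le k f M" "C_norm_le k g N"
  shows "C_norm_le k (\<lambda>x. a * f x + b * g x) (\<bar>a\<bar> * M + \<bar>b\<bar> * N)"
  unfolding C_norm_le_def
proof (intro allI impI)
  fix j x assume j: "j \<le> k"
  have "\<bar>a * (deriv ^^ j) f x + b * (deriv ^^ j) g x\<bar>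
    \<le> \<bar>a\<bar> * \<bar>(deriv ^^ j) f x\<bar> + \<bar>b\<bar> * \<bar>(deriv ^^ j) g x\<bar>"
    using abs_triangle_ineq by (metis abs_mult)
  also have "\<dots> \<le> \<bar>a\<bar> * M + \<bar>b\<bar> * N"
    using assms j by (intro add_mono mult_left_mono C_norm_leD) auto
  finally show "\<bar>(deriv ^^ j) (\<lambda>x. a * f x + b * g x) x\<bar> \<le> \<bar>a\<bar> * M + \<bar>b\<bar> * N"
    using assms j by (simp add: periodic_C_deriv_iterate_lincomb)
qed

lemma uniformly_convergent_geometric:
  fixes f :: "nat \<Rightarrow> real \<Rightarrow> real"
  assumes "\<And>n x. \<bar>f n x\<bar> \<le> B * r ^ n" "0 \<le> r" "r < 1"
  shows "uniformly_convergent_on UNIV (\<lambda>n x. \<Sum>i<n. f i x)"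
    and "summable (\<lambda>n. f n x)"
    and "\<bar>\<Sum>n. f n x\<bar> \<le> B / (1 - r)"
proof -
  have s: "(\<lambda>n. B * r ^ n) sums (B * (1 / (1 - r)))"
    using assms(2,3) by (intro sums_mult geometric_sums) simp
  then have summ: "summable (\<lambda>n. B * r ^ n)" by (rule sums_summable)
  show "uniformly_convergent_on UNIV (\<lambda>n x. \<Sum>i<n. f i x)"
    by (rule Weierstrass_m_test'[where M = "\<lambda>n. B * r ^ n"]) (simp_all only: real_norm_def abs_abs assms(1) summ)
  have a: "summable (\<lambda>n. \<bar>f n x\<bar>)"
    by (rule summable_comparison_test'[of "\<lambda>n. B * r ^ n" 0]) (simp_all only: real_norm_def abs_abs assms(1) summ)
  then show "summable (\<lambda>n. f n x)" by (rule summable_rabs_cancel)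
  have "\<bar>\<Sum>n. f n x\<bar> \<le> (\<Sum>n. \<bar>f n x\<bar>)" using a by (rule summable_rabs)
  also have "\<dots> \<le> (\<Sum>n. B * r ^ n)"
    using assms(1) a summ by (intro suminf_le)
  finally show "\<bar>\<Sum>n. f n x\<bar> \<le> B / (1 - r)" using s by (simp add: sums_iff)
qed

lemma tendsto_of_geometric_bound:
  fixes a :: "nat \<Rightarrow> real"
  assumes "\<And>n. \<bar>l - a n\<bar> \<le> B * r ^ n" "0 \<le> r" "r < 1"
  shows "a \<longlonglongrightarrow> l"
proof -
  have "(\<lambda>n. B * r ^ n) \<longlonglongrightarrow> 0"
    using assms(2,3) by (intro tendsto_mult_right_zero LIMSEQ_realpow_zero)
  then have "(\<lambda>n. a n - l) \<longlonglongrightarrow> 0"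
    by (rule Lim_null_comparison[rotated]) (use assms(1) in \<open>simp add: abs_minus_commute\<close>)
  then show ?thesis by (simp add: LIM_zero_iff)
qed

text \<open>The Weierstrass test applied to each of the first k derivatives: a geometrically convergent
series in C^k may be differentiated term by term.\<close>

lemma periodic_C_series:
  fixes f :: "nat \<Rightarrow> real \<Rightarrow> real"
  assumes f: "\<And>n. f n \<in> periodic_C k" "\<And>n. C_norm_le k (f n) (B * r ^ n)"
    and r: "0 \<le> r" "r < 1"
  shows "(\<lambda>x. \<Sum>n. f n x) \<in> periodic_C k"
    and "C_norm_le k (\<lambda>x. \<Sum>n. f n x) (B / (1 - r))"
proof -
  define F where "F j x = (\<Sum>n. (deriv ^^ j) (f n) x)" for j x
  have bd: "\<bar>(deriv ^^ j) (f n) x\<bar> \<le> B * r ^ n" if "j \<le> k" for j n x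
    using f(2) that by (rule C_norm_leD)
  have DF: "(F j has_real_derivative F (Suc j) x) (at x)" if "j < k" for j x
    unfolding F_def
  proof (rule has_field_derivative_series'(2)[of UNIV _ _ x])
    show "((deriv ^^ j) (f n) has_real_derivative (deriv ^^ Suc j) (f n) y) (at y within UNIV)" for n y
      using f(1) that periodic_C_DERIV by blast
    show "uniformly_convergent_on UNIV (\<lambda>n x. \<Sum>i<n. (deriv ^^ Suc j) (f i) x)"
      using bd[of "Suc j"] that r by (intro uniformly_convergent_geometric(1)[of _ B r]) auto
    show "summable (\<lambda>n. (deriv ^^ j) (f n) x)"
      using bd[of j] that r by (intro uniformly_convergent_geometric(2)) auto
  qed auto
  have contF: "continuous_on UNIV (F k)"
  proof -
    have "uniformly_convergent_on UNIV (\<lambda>n x. \<Sum>i<n. (deriv ^^ k) (f i) x)"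
      using bd r by (intro uniformly_convergent_geometric(1)) auto
    then have "uniform_limit UNIV (\<lambda>n x. \<Sum>i<n. (deriv ^^ k) (f i) x) (F k) sequentially"
      unfolding uniformly_convergent_uniform_limit_iff F_def
      by (simp add: suminf_eq_lim)
    then show ?thesis
    proof (rule uniform_limit_theorem[rotated])
      have "continuous_on UNIV ((deriv ^^ k) (f i))" for i
        using periodic_C_continuous[OF periodic_C_deriv_iterate[OF f(1), of k 0]] by simp
      then show "\<forall>\<^sub>F n in sequentially. continuous_on UNIV (\<lambda>x. \<Sum>i<n. (deriv ^^ k) (f i) x)"
        by (intro always_eventually allI continuous_on_sum)
    qed simp
  qed
  have it: "(deriv ^^ j) (F 0) = F j" if "j \<le> k" for j
    using that
  proof (induction j)
    case (Suc j)
    then have "deriv (F j) = F (Suc j)" using DF by (intro ext DERIV_imp_deriv) simp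
    then show ?case using Suc by simp
  qed simp
  have F0: "F 0 = (\<lambda>x. \<Sum>n. f n x)" by (auto simp: F_def)
  have "C_class k (F 0)"
    unfolding C_class_def
  proof (intro conjI allI impI)
    show "(deriv ^^ i) (F 0) differentiable at x" if "i < k" for i x
      using it[of i] DF[OF that] that by (auto simp: real_differentiable_def)
    show "continuous_on UNIV ((deriv ^^ k) (F 0))" using it contF by simp
  qed
  moreover have "circle_fun (F 0)"
    using f(1) by (simp add: circle_fun_def F_def periodic_C_def)
  ultimately show "(\<lambda>x. \<Sum>n. f n x) \<in> periodic_C k"
    by (simp add: F0[symmetric] periodic_C_def)
  show "C_norm_le k (\<lambda>x. \<Sum>n. f n x) (B / (1 - r))"
    unfolding F0[symmetric] C_norm_le_def
  proof (intro allI impI)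
    fix j x assume "j \<le> k"
    then show "\<bar>(deriv ^^ j) (F 0) x\<bar> \<le> B / (1 - r)"
      using uniformly_convergent_geometric(3)[of "\<lambda>n. (deriv ^^ j) (f n)" B r x] bd r
      by (simp add: it F_def)
  qed
qed

text \<open>The cone of functions whose logarithmic derivatives up to order k are bounded. With
\<kappa> 0 = 1 the condition of order 0 says that the function is nonnegative.\<close>

definition deriv_cone :: "(nat \<Rightarrow> real) \<Rightarrow> nat \<Rightarrow> (real \<Rightarrow> real) set" where
  "deriv_cone \<kappa> k = {f \<in> periodic_C k. \<forall>j\<le>k. \<forall>x. \<bar>(deriv ^^ j) f x\<bar> \<le> \<kappa> j * f x}"

text \<open>The abstract contraction principle. Strict invariance is required only for the derivatives of
positive order: at order 0 there is nothing to gain, because Q preserves the mean. The lower bound 1 on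
\<kappa> makes every smooth function the difference of an element of the cone and of a constant, both controlled by
its norm.\<close>

locale cone_contraction =
  fixes Q :: "(real \<Rightarrow> real) \<Rightarrow> real \<Rightarrow> real"
    and \<kappa> :: "nat \<Rightarrow> real" and \<eta> :: real and k :: nat
  assumes Q_periodic_C: "f \<in> periodic_C k \<Longrightarrow> Q f \<in> periodic_C k"
    and Q_lincomb: "f \<in> periodic_C k \<Longrightarrow> g \<in> periodic_C k \<Longrightarrow>
      Q (\<lambda>x. a * f x + b * g x) = (\<lambda>x. a * Q f x + b * Q g x)"
    and Q_mean: "f \<in> periodic_C k \<Longrightarrow> circle_mean (Q f) = circle_mean f"
    and Q_cone: "f \<in> deriv_cone \<kappa> k \<Longrightarrow> Q f \<in> deriv_cone (\<lambda>j. if j = 0 then 1 else \<eta> * \<kappa> j) k"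
    and \<kappa>_0: "\<kappa> 0 = 1" and \<kappa>_ge_1: "1 \<le> \<kappa> j"
    and \<eta>: "0 < \<eta>" "\<eta> < 1" and k_pos: "1 \<le> k"
begin

lemma coneD: "f \<in> deriv_cone \<kappa> k \<Longrightarrow> f \<in> periodic_C k"
  "f \<in> deriv_cone \<kappa> k \<Longrightarrow> j \<le> k \<Longrightarrow> \<bar>(deriv ^^ j) f x\<bar> \<le> \<kappa> j * f x"
  by (auto simp: deriv_cone_def)

lemma cone_nonneg: "f \<in> deriv_cone \<kappa> k \<Longrightarrow> 0 \<le> f x"
  using coneD(2)[of f 0 x] \<kappa>_0 by simp

text \<open>The condition on the first derivative bounds the derivative of the logarithm, so on a circle of
length 1 any two values differ at most by the factor exp (\<kappa> 1). To avoid taking logarithms of a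
function that may vanish, the proof uses that f t * exp (\<kappa> 1 * t) is nondecreasing.\<close>

lemma cone_Harnack:
  assumes f: "f \<in> deriv_cone \<kappa> k"
  shows "f y \<le> exp (\<kappa> 1) * f x"
proof -
  \<comment> \<open>the representative of y modulo 1 that lies in the interval from x - 1 to x\<close>
  define z where "z = x - frac (x - y)"
  have fz: "f z = f y"
    using circle_fun_shift_int[OF periodic_C_circle[OF coneD(1)[OF f]], of y "\<lfloor>x - y\<rfloor>"]
    by (simp add: z_def frac_def algebra_simps)
  have zx: "z \<le> x" "x - z \<le> 1" by (simp_all add: z_def frac_lt_1 less_imp_le)
  have "f z * exp (\<kappa> 1 * z) \<le> f x * exp (\<kappa> 1 * x)"
  proof (rule DERIV_nonneg_imp_nondecreasing[OF zx(1)])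
    fix t
    have D: "(f has_real_derivative deriv f t) (at t)"
      using periodic_C_DERIV[OF coneD(1)[OF f], of 0 t] k_pos by simp
    have "((\<lambda>t. f t * exp (\<kappa> 1 * t)) has_real_derivative
        (deriv f t + \<kappa> 1 * f t) * exp (\<kappa> 1 * t)) (at t)"
      by (auto intro!: derivative_eq_intros D simp: algebra_simps)
    moreover have "0 \<le> deriv f t + \<kappa> 1 * f t"
      using coneD(2)[OF f, of 1 t] k_pos by simp
    ultimately show "\<exists>D. ((\<lambda>t. f t * exp (\<kappa> 1 * t)) has_real_derivative D) (at t) \<and> 0 \<le> D"
      by auto
  qed
  then have "f z \<le> f x * exp (\<kappa> 1 * x) / exp (\<kappa> 1 * z)"
    by (simp add: field_simps)
  also have "\<dots> = f x * exp (\<kappa> 1 * (x - z))"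
    by (simp add: exp_diff algebra_simps)
  also have "\<dots> \<le> f x * exp (\<kappa> 1)"
    using zx(2) \<kappa>_ge_1[of 1] mult_left_mono[of "x - z" 1 "\<kappa> 1"]
    by (intro mult_left_mono cone_nonneg[OF f]) simp
  finally show ?thesis by (simp add: fz mult.commute)
qed

lemma cone_mean_bounds:
  assumes f: "f \<in> deriv_cone \<kappa> k"
  shows "exp (- \<kappa> 1) * circle_mean f \<le> f x" and "f x \<le> exp (\<kappa> 1) * circle_mean f"
    and "0 \<le> circle_mean f"
proof -
  have fp: "f \<in> periodic_C k" using f by (rule coneD)
  have "circle_mean f \<le> circle_mean (\<lambda>_. exp (\<kappa> 1) * f x)"
    by (intro circle_mean_mono[OF fp periodic_C_const] cone_Harnack f)
  then show "exp (- \<kappa> 1) * circle_mean f \<le> f x"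
    by (simp add: circle_mean_const exp_minus field_simps)
  have "f x \<le> circle_mean (\<lambda>y. exp (\<kappa> 1) * f y)"
    using circle_mean_mono[OF periodic_C_const[of "f x" 0] periodic_C_cmult[OF fp]] cone_Harnack[OF f]
    by (simp add: circle_mean_const)
  then show "f x \<le> exp (\<kappa> 1) * circle_mean f"
    using circle_mean_lincomb[OF fp fp, of "exp (\<kappa> 1)" 0] by simp
  show "0 \<le> circle_mean f"
    using circle_mean_mono[OF periodic_C_const[of 0 0] fp] cone_nonneg[OF f]
    by (simp add: circle_mean_const)
qed

text \<open>The fraction of the mean that remains after a constant has been split off.\<close>

definition \<theta> :: real where "\<theta> = 1 - (1 - \<eta>) * exp (- \<kappa> 1)"

lemma \<theta>: "0 \<le> \<theta>" "\<theta> < 1"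
proof -
  have "exp (- \<kappa> 1) \<le> 1" using \<kappa>_ge_1[of 1] by simp
  then have "(1 - \<eta>) * exp (- \<kappa> 1) \<le> 1 * 1" using \<eta> by (intro mult_mono) auto
  then show "0 \<le> \<theta>" by (simp add: \<theta>_def)
  show "\<theta> < 1" using \<eta> by (simp add: \<theta>_def)
qed

text \<open>The mechanism of the contraction. Applying Q shrinks the derivatives of positive order by \<eta>,
and this slack pays for subtracting the fraction 1 - \<eta> of the lower bound of the function. The constant
that is removed depends on f only through its mean, so it cancels in differences of functions with the same
mean.\<close>

lemma cone_split_constant:
  assumes f: "f \<in> deriv_cone \<kappa> k"
  defines "c \<equiv> (1 - \<eta>) * (exp (- \<kappa> 1) * circle_mean f)"
  shows "(\<lambda>x. Q f x - c) \<in> deriv_cone \<kappa> k"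
    and "circle_mean (\<lambda>x. Q f x - c) = \<theta> * circle_mean f"
proof -
  have fp: "f \<in> periodic_C k" using f by (rule coneD)
  have Qp: "Q f \<in> periodic_C k" using fp by (rule Q_periodic_C)
  have Qd: "\<bar>(deriv ^^ j) (Q f) x\<bar> \<le> \<eta> * \<kappa> j * Q f x" if "1 \<le> j" "j \<le> k" for j x
    using Q_cone[OF f] that by (auto simp: deriv_cone_def)
  have Q0: "0 \<le> Q f x" for x
    using Q_cone[OF f] by (force simp: deriv_cone_def)
  have "Q f \<in> deriv_cone \<kappa> k"
    unfolding deriv_cone_def
  proof (intro CollectI conjI Qp allI impI)
    fix j x assume j: "j \<le> k"
    show "\<bar>(deriv ^^ j) (Q f) x\<bar> \<le> \<kappa> j * Q f x"
    proof (cases "j = 0")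
      case True
      then show ?thesis using Q0 \<kappa>_0 by simp
    next
      case False
      have "\<eta> * (\<kappa> j * Q f x) \<le> 1 * (\<kappa> j * Q f x)"
        using \<eta> Q0[of x] \<kappa>_ge_1[of j] by (intro mult_right_mono) auto
      then show ?thesis using Qd[of j x] False j by (simp add: mult.assoc)
    qed
  qed
  note lower = cone_mean_bounds(1,3)[OF this, unfolded Q_mean[OF fp]]
  have c: "c \<le> (1 - \<eta>) * Q f x" for x
    unfolding c_def using \<eta> lower(1) by (intro mult_left_mono) auto
  show "(\<lambda>x. Q f x - c) \<in> deriv_cone \<kappa> k"
    unfolding deriv_cone_def
  proof (intro CollectI conjI allI impI)
    show "(\<lambda>x. Q f x - c) \<in> periodic_C k"
      using Qp periodic_C_const by (rule periodic_C_diff)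
    fix j x assume j: "j \<le> k"
    have der: "(deriv ^^ j) (\<lambda>x. Q f x - c) x = (deriv ^^ j) (Q f) x - (if j = 0 then c else 0)"
      using periodic_C_deriv_iterate_diff[OF Qp periodic_C_const j, of c x]
      by (simp add: deriv_iterate_const)
    have le: "\<eta> * Q f x \<le> Q f x - c" using c[of x] by (simp add: algebra_simps)
    show "\<bar>(deriv ^^ j) (\<lambda>x. Q f x - c) x\<bar> \<le> \<kappa> j * (Q f x - c)"
    proof (cases "j = 0")
      case True
      have "0 \<le> \<eta> * Q f x" using \<eta> Q0 by simp
      then show ?thesis using le \<kappa>_0 True by simp
    next
      case False
      have "\<bar>(deriv ^^ j) (\<lambda>x. Q f x - c) x\<bar> \<le> \<eta> * \<kappa> j * Q f x"
        using Qd[of j x] False j der by simp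
      also have "\<dots> = \<kappa> j * (\<eta> * Q f x)" by simp
      also have "\<dots> \<le> \<kappa> j * (Q f x - c)"
        using le \<kappa>_ge_1[of j] by (intro mult_left_mono) auto
      finally show ?thesis .
    qed
  qed
  show "circle_mean (\<lambda>x. Q f x - c) = \<theta> * circle_mean f"
    using circle_mean_diff[OF Qp periodic_C_const[of c 0]] Q_mean[OF fp]
    by (simp add: circle_mean_const c_def \<theta>_def algebra_simps)
qed

lemma Q_diff: "f \<in> periodic_C k \<Longrightarrow> g \<in> periodic_C k \<Longrightarrow> Q (\<lambda>x. f x - g x) = (\<lambda>x. Q f x - Q g x)"
  using Q_lincomb[of f g 1 "-1"] by simp

lemma Q_add: "f \<in> periodic_C k \<Longrightarrow> g \<in> periodic_C k \<Longrightarrow> Q (\<lambda>x. f x + g x) = (\<lambda>x. Q f x + Q g x)"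
  using Q_lincomb[of f g 1 1] by simp

lemma Q_iterate_periodic_C: "f \<in> periodic_C k \<Longrightarrow> (Q ^^ n) f \<in> periodic_C k"
  by (induction n) (auto intro: Q_periodic_C)

lemma Q_iterate_mean: "f \<in> periodic_C k \<Longrightarrow> circle_mean ((Q ^^ n) f) = circle_mean f"
  by (induction n) (auto simp: Q_mean Q_iterate_periodic_C)

lemma Q_iterate_diff: "f \<in> periodic_C k \<Longrightarrow> g \<in> periodic_C k \<Longrightarrow>
  (Q ^^ n) (\<lambda>x. f x - g x) = (\<lambda>x. (Q ^^ n) f x - (Q ^^ n) g x)"
  by (induction n) (auto simp: Q_diff Q_iterate_periodic_C)

lemma cone_add_const:
  assumes f: "f \<in> deriv_cone \<kappa> k" and c: "0 \<le> c"
  shows "(\<lambda>x. f x + c) \<in> deriv_cone \<kappa> k"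
  unfolding deriv_cone_def
proof (intro CollectI conjI allI impI)
  show "(\<lambda>x. f x + c) \<in> periodic_C k"
    using coneD(1)[OF f] periodic_C_const by (rule periodic_C_add)
  fix j x assume j: "j \<le> k"
  have "(deriv ^^ j) (\<lambda>x. f x + c) x = (deriv ^^ j) f x + (if j = 0 then c else 0)"
    using periodic_C_deriv_iterate_lincomb[OF coneD(1)[OF f] periodic_C_const j, of 1 1 c x]
    by (simp add: deriv_iterate_const)
  moreover have "0 \<le> \<kappa> j * c" using \<kappa>_ge_1[of j] c by simp
  ultimately show "\<bar>(deriv ^^ j) (\<lambda>x. f x + c) x\<bar> \<le> \<kappa> j * (f x + c)"
    using coneD(2)[OF f j, of x] \<kappa>_0 c cone_nonneg[OF f, of x] by (auto simp: distrib_left)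
qed

lemma Q_cone_self:
  assumes f: "f \<in> deriv_cone \<kappa> k" shows "Q f \<in> deriv_cone \<kappa> k"
proof -
  have "0 \<le> (1 - \<eta>) * (exp (- \<kappa> 1) * circle_mean f)"
    using \<eta> cone_mean_bounds(3)[OF f] by simp
  from cone_add_const[OF cone_split_constant(1)[OF f] this] show ?thesis by simp
qed

lemma Q_iterate_cone: "f \<in> deriv_cone \<kappa> k \<Longrightarrow> (Q ^^ n) f \<in> deriv_cone \<kappa> k"
  by (induction n) (auto intro: Q_cone_self)

text \<open>In each step the same constant is split off from both functions; their difference is unchanged,
while both means are multiplied by \<theta>.\<close>

lemma Q_iterate_diff_cone:
  assumes "f \<in> deriv_cone \<kappa> k" "g \<in> deriv_cone \<kappa> k" "circle_mean f = circle_mean g"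
  shows "\<exists>f'\<in>deriv_cone \<kappa> k. \<exists>g'\<in>deriv_cone \<kappa> k.
    circle_mean f' = \<theta> ^ n * circle_mean f \<and> circle_mean g' = \<theta> ^ n * circle_mean f \<and>
    (Q ^^ n) (\<lambda>x. f x - g x) = (\<lambda>x. f' x - g' x)"
proof (induction n)
  case 0
  then show ?case using assms by auto
next
  case (Suc n)
  then obtain f' g' where *: "f' \<in> deriv_cone \<kappa> k" "g' \<in> deriv_cone \<kappa> k"
    "circle_mean f' = \<theta> ^ n * circle_mean f" "circle_mean g' = \<theta> ^ n * circle_mean f"
    "(Q ^^ n) (\<lambda>x. f x - g x) = (\<lambda>x. f' x - g' x)" by blast
  define c where "c = (1 - \<eta>) * (exp (- \<kappa> 1) * (\<theta> ^ n * circle_mean f))"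
  have "(Q ^^ Suc n) (\<lambda>x. f x - g x) = (\<lambda>x. (Q f' x - c) - (Q g' x - c))"
    using *(1,2,5) by (simp add: Q_diff coneD(1))
  moreover note cone_split_constant[OF *(1)] cone_split_constant[OF *(2)]
  ultimately show ?case
    unfolding *(3,4) c_def[symmetric]
    by (intro bexI[of _ "\<lambda>x. Q f' x - c"] bexI[of _ "\<lambda>x. Q g' x - c"]) auto
qed

text \<open>A common bound for the norms of Q and, up to powers of \<theta>, of its iterates on functions with
mean zero. The factor 5 comes from writing a function g of norm M as the difference of g + 2 M, whose
mean is at most 3 M, and of 2 M.\<close>

definition C\<^sub>0 :: real where "C\<^sub>0 = 5 * exp (\<kappa> 1) * (\<Sum>j\<le>k. \<kappa> j)"

lemma C\<^sub>0_nonneg: "0 \<le> C\<^sub>0"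
  unfolding C\<^sub>0_def using \<kappa>_ge_1 by (intro mult_nonneg_nonneg sum_nonneg) (auto intro: order_trans[of 0 1])

lemma cone_deriv_le:
  assumes f: "f \<in> deriv_cone \<kappa> k" and j: "j \<le> k"
  shows "\<bar>(deriv ^^ j) f x\<bar> \<le> C\<^sub>0 / 5 * circle_mean f"
proof -
  have "\<kappa> j \<le> (\<Sum>j\<le>k. \<kappa> j)"
    using j \<kappa>_ge_1 by (intro member_le_sum) (auto intro: order_trans[of 0 1])
  have "\<bar>(deriv ^^ j) f x\<bar> \<le> \<kappa> j * f x" using f j by (rule coneD)
  also have "\<dots> \<le> (\<Sum>j\<le>k. \<kappa> j) * (exp (\<kappa> 1) * circle_mean f)"
    using \<open>\<kappa> j \<le> _\<close> \<kappa>_ge_1[of j] cone_mean_bounds(2)[OF f] cone_nonneg[OF f]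
    by (intro mult_mono) auto
  finally show ?thesis by (simp add: C\<^sub>0_def mult.commute mult.left_commute)
qed

text \<open>With the constant M alone the sum could vanish where a derivative does not; with 2 M it is at
least M everywhere.\<close>

lemma add_const_in_cone:
  assumes "g \<in> periodic_C k" "C_norm_le k g M"
  shows "(\<lambda>x. g x + 2 * M) \<in> deriv_cone \<kappa> k"
  unfolding deriv_cone_def
proof (intro CollectI conjI allI impI)
  show "(\<lambda>x. g x + 2 * M) \<in> periodic_C k"
    using assms(1) periodic_C_const by (rule periodic_C_add)
  fix j x assume j: "j \<le> k"
  have d: "(deriv ^^ j) (\<lambda>x. g x + 2 * M) x = (deriv ^^ j) g x + (if j = 0 then 2 * M else 0)"
    using periodic_C_deriv_iterate_lincomb[OF assms(1) periodic_C_const j, of 1 1 "2 * M" x]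
    by (simp add: deriv_iterate_const)
  have M: "M \<le> g x + 2 * M" "0 \<le> M"
    using C_norm_le_0[OF assms(2), of x] C_norm_le_nonneg[OF assms(2)] by auto
  have "g x + 2 * M \<le> \<kappa> j * (g x + 2 * M)"
    using M \<kappa>_ge_1[of j] mult_right_mono[of 1 "\<kappa> j" "g x + 2 * M"] by simp
  then show "\<bar>(deriv ^^ j) (\<lambda>x. g x + 2 * M) x\<bar> \<le> \<kappa> j * (g x + 2 * M)"
    using d M C_norm_leD[OF assms(2) j, of x] by (cases "j = 0") auto
qed

lemma Q_bounded:
  assumes g: "g \<in> periodic_C k" "C_norm_le k g M"
  shows "C_norm_le k (Q g) (C\<^sub>0 * M)"
  unfolding C_norm_le_def
proof (intro allI impI)
  fix j x assume j: "j \<le> k"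
  have M: "0 \<le> M" using g(2) by (rule C_norm_le_nonneg)
  define u where "u = (\<lambda>x. g x + 2 * M)"
  define v where "v = (\<lambda>x::real. 2 * M)"
  have u: "u \<in> deriv_cone \<kappa> k" unfolding u_def using g by (rule add_const_in_cone)
  have v: "v \<in> deriv_cone \<kappa> k"
    using add_const_in_cone[OF periodic_C_const[of 0], of M] M
    by (simp add: v_def C_norm_le_def deriv_iterate_const)
  have mv: "circle_mean v = 2 * M" by (simp add: v_def circle_mean_const)
  have "circle_mean u = circle_mean g + 2 * M"
    unfolding u_def using circle_mean_add[OF g(1) periodic_C_const[of "2 * M" 0]]
    by (simp add: circle_mean_const)
  also have "\<dots> \<le> 3 * M" using circle_mean_abs_le[OF g(1) C_norm_le_0[OF g(2)]] by simp
  finally have mu: "circle_mean u \<le> 3 * M" .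
  have "g = (\<lambda>x. u x - v x)" by (auto simp: u_def v_def)
  then have "Q g = (\<lambda>x. Q u x - Q v x)" using Q_diff[OF coneD(1)[OF u] coneD(1)[OF v]] by simp
  then have "(deriv ^^ j) (Q g) x = (deriv ^^ j) (Q u) x - (deriv ^^ j) (Q v) x"
    using periodic_C_deriv_iterate_diff[OF Q_periodic_C[OF coneD(1)[OF u]] Q_periodic_C[OF coneD(1)[OF v]] j]
    by simp
  moreover have "\<bar>(deriv ^^ j) (Q u) x\<bar> \<le> C\<^sub>0 / 5 * (3 * M)"
    using cone_deriv_le[OF Q_cone_self[OF u] j, of x] mu C\<^sub>0_nonneg
      mult_left_mono[OF mu, of "C\<^sub>0 / 5"] by (simp add: Q_mean coneD(1)[OF u])
  moreover have "\<bar>(deriv ^^ j) (Q v) x\<bar> \<le> C\<^sub>0 / 5 * (2 * M)"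
    using cone_deriv_le[OF Q_cone_self[OF v] j, of x] mv by (simp add: Q_mean coneD(1)[OF v])
  ultimately show "\<bar>(deriv ^^ j) (Q g) x\<bar> \<le> C\<^sub>0 * M" by (simp add: field_simps)
qed

text \<open>The spectral gap: a function with mean zero is a difference of two elements of the cone with
equal means, and after n steps both of these have been replaced by elements with mean at most
2 M \<theta>^n.\<close>

lemma Q_iterate_decay:
  assumes g: "g \<in> periodic_C k" "C_norm_le k g M" "circle_mean g = 0"
  shows "C_norm_le k ((Q ^^ n) g) (C\<^sub>0 * M * \<theta> ^ n)"
  unfolding C_norm_le_def
proof (intro allI impI)
  fix j x assume j: "j \<le> k"
  have M: "0 \<le> M" using g(2) by (rule C_norm_le_nonneg)
  define u where "u = (\<lambda>x. g x + 2 * M)"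
  define v where "v = (\<lambda>x::real. 2 * M)"
  have u: "u \<in> deriv_cone \<kappa> k" unfolding u_def using g(1,2) by (rule add_const_in_cone)
  have v: "v \<in> deriv_cone \<kappa> k"
    using add_const_in_cone[OF periodic_C_const[of 0], of M] M
    by (simp add: v_def C_norm_le_def deriv_iterate_const)
  have mv: "circle_mean v = 2 * M" by (simp add: v_def circle_mean_const)
  have mu: "circle_mean u = 2 * M"
    unfolding u_def using circle_mean_add[OF g(1) periodic_C_const[of "2 * M" 0]] g(3)
    by (simp add: circle_mean_const)
  obtain u' v' where *: "u' \<in> deriv_cone \<kappa> k" "v' \<in> deriv_cone \<kappa> k"
    "circle_mean u' = \<theta> ^ n * (2 * M)" "circle_mean v' = \<theta> ^ n * (2 * M)"
    "(Q ^^ n) (\<lambda>x. u x - v x) = (\<lambda>x. u' x - v' x)"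
    using Q_iterate_diff_cone[OF u v, of n] mu mv by auto
  have "g = (\<lambda>x. u x - v x)" by (auto simp: u_def v_def)
  then have "(deriv ^^ j) ((Q ^^ n) g) x = (deriv ^^ j) u' x - (deriv ^^ j) v' x"
    using periodic_C_deriv_iterate_diff[OF coneD(1)[OF *(1)] coneD(1)[OF *(2)] j] *(5) by simp
  moreover have "\<bar>(deriv ^^ j) u' x\<bar> \<le> C\<^sub>0 / 5 * (\<theta> ^ n * (2 * M))"
    "\<bar>(deriv ^^ j) v' x\<bar> \<le> C\<^sub>0 / 5 * (\<theta> ^ n * (2 * M))"
    using cone_deriv_le[OF *(1) j, of x] cone_deriv_le[OF *(2) j, of x] *(3,4) by simp_all
  moreover have "2 * (C\<^sub>0 / 5 * (\<theta> ^ n * (2 * M))) \<le> C\<^sub>0 * M * \<theta> ^ n"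
  proof -
    have "0 \<le> C\<^sub>0 * (M * \<theta> ^ n)" using C\<^sub>0_nonneg M \<theta> by simp
    then show ?thesis by (simp add: field_simps)
  qed
  ultimately show "\<bar>(deriv ^^ j) ((Q ^^ n) g) x\<bar> \<le> C\<^sub>0 * M * \<theta> ^ n" by linarith
qed

text \<open>The Neumann series, which inverts Id - Q on functions with mean zero.\<close>

definition R :: "(real \<Rightarrow> real) \<Rightarrow> real \<Rightarrow> real" where
  "R g x = (\<Sum>n. (Q ^^ n) g x)"

definition C\<^sub>1 :: real where "C\<^sub>1 = C\<^sub>0 / (1 - \<theta>)"

lemma R_periodic_C:
  assumes g: "g \<in> periodic_C k" "circle_mean g = 0"
  shows "R g \<in> periodic_C k"
proof -
  obtain M where M: "C_norm_le k g M" using C_norm_le_exists[OF g(1)] .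
  show ?thesis
    unfolding R_def[abs_def]
    using Q_iterate_periodic_C[OF g(1)] Q_iterate_decay[OF g(1) M g(2)] \<theta>
    by (rule periodic_C_series)
qed

lemma R_bounded:
  assumes g: "g \<in> periodic_C k" "C_norm_le k g M" "circle_mean g = 0"
  shows "C_norm_le k (R g) (C\<^sub>1 * M)"
  using periodic_C_series(2)[OF Q_iterate_periodic_C[OF g(1)] Q_iterate_decay[OF g] \<theta>]
  by (simp add: R_def[abs_def] C\<^sub>1_def)

lemma R_remainder:
  assumes g: "g \<in> periodic_C k" "C_norm_le k g M" "circle_mean g = 0"
  shows "C_norm_le k (\<lambda>x. R g x - (\<Sum>n<N. (Q ^^ n) g x)) (C\<^sub>1 * M * \<theta> ^ N)"
proof -
  have "R g x - (\<Sum>n<N. (Q ^^ n) g x) = (\<Sum>n. (Q ^^ (n + N)) g x)" for x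
    unfolding R_def
    using uniformly_convergent_geometric(2)[of "\<lambda>n. (Q ^^ n) g" "C\<^sub>0 * M" \<theta> x]
      C_norm_le_0[OF Q_iterate_decay[OF g]] \<theta> suminf_minus_initial_segment by force
  moreover have "C_norm_le k (\<lambda>x. \<Sum>n. (Q ^^ (n + N)) g x) (C\<^sub>0 * M * \<theta> ^ N / (1 - \<theta>))"
  proof (rule periodic_C_series(2)[OF _ _ \<theta>])
    show "(Q ^^ (n + N)) g \<in> periodic_C k" for n by (rule Q_iterate_periodic_C[OF g(1)])
    show "C_norm_le k ((Q ^^ (n + N)) g) (C\<^sub>0 * M * \<theta> ^ N * \<theta> ^ n)" for n
      using Q_iterate_decay[OF g, of "n + N"] by (simp add: power_add mult_ac)
  qed
  ultimately show ?thesis by (simp add: C\<^sub>1_def mult_ac)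
qed

lemma R_mean:
  assumes g: "g \<in> periodic_C k" "circle_mean g = 0"
  shows "circle_mean (R g) = 0"
proof -
  obtain M where M: "C_norm_le k g M" using C_norm_le_exists[OF g(1)] .
  have "\<bar>circle_mean (R g)\<bar> \<le> C\<^sub>1 * M * \<theta> ^ N" for N
  proof -
    have S: "(\<lambda>x. \<Sum>n<N. (Q ^^ n) g x) \<in> periodic_C k"
      by (intro periodic_C_sum Q_iterate_periodic_C g)
    have "circle_mean (\<lambda>x. \<Sum>n<N. (Q ^^ n) g x) = 0"
    proof (induction N)
      case (Suc N)
      have "(\<lambda>x. \<Sum>n<N. (Q ^^ n) g x) \<in> periodic_C k"
        by (intro periodic_C_sum Q_iterate_periodic_C g)
      then show ?case
        using Suc circle_mean_add[OF _ Q_iterate_periodic_C[OF g(1)], of _ k N]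
        by (simp add: Q_iterate_mean g)
    qed (simp add: circle_mean_const)
    then have "circle_mean (\<lambda>x. R g x - (\<Sum>n<N. (Q ^^ n) g x)) = circle_mean (R g)"
      using circle_mean_diff[OF R_periodic_C[OF g] S] by simp
    then show ?thesis
      using circle_mean_abs_le[OF periodic_C_diff[OF R_periodic_C[OF g] S]
          C_norm_le_0[OF R_remainder[OF g(1) M g(2)]]] by simp
  qed
  moreover have "(\<lambda>N. C\<^sub>1 * M * \<theta> ^ N) \<longlonglongrightarrow> 0"
    using \<theta> by (intro tendsto_mult_right_zero LIMSEQ_realpow_zero)
  ultimately have "\<bar>circle_mean (R g)\<bar> \<le> 0" by (intro LIMSEQ_le_const) auto
  then show ?thesis by simp
qed

text \<open>Q maps the partial sum of order N to the partial sum of order N + 1 without its first term, and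
Q may be exchanged with the limit because it is bounded in C^k.\<close>

lemma R_inverse_left:
  assumes g: "g \<in> periodic_C k" "circle_mean g = 0"
  shows "R g x - Q (R g) x = g x"
proof -
  obtain M where M: "C_norm_le k g M" using C_norm_le_exists[OF g(1)] .
  define S where "S N = (\<lambda>x. \<Sum>n<N. (Q ^^ n) g x)" for N
  have S: "S N \<in> periodic_C k" for N
    unfolding S_def by (intro periodic_C_sum Q_iterate_periodic_C g)
  have Rp: "R g \<in> periodic_C k" using g by (rule R_periodic_C)
  have rem: "C_norm_le k (\<lambda>x. R g x - S N x) (C\<^sub>1 * M * \<theta> ^ N)" for N
    unfolding S_def using g(1) M g(2) by (rule R_remainder)
  have QS: "Q (S N) x = S (Suc N) x - g x" for N
  proof (induction N)
    case 0
    have "Q (\<lambda>x. 0) = (\<lambda>x. 0)" using Q_lincomb[OF g(1) g(1), of 0 0] by simp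
    then show ?case by (simp add: S_def)
  next
    case (Suc N)
    have "Q (S (Suc N)) = (\<lambda>x. Q (S N) x + Q ((Q ^^ N) g) x)"
      using Q_add[OF S Q_iterate_periodic_C[OF g(1)], of N N] by (simp add: S_def)
    then show ?case using Suc by (simp add: S_def)
  qed
  have SR: "(\<lambda>N. S N x) \<longlonglongrightarrow> R g x"
    by (rule tendsto_of_geometric_bound[OF _ \<theta>]) (rule C_norm_le_0[OF rem])
  have "(\<lambda>N. Q (S N) x) \<longlonglongrightarrow> Q (R g) x"
  proof (rule tendsto_of_geometric_bound[OF _ \<theta>])
    fix N
    have "C_norm_le k (Q (\<lambda>x. R g x - S N x)) (C\<^sub>0 * (C\<^sub>1 * M * \<theta> ^ N))"
      using periodic_C_diff[OF Rp S] rem by (rule Q_bounded)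
    then show "\<bar>Q (R g) x - Q (S N) x\<bar> \<le> C\<^sub>0 * (C\<^sub>1 * M) * \<theta> ^ N"
      using C_norm_le_0[of k _ _ x] by (fastforce simp: Q_diff[OF Rp S] mult.assoc)
  qed
  moreover have "(\<lambda>N. Q (S N) x) \<longlonglongrightarrow> R g x - g x"
    unfolding QS by (intro tendsto_diff tendsto_const LIMSEQ_Suc SR)
  ultimately have "Q (R g) x = R g x - g x" by (rule LIMSEQ_unique)
  then show ?thesis by simp
qed

text \<open>The difference of two solutions is a fixed point of Q with mean zero, which the decay of the
iterates forces to vanish.\<close>

lemma R_unique:
  assumes v: "v \<in> periodic_C k" "circle_mean v = 0" and g: "g \<in> periodic_C k"
    and eq: "\<And>x. v x - Q v x = g x"
  shows "v = R g"
proof -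
  have mg: "circle_mean g = 0"
    using circle_mean_diff[OF v(1) Q_periodic_C[OF v(1)]] eq by (simp add: Q_mean v)
  have Rp: "R g \<in> periodic_C k" using g mg by (rule R_periodic_C)
  define e where "e = (\<lambda>x. v x - R g x)"
  have e: "e \<in> periodic_C k" unfolding e_def using v(1) Rp by (rule periodic_C_diff)
  have "Q e = e"
  proof
    fix x
    show "Q e x = e x"
      using eq[of x] R_inverse_left[OF g mg, of x] by (simp add: e_def Q_diff[OF v(1) Rp])
  qed
  then have Qe: "(Q ^^ n) e = e" for n by (induction n) auto
  have me: "circle_mean e = 0"
    using circle_mean_diff[OF v(1) Rp] v(2) R_mean[OF g mg] by (simp add: e_def)
  obtain M where M: "C_norm_le k e M" using C_norm_le_exists[OF e] .
  have "(\<lambda>n. 0) \<longlonglongrightarrow> e x" for x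
    using tendsto_of_geometric_bound[OF _ \<theta>, of "e x" "\<lambda>_. 0" "C\<^sub>0 * M"]
      C_norm_le_0[OF Q_iterate_decay[OF e M me], of _ x] by (simp add: Qe)
  then have "e x = 0" for x by (simp add: LIMSEQ_const_iff)
  then show ?thesis by (auto simp: e_def fun_eq_iff)
qed

lemma one_in_cone: "(\<lambda>x. 1) \<in> deriv_cone \<kappa> k"
  using \<kappa>_ge_1 periodic_C_const by (auto simp: deriv_cone_def deriv_iterate_const intro: order_trans[of 0 1])

text \<open>Correcting the constant density 1 by the Neumann series of its defect gives a fixed point. The
corrections up to order N add up to the N-th iterate of 1, so the fixed point is the limit of these iterates in
C^k and stays in the cone; this is what makes the bounds on its derivatives independent of Q.\<close>

lemma fixed_point_in_cone:
  obtains h where "h \<in> deriv_cone \<kappa> k" "circle_mean h = 1" "Q h = h"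
proof -
  define u where "u = (\<lambda>x::real. 1::real)"
  have u: "u \<in> deriv_cone \<kappa> k" unfolding u_def by (rule one_in_cone)
  note up = coneD(1)[OF u]
  have mu: "circle_mean u = 1" by (simp add: u_def circle_mean_const)
  define g where "g = (\<lambda>x. Q u x - u x)"
  have g: "g \<in> periodic_C k" unfolding g_def using Q_periodic_C[OF up] up by (rule periodic_C_diff)
  have mg: "circle_mean g = 0"
    unfolding g_def using circle_mean_diff[OF Q_periodic_C[OF up] up] by (simp add: Q_mean up)
  obtain M where M: "C_norm_le k g M" using C_norm_le_exists[OF g] .
  have Rp: "R g \<in> periodic_C k" using g mg by (rule R_periodic_C)
  define h where "h = (\<lambda>x. u x + R g x)"
  have hp: "h \<in> periodic_C k" unfolding h_def using up Rp by (rule periodic_C_add)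
  have S: "(\<Sum>n<N. (Q ^^ n) g x) = (Q ^^ N) u x - u x" for N x
  proof (induction N)
    case (Suc N)
    have "(Q ^^ N) g = (\<lambda>x. (Q ^^ Suc N) u x - (Q ^^ N) u x)"
      unfolding g_def using Q_iterate_diff[OF Q_periodic_C[OF up] up, of N]
      by (simp add: funpow_swap1)
    then show ?case using Suc by simp
  qed simp
  have lim: "(\<lambda>N. (deriv ^^ j) ((Q ^^ N) u) x) \<longlonglongrightarrow> (deriv ^^ j) h x" if "j \<le> k" for j x
  proof (rule tendsto_of_geometric_bound[OF _ \<theta>])
    fix N
    have "(\<lambda>x. R g x - (\<Sum>n<N. (Q ^^ n) g x)) = (\<lambda>x. h x - (Q ^^ N) u x)"
      by (auto simp: S h_def)
    then show "\<bar>(deriv ^^ j) h x - (deriv ^^ j) ((Q ^^ N) u) x\<bar> \<le> C\<^sub>1 * M * \<theta> ^ N"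
      using C_norm_leD[OF R_remainder[OF g M mg] that, of N x]
        periodic_C_deriv_iterate_diff[OF hp Q_iterate_periodic_C[OF up] that, of N x] by simp
  qed
  have "h \<in> deriv_cone \<kappa> k"
    unfolding deriv_cone_def
  proof (intro CollectI conjI hp allI impI)
    fix j x assume j: "j \<le> k"
    show "\<bar>(deriv ^^ j) h x\<bar> \<le> \<kappa> j * h x"
    proof (rule LIMSEQ_le)
      show "(\<lambda>N. \<bar>(deriv ^^ j) ((Q ^^ N) u) x\<bar>) \<longlonglongrightarrow> \<bar>(deriv ^^ j) h x\<bar>"
        by (intro tendsto_rabs lim j)
      show "(\<lambda>N. \<kappa> j * (Q ^^ N) u x) \<longlonglongrightarrow> \<kappa> j * h x"
        using lim[of 0 x] by (intro tendsto_mult_left) simp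
      show "\<exists>N. \<forall>n\<ge>N. \<bar>(deriv ^^ j) ((Q ^^ n) u) x\<bar> \<le> \<kappa> j * (Q ^^ n) u x"
        using coneD(2)[OF Q_iterate_cone[OF u] j] by blast
    qed
  qed
  moreover have "circle_mean h = 1"
    unfolding h_def using circle_mean_add[OF up Rp] mu R_mean[OF g mg] by simp
  moreover have "Q h = h"
  proof
    fix x
    have "g x = Q u x - u x" by (simp add: g_def)
    then show "Q h x = h x"
      using R_inverse_left[OF g mg, of x] by (simp add: h_def Q_add[OF up Rp])
  qed
  ultimately show ?thesis by (rule that)
qed

end

section \<open>Averaging over random translations\<close>

lemma circle_fun_set_integral_shift:
  assumes "circle_fun f"
  shows "set_integrable lborel {a + of_int n..<b + of_int n} f \<longleftrightarrow> set_integrable lborel {a..<b} f" (is ?I)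
    and "(LINT x:{a + of_int n..<b + of_int n}|lborel. f x) = (LINT x:{a..<b}|lborel. (f x :: real))" (is ?E)
proof -
  have *: "(\<lambda>x. indicator {a + of_int n..<b + of_int n} (of_int n + 1 * x) *\<^sub>R f (of_int n + 1 * x))
      = (\<lambda>x. indicator {a..<b} x *\<^sub>R f x)"
    using circle_fun_shift_int[OF assms, of _ n] by (auto simp: indicator_def add.commute)
  show ?I
    unfolding set_integrable_def
    by (subst lborel_integrable_real_affine_iff[of 1 _ "of_int n", symmetric]) (simp, simp only: *)
  show ?E
    unfolding set_lebesgue_integral_def
    by (subst lborel_integral_real_affine[of 1 _ "of_int n"]) (simp, simp only: *, simp)
qed

text \<open>The interval is cut at the integer it contains, and the pieces are moved back to [0,1) by integer
translations.\<close>

lemma circle_fun_set_integral_period: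
  assumes f: "circle_fun f" and int: "set_integrable lborel {0..<1} f"
  shows "set_integrable lborel {a..<a + 1} f"
    and "(LINT x:{a..<a + 1}|lborel. f x) = (LINT x:{0..<1}|lborel. (f x :: real))"
proof -
  define r where "r = frac a"
  have r: "0 \<le> r" "r < 1" and ar: "a = r + of_int \<lfloor>a\<rfloor>"
    by (simp_all add: r_def frac_lt_1) (simp add: frac_def)
  have i1: "set_integrable lborel {r..<1} f" and i0: "set_integrable lborel {0..<r} f"
    using r by (auto intro: set_integrable_subset[OF int])
  have i2: "set_integrable lborel {1..<r + 1} f"
    using circle_fun_set_integral_shift(1)[OF f, of 0 1 r] i0 by simp
  have un: "{r..<r + 1} = {r..<1} \<union> {1..<r + 1}" "{0..<1} = {0..<r} \<union> {r..<1}"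
    using r by auto
  have "set_integrable lborel {r..<r + 1} f"
    unfolding un using i1 i2 by (intro set_integrable_Un) auto
  then show "set_integrable lborel {a..<a + 1} f"
    using circle_fun_set_integral_shift(1)[OF f, of r "\<lfloor>a\<rfloor>" "r + 1"] ar by (simp add: algebra_simps)
  have "(LINT x:{r..<r + 1}|lborel. f x) = (LINT x:{r..<1}|lborel. f x) + (LINT x:{1..<r + 1}|lborel. f x)"
    unfolding un using i1 i2 by (intro set_integral_Un) auto
  also have "(LINT x:{1..<r + 1}|lborel. f x) = (LINT x:{0..<r}|lborel. f x)"
    using circle_fun_set_integral_shift(2)[OF f, of 0 1 r] by simp
  also have "(LINT x:{r..<1}|lborel. f x) + (LINT x:{0..<r}|lborel. f x) = (LINT x:{0..<1}|lborel. f x)"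
    unfolding un(2) using i1 i0 by (subst set_integral_Un) auto
  finally show "(LINT x:{a..<a + 1}|lborel. f x) = (LINT x:{0..<1}|lborel. f x)"
    using circle_fun_set_integral_shift(2)[OF f, of r "\<lfloor>a\<rfloor>" "r + 1"] ar by (simp add: algebra_simps)
qed

lemma circle_mean_translate:
  assumes "f \<in> periodic_C k"
  shows "circle_mean (\<lambda>x. f (x - a)) = circle_mean f"
proof -
  have "(\<lambda>x. indicator {0..<1} (a + 1 * x) *\<^sub>R f (a + 1 * x - a)) = (\<lambda>x. indicator {- a..<- a + 1} x *\<^sub>R f x)"
    by (rule ext) (auto simp: indicator_def)
  then have "circle_mean (\<lambda>x. f (x - a)) = (LINT x:{- a..<- a + 1}|lborel. f x)"
    unfolding circle_mean_def set_lebesgue_integral_def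
    by (subst lborel_integral_real_affine[of 1 _ a]) simp_all
  then show ?thesis
    using circle_fun_set_integral_period(2)[OF periodic_C_circle[OF assms] periodic_C_integrable[OF assms], of "- a"]
    by (simp add: circle_mean_def)
qed

text \<open>Convolution with \<rho>_\<delta> is averaging over translations by \<delta> z, where z is distributed according to a
fixed law \<nu> on [-1,1]. In this form \<delta> = 0 is the identity and needs no separate treatment.\<close>

locale jitter = prob_space \<nu> for \<nu> :: "real measure" +
  assumes sets_\<nu> [measurable_cong]: "sets \<nu> = sets borel"
    and support: "AE z in \<nu>. \<bar>z\<bar> \<le> 1"
begin

definition avg :: "real \<Rightarrow> (real \<Rightarrow> real) \<Rightarrow> real \<Rightarrow> real" where
  "avg \<delta> f x = (LINT z|\<nu>. f (x - \<delta> * z))"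

lemma avg_integrable:
  assumes "f \<in> periodic_C k"
  shows "integrable \<nu> (\<lambda>z. f (x - \<delta> * z))"
proof -
  obtain M where "\<And>x. \<bar>f x\<bar> \<le> M" using periodic_C_bounded[OF assms] by blast
  moreover have [measurable]: "f \<in> borel_measurable borel" using assms by (rule periodic_C_measurable)
  ultimately show ?thesis by (intro integrable_const_bound[of _ M]) auto
qed

lemma avg_lincomb:
  assumes "f \<in> periodic_C k" "g \<in> periodic_C l"
  shows "avg \<delta> (\<lambda>x. a * f x + b * g x) = (\<lambda>x. a * avg \<delta> f x + b * avg \<delta> g x)"
  unfolding avg_def using avg_integrable[OF assms(1)] avg_integrable[OF assms(2)] by simp

lemma avg_abs_le:
  assumes "f \<in> periodic_C k" "g \<in> periodic_C l" "\<And>x. \<bar>f x\<bar> \<le> g x"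
  shows "\<bar>avg \<delta> f x\<bar> \<le> avg \<delta> g x"
proof -
  have "\<bar>avg \<delta> f x\<bar> \<le> (LINT z|\<nu>. \<bar>f (x - \<delta> * z)\<bar>)"
    unfolding avg_def by (rule integral_abs_bound)
  also have "\<dots> \<le> avg \<delta> g x"
    unfolding avg_def
    by (intro integral_mono integrable_abs avg_integrable[OF assms(1)] avg_integrable[OF assms(2)] assms(3))
  finally show ?thesis .
qed

lemma avg_0: "avg 0 f = f"
  by (rule ext) (simp add: avg_def prob_space)

lemma avg_continuous:
  assumes f: "f \<in> periodic_C k"
  shows "continuous_on UNIV (avg \<delta> f)"
proof (intro continuous_at_imp_continuous_on ballI)
  fix x
  obtain M where M: "\<And>x. \<bar>f x\<bar> \<le> M" using periodic_C_bounded[OF f] by blast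
  have [measurable]: "f \<in> borel_measurable borel" using f by (rule periodic_C_measurable)
  have "isCont f y" for y
    using periodic_C_continuous[OF f, of UNIV] by (simp add: continuous_on_eq_continuous_at)
  show "isCont (avg \<delta> f) x"
    unfolding continuous_at_sequentially comp_def avg_def
  proof (intro allI impI)
    fix X :: "nat \<Rightarrow> real" assume X: "X \<longlonglongrightarrow> x"
    show "(\<lambda>n. LINT z|\<nu>. f (X n - \<delta> * z)) \<longlonglongrightarrow> (LINT z|\<nu>. f (x - \<delta> * z))"
    proof (rule integral_dominated_convergence[where w = "\<lambda>_. M"])
      show "AE z in \<nu>. (\<lambda>n. f (X n - \<delta> * z)) \<longlonglongrightarrow> f (x - \<delta> * z)"
        by (intro always_eventually allI isCont_tendsto_compose[OF \<open>isCont f _\<close>] tendsto_intros X)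
    qed (use M in auto)
  qed
qed

text \<open>Difference quotients of f are dominated by the supremum of the derivative, so they may be averaged
in the limit.\<close>

lemma avg_DERIV:
  assumes f: "f \<in> periodic_C (Suc k)"
  shows "(avg \<delta> f has_real_derivative avg \<delta> (deriv f) x) (at x)"
proof -
  have f': "deriv f \<in> periodic_C k" using f by (rule periodic_C_deriv)
  obtain M where M: "\<And>x. \<bar>deriv f x\<bar> \<le> M" using periodic_C_bounded[OF f'] by blast
  have [measurable]: "f \<in> borel_measurable borel" using f by (rule periodic_C_measurable)
  have [measurable]: "deriv f \<in> borel_measurable borel" using f' by (rule periodic_C_measurable)
  have D: "(f has_real_derivative deriv f y) (at y)" for y
    using periodic_C_DERIV[OF f, of 0] by simp
  have lip: "\<bar>f a - f b\<bar> \<le> M * \<bar>a - b\<bar>" for a b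
    using field_differentiable_bound[of UNIV f "deriv f" M a b] D M
    by (auto intro: has_field_derivative_at_within)
  have "((\<lambda>h. (avg \<delta> f (x + h) - avg \<delta> f x) / h) \<longlongrightarrow> avg \<delta> (deriv f) x) (at 0)"
    unfolding tendsto_at_iff_sequentially comp_def
  proof (intro allI impI)
    fix X :: "nat \<Rightarrow> real" assume X0: "\<forall>i. X i \<in> UNIV - {0}" and X: "X \<longlonglongrightarrow> 0"
    have eq: "(avg \<delta> f (x + X n) - avg \<delta> f x) / X n
        = (LINT z|\<nu>. (f (x - \<delta> * z + X n) - f (x - \<delta> * z)) / X n)" for n
      unfolding avg_def using avg_integrable[OF f, of "x + X n" \<delta>] avg_integrable[OF f, of x \<delta>]
      by (simp add: algebra_simps)
    show "(\<lambda>n. (avg \<delta> f (x + X n) - avg \<delta> f x) / X n) \<longlonglongrightarrow> avg \<delta> (deriv f) x"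
      unfolding eq unfolding avg_def
    proof (rule integral_dominated_convergence[where w = "\<lambda>_. M"])
      have "(\<lambda>n. (f (y + X n) - f y) / X n) \<longlonglongrightarrow> deriv f y" for y
        using D[of y, unfolded DERIV_def tendsto_at_iff_sequentially comp_def] X X0 by blast
      then show "AE z in \<nu>. (\<lambda>n. (f (x - \<delta> * z + X n) - f (x - \<delta> * z)) / X n)
          \<longlonglongrightarrow> deriv f (x - \<delta> * z)" by simp
      show "AE z in \<nu>. norm ((f (x - \<delta> * z + X n) - f (x - \<delta> * z)) / X n) \<le> M" for n
        using lip[of "x - \<delta> * z + X n" "x - \<delta> * z" for z] X0 by (simp add: abs_divide field_simps)
    qed auto
  qed
  then show ?thesis by (simp add: DERIV_def)
qed

lemma avg_circle_fun: "circle_fun f \<Longrightarrow> circle_fun (avg \<delta> f)"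
  unfolding circle_fun_def avg_def
  by (intro allI arg_cong[where f = "integral\<^sup>L \<nu>"] ext) (metis add_diff_eq diff_add_eq)

lemma avg_C_class: "f \<in> periodic_C k \<Longrightarrow> C_class k (avg \<delta> f)"
proof (induction k arbitrary: f)
  case 0
  then show ?case using avg_continuous by (simp add: C_class_0)
next
  case (Suc k)
  then show ?case by (intro C_class_SucI[OF avg_DERIV[OF Suc.prems]]) (auto intro: periodic_C_deriv)
qed

lemma avg_periodic_C: "f \<in> periodic_C k \<Longrightarrow> avg \<delta> f \<in> periodic_C k"
  using avg_C_class avg_circle_fun by (auto simp: periodic_C_def)

lemma avg_deriv_iterate:
  "f \<in> periodic_C k \<Longrightarrow> j \<le> k \<Longrightarrow> (deriv ^^ j) (avg \<delta> f) = avg \<delta> ((deriv ^^ j) f)"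
proof (induction j)
  case (Suc j)
  have "(deriv ^^ j) f \<in> periodic_C (Suc 0)"
    using Suc.prems by (intro periodic_C_deriv_iterate[of f k]) auto
  then have "deriv (avg \<delta> ((deriv ^^ j) f)) = avg \<delta> (deriv ((deriv ^^ j) f))"
    by (intro ext DERIV_imp_deriv avg_DERIV)
  then show ?case using Suc by simp
qed simp

text \<open>Fubini, and translation invariance of the integral over a period.\<close>

lemma avg_mean:
  assumes f: "f \<in> periodic_C k"
  shows "circle_mean (avg \<delta> f) = circle_mean f"
proof -
  obtain M where M: "\<And>x. \<bar>f x\<bar> \<le> M" using periodic_C_bounded[OF f] by blast
  have [measurable]: "f \<in> borel_measurable borel" using f by (rule periodic_C_measurable)
  interpret P: pair_sigma_finite "lborel :: real measure" \<nu> ..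
  have int: "integrable (lborel \<Otimes>\<^sub>M \<nu>) (\<lambda>(x, z). indicator {0..<1} x *\<^sub>R f (x - \<delta> * z))"
  proof (rule integrableI_bounded_set[of "{0..<1::real} \<times> space \<nu>" _ _ M])
    show "{0..<1::real} \<times> space \<nu> \<in> sets (lborel \<Otimes>\<^sub>M \<nu>)"
      by (intro pair_measureI sets.top) simp
    show "(\<lambda>(x, z). indicator {0..<1} x *\<^sub>R f (x - \<delta> * z)) \<in> borel_measurable (lborel \<Otimes>\<^sub>M \<nu>)" by measurable
    have "emeasure (lborel \<Otimes>\<^sub>M \<nu>) ({0..<1::real} \<times> space \<nu>) = 1"
      by (subst emeasure_pair_measure_Times) (auto simp: emeasure_space_1)
    then show "emeasure (lborel \<Otimes>\<^sub>M \<nu>) ({0..<1::real} \<times> space \<nu>) < \<infinity>" by simp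
  qed (use M in \<open>auto simp: indicator_def space_pair_measure intro!: AE_I2\<close>)
  have "circle_mean (avg \<delta> f) = (LINT x|lborel. LINT z|\<nu>. indicator {0..<1} x *\<^sub>R f (x - \<delta> * z))"
    unfolding circle_mean_def set_lebesgue_integral_def avg_def by simp
  also have "\<dots> = (LINT z|\<nu>. LINT x|lborel. indicator {0..<1} x *\<^sub>R f (x - \<delta> * z))"
    using P.Fubini_integral[OF int] by simp
  also have "\<dots> = (LINT z|\<nu>. circle_mean f)"
    using circle_mean_translate[OF f, unfolded circle_mean_def set_lebesgue_integral_def]
    by (simp add: circle_mean_def set_lebesgue_integral_def)
  finally show ?thesis by (simp add: prob_space)
qed

end

section \<open>The transfer operator of an expanding circle map\<close>

text \<open>The number N is the smoothness that is left for 1 / T', and hence the largest order of the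
function spaces on which the transfer operator acts.\<close>

locale expanding_circle_map =
  fixes T :: "real \<Rightarrow> real" and \<alpha> :: real and N :: nat
  assumes lift: "circle_lift T" and smooth: "C_class (Suc N) T"
    and \<alpha>: "1 < inverse \<alpha>" and expansion: "inverse \<alpha> \<le> \<bar>deriv T x\<bar>"
begin

text \<open>The lift T is a diffeomorphism of the line with inverse S and orientation \<sigma>; the degree of the
circle map is deg up to sign.\<close>

definition w :: "real \<Rightarrow> real" where "w x = inverse (deriv T x)"
definition \<sigma> :: real where "\<sigma> = sgn (deriv T 0)"
definition S :: "real \<Rightarrow> real" where "S = inv T"
definition deg :: nat where "deg = nat \<bar>\<lfloor>T 1 - T 0\<rfloor>\<bar>"

lemma \<alpha>_bounds: "0 < \<alpha>" "\<alpha> < 1"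
proof -
  show "0 < \<alpha>" using \<alpha> by (metis inverse_positive_iff_positive less_trans zero_less_one)
  then show "\<alpha> < 1" using \<alpha> by (simp add: field_simps)
qed

lemma T_DERIV: "(T has_real_derivative deriv T x) (at x)"
  using C_class_DERIV[OF smooth] .

lemma deriv_nonzero: "deriv T x \<noteq> 0"
  using expansion[of x] \<alpha> by auto

lemma abs_w_le: "\<bar>w x\<bar> \<le> \<alpha>"
  using expansion[of x] \<alpha>_bounds deriv_nonzero[of x] by (simp add: w_def field_simps)

text \<open>T' is continuous and has no zero.\<close>

lemma sgn_deriv: "sgn (deriv T x) = \<sigma>"
proof (rule ccontr)
  assume "sgn (deriv T x) \<noteq> \<sigma>"
  then have *: "deriv T x < 0 \<and> deriv T 0 > 0 \<or> deriv T x > 0 \<and> deriv T 0 < 0"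
    using deriv_nonzero[of x] deriv_nonzero[of 0] by (auto simp: \<sigma>_def sgn_if split: if_splits)
  have "continuous_on UNIV (deriv T)"
    using smooth by (blast intro: C_class_continuous C_class_deriv)
  then have "connected (range (deriv T))" by (intro connected_continuous_image) auto
  then have "0 \<in> range (deriv T)"
    using * connectedD_interval[of "range (deriv T)" "deriv T x" "deriv T 0" 0]
      connectedD_interval[of "range (deriv T)" "deriv T 0" "deriv T x" 0] by auto
  then show False using deriv_nonzero by (metis imageE)
qed

lemma \<sigma>: "\<sigma> = 1 \<or> \<sigma> = -1" "\<sigma> * \<sigma> = 1"
  using deriv_nonzero[of 0] by (auto simp: \<sigma>_def sgn_if)

lemma abs_deriv: "\<bar>deriv T x\<bar> = \<sigma> * deriv T x"
  using sgn_deriv[of x] by (metis abs_sgn mult.commute)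

lemma abs_w: "\<bar>w x\<bar> = \<sigma> * w x"
  using abs_deriv[of x] \<sigma>(1) by (auto simp: w_def abs_inverse)

lemma T_expands: "x \<le> y \<Longrightarrow> \<sigma> * T x + (y - x) \<le> \<sigma> * T y"
proof -
  assume xy: "x \<le> y"
  have "\<sigma> * T x - x \<le> \<sigma> * T y - y"
  proof (rule DERIV_nonneg_imp_nondecreasing[OF xy])
    fix t
    have "((\<lambda>t. \<sigma> * T t - t) has_real_derivative \<sigma> * deriv T t - 1) (at t)"
      by (auto intro!: derivative_eq_intros T_DERIV)
    moreover have "0 \<le> \<sigma> * deriv T t - 1"
      using expansion[of t] \<alpha> abs_deriv[of t] by linarith
    ultimately show "\<exists>D. ((\<lambda>t. \<sigma> * T t - t) has_real_derivative D) (at t) \<and> 0 \<le> D" by blast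
  qed
  then show ?thesis by simp
qed

lemma T_expansive: "\<bar>x - y\<bar> \<le> \<bar>T x - T y\<bar>"
  using T_expands[of x y] T_expands[of y x] \<sigma>(1) by (cases "x \<le> y") auto

lemma T_inj: "inj T"
proof (rule injI)
  fix x y assume "T x = T y"
  then show "x = y" using T_expansive[of x y] by simp
qed

lemma T_surj: "surj T"
proof -
  have "\<exists>x. T x = y" for y
  proof -
    define a where "a = \<bar>\<sigma> * y - \<sigma> * T 0\<bar>"
    have a: "0 \<le> a" "\<sigma> * T (- a) \<le> \<sigma> * y" "\<sigma> * y \<le> \<sigma> * T a"
      using T_expands[of 0 a] T_expands[of "- a" 0] by (auto simp: a_def)
    have "continuous_on {- a..a} (\<lambda>x. \<sigma> * T x)"
      using C_class_continuous[OF smooth] by (intro continuous_intros) auto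
    then obtain x where "\<sigma> * T x = \<sigma> * y"
      using IVT'[of "\<lambda>x. \<sigma> * T x" "- a" "\<sigma> * y" a] a by auto
    then show ?thesis using \<sigma>(1) by auto
  qed
  then show ?thesis by (metis surjI)
qed

lemma T_S: "T (S x) = x" and S_T: "S (T x) = x"
  using T_surj T_inj by (auto simp: S_def surj_f_inv_f)

lemma S_isCont: "isCont S x"
proof -
  have "\<bar>S u - S v\<bar> \<le> 1 * \<bar>u - v\<bar>" for u v
    using T_expansive[of "S u" "S v"] by (simp add: T_S)
  then have "1-lipschitz_on UNIV S" by (intro lipschitz_onI) (auto simp: dist_real_def)
  then show ?thesis
    using lipschitz_on_continuous_on[of 1 UNIV S] by (simp add: continuous_on_eq_continuous_at)
qed

lemma S_DERIV: "(S has_real_derivative w (S x)) (at x)"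
  unfolding w_def
  by (rule DERIV_inverse_function[of T _ _ _ "x - 1" "x + 1"])
     (auto intro: T_DERIV S_isCont simp: deriv_nonzero T_S)

text \<open>The increment over a period is continuous in x and has integer values, so it is constant.\<close>

lemma T_add_1: "T (x + 1) = T x + of_int \<lfloor>T 1 - T 0\<rfloor>"
proof -
  define g where "g x = T (x + 1) - T x" for x
  have gZ: "g x \<in> \<int>" for x using lift by (simp add: circle_lift_def g_def)
  have "continuous_on UNIV g"
  proof (intro continuous_at_imp_continuous_on ballI)
    fix x
    have "((\<lambda>x. T (x + 1)) has_real_derivative deriv T (x + 1)) (at x)"
      using T_DERIV[of "x + 1"] DERIV_shift by blast
    then show "isCont g x"
      unfolding g_def by (intro continuous_intros DERIV_isCont) (auto intro: T_DERIV)
  qed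
  moreover have "\<exists>e>0. \<forall>y. y \<in> UNIV \<and> g y \<noteq> g x \<longrightarrow> e \<le> norm (g y - g x)" for x
    using Ints_nonzero_abs_ge1[OF Ints_diff[OF gZ gZ]]
    by (intro exI[of _ 1] conjI allI impI) (simp_all add: real_norm_def)
  ultimately have "g constant_on UNIV"
    by (intro continuous_discrete_range_constant) auto
  then have "g x = g 0" by (auto simp: constant_on_def)
  moreover have "of_int \<lfloor>g 0\<rfloor> = g 0" using gZ[of 0] by (auto elim: Ints_cases)
  moreover have "g 0 = T 1 - T 0" by (simp add: g_def)
  ultimately have "g x = of_int \<lfloor>T 1 - T 0\<rfloor>" by (simp only:)
  then show ?thesis unfolding g_def by linarith
qed

lemma of_nat_deg: "real deg = \<sigma> * of_int \<lfloor>T 1 - T 0\<rfloor>" and deg_pos: "1 \<le> deg"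
proof -
  have "1 \<le> \<sigma> * of_int \<lfloor>T 1 - T 0\<rfloor>"
  proof -
    define e where "e = real_of_int \<lfloor>T 1 - T 0\<rfloor>"
    have "T 1 = T 0 + e" using T_add_1[of 0] by (simp add: e_def)
    then have "1 \<le> \<sigma> * e" using T_expands[of 0 1] by (simp add: distrib_left)
    then show ?thesis by (simp add: e_def)
  qed
  then have *: "(\<sigma> = 1 \<and> 1 \<le> \<lfloor>T 1 - T 0\<rfloor>) \<or> (\<sigma> = -1 \<and> \<lfloor>T 1 - T 0\<rfloor> \<le> -1)"
  proof -
    define e where "e = \<lfloor>T 1 - T 0\<rfloor>"
    show "1 \<le> \<sigma> * of_int \<lfloor>T 1 - T 0\<rfloor> \<Longrightarrow> ?thesis"
      unfolding e_def[symmetric] using \<sigma>(1) by auto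
  qed
  then show "real deg = \<sigma> * of_int \<lfloor>T 1 - T 0\<rfloor>" by (auto simp: deg_def)
  from * have "1 \<le> \<bar>\<lfloor>T 1 - T 0\<rfloor>\<bar>" by linarith
  then show "1 \<le> deg" unfolding deg_def by arith
qed

text \<open>The inverse of the relation T (x + \<sigma>) = T x + deg: deg consecutive unit intervals are mapped by
S onto one period.\<close>

lemma S_add_deg: "S (x + real deg) = S x + \<sigma>"
proof -
  have "T (S x + \<sigma>) = T (S x) + real deg"
    using \<sigma>(1)
  proof
    assume "\<sigma> = 1"
    then show ?thesis by (simp add: T_add_1 of_nat_deg)
  next
    assume *: "\<sigma> = -1"
    then show ?thesis using T_add_1[of "S x - 1"] by (simp add: of_nat_deg)
  qed
  then show ?thesis by (metis S_T T_S)
qed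

lemma circle_fun_add_\<sigma>: "circle_fun f \<Longrightarrow> f (x + \<sigma>) = f x"
  using circle_fun_shift_int[of f x 1] circle_fun_shift_int[of f x "-1"] \<sigma>(1) by auto

lemma w_periodic_C: "w \<in> periodic_C N"
proof -
  have "C_class N w"
    unfolding w_def[abs_def] using smooth deriv_nonzero by (intro C_class_inverse C_class_deriv)
  moreover have "deriv T (x + 1) = deriv T x" for x
  proof (rule DERIV_unique)
    show "(T has_real_derivative deriv T (x + 1)) (at (x + 1))" by (rule T_DERIV)
    have "((\<lambda>x. T x + of_int \<lfloor>T 1 - T 0\<rfloor>) has_real_derivative deriv T x) (at x)"
      by (auto intro!: derivative_eq_intros T_DERIV)
    then show "(T has_real_derivative deriv T x) (at (x + 1))"
      by (simp only: DERIV_shift[of T] T_add_1)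
  qed
  ultimately show ?thesis by (simp add: periodic_C_def circle_fun_def w_def)
qed

text \<open>The density of the image measure: the preimages of x on the circle are represented by
S (x + i) for i < deg, and each contributes with the weight 1 / |T'|.\<close>

definition L :: "(real \<Rightarrow> real) \<Rightarrow> real \<Rightarrow> real" where
  "L f x = (\<Sum>i<deg. f (S (x + real i)) * \<bar>w (S (x + real i))\<bar>)"

text \<open>The operator that corresponds to differentiation under L, that is (L f)' = L (P f).\<close>

definition P :: "(real \<Rightarrow> real) \<Rightarrow> real \<Rightarrow> real" where
  "P f = deriv (\<lambda>x. w x * f x)"

lemma L_lincomb: "L (\<lambda>x. a * f x + b * g x) = (\<lambda>x. a * L f x + b * L g x)"
  by (rule ext) (simp add: L_def sum.distrib sum_distrib_left distrib_right mult.assoc)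

lemma L_abs_le: "(\<And>x. \<bar>f x\<bar> \<le> g x) \<Longrightarrow> \<bar>L f x\<bar> \<le> L g x"
  unfolding L_def by (rule order_trans[OF sum_abs]) (auto intro!: sum_mono mult_right_mono simp: abs_mult)

lemma L_circle_fun:
  assumes f: "circle_fun f" shows "circle_fun (L f)"
  unfolding circle_fun_def
proof
  fix x
  define v where "v x = f (S x) * \<bar>w (S x)\<bar>" for x
  have v: "v (x + real deg) = v x"
    by (simp add: v_def S_add_deg circle_fun_add_\<sigma> f periodic_C_circle[OF w_periodic_C])
  obtain m where m: "deg = Suc m" using deg_pos by (cases deg) auto
  have "L f (x + 1) = (\<Sum>i<deg. v (x + real (Suc i)))"
    by (simp add: L_def v_def add_ac)
  also have "\<dots> = (\<Sum>i<m. v (x + real (Suc i))) + v x"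
    using v by (simp add: m)
  also have "\<dots> = (\<Sum>i<deg. v (x + real i))"
    unfolding m by (subst sum.lessThan_Suc_shift) simp
  finally show "L f (x + 1) = L f x" by (simp add: L_def v_def)
qed

lemma L_continuous:
  assumes "f \<in> periodic_C k" shows "continuous_on UNIV (L f)"
proof -
  have S: "isCont (\<lambda>x. S (x + c)) x" for x c
    by (rule isCont_o2[OF _ S_isCont]) simp
  have cont: "isCont g x" if "g \<in> periodic_C k" for g k x
    using periodic_C_continuous[OF that, of UNIV] by (simp add: continuous_on_eq_continuous_at)
  have "isCont (L f) x" for x
    unfolding L_def
    by (intro continuous_intros isCont_o2[OF S cont[OF assms]] isCont_o2[OF S cont[OF w_periodic_C]])
  then show ?thesis by (simp add: continuous_at_imp_continuous_on)
qed

lemma P_periodic_C: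
  assumes "f \<in> periodic_C (Suc k)" "Suc k \<le> N" shows "P f \<in> periodic_C k"
  unfolding P_def
  using assms by (intro periodic_C_deriv periodic_C_mult periodic_C_le[OF w_periodic_C])

text \<open>Since |w| = \<sigma> w, each summand of L f is the function \<sigma> w f composed with a translate of S, and the
chain rule produces another factor w, which is the weight needed to read the result as a value of L.\<close>

lemma L_DERIV:
  assumes f: "f \<in> periodic_C (Suc k)" and k: "Suc k \<le> N"
  shows "(L f has_real_derivative L (P f) x) (at x)"
proof -
  have "(\<lambda>x. w x * f x) \<in> periodic_C (Suc k)"
    using f k by (intro periodic_C_mult periodic_C_le[OF w_periodic_C])
  then have D: "((\<lambda>x. w x * f x) has_real_derivative P f x) (at x)" for x
    using periodic_C_DERIV[of _ "Suc k" 0] by (simp add: P_def)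
  have "((\<lambda>x. \<sigma> * (w (S (x + c)) * f (S (x + c)))) has_real_derivative
      \<sigma> * (P f (S (x + c)) * w (S (x + c)))) (at x)" for c
  proof -
    have "((\<lambda>x. S (x + c)) has_real_derivative w (S (x + c))) (at x)"
      using S_DERIV[of "x + c"] DERIV_shift by blast
    then show ?thesis by (intro DERIV_cmult DERIV_chain2[OF D])
  qed
  then have "((\<lambda>x. \<Sum>i<deg. \<sigma> * (w (S (x + real i)) * f (S (x + real i)))) has_real_derivative
      (\<Sum>i<deg. \<sigma> * (P f (S (x + real i)) * w (S (x + real i))))) (at x)"
    by (rule DERIV_sum)
  then show ?thesis by (simp add: L_def[abs_def] abs_w mult_ac)
qed

lemma L_C_class: "f \<in> periodic_C k \<Longrightarrow> k \<le> N \<Longrightarrow> C_class k (L f)"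
proof (induction k arbitrary: f)
  case 0
  then show ?case using L_continuous by (simp add: C_class_0)
next
  case (Suc k)
  show ?case by (rule C_class_SucI[OF L_DERIV[OF Suc.prems]]) (use Suc P_periodic_C in auto)
qed

lemma L_periodic_C: "f \<in> periodic_C k \<Longrightarrow> k \<le> N \<Longrightarrow> L f \<in> periodic_C k"
  using L_C_class L_circle_fun by (auto simp: periodic_C_def)

lemma L_deriv_iterate:
  "f \<in> periodic_C k \<Longrightarrow> k \<le> N \<Longrightarrow> j \<le> k \<Longrightarrow>
    (P ^^ j) f \<in> periodic_C (k - j) \<and> (deriv ^^ j) (L f) = L ((P ^^ j) f)"
proof (induction j)
  case (Suc j)
  then have IH: "(P ^^ j) f \<in> periodic_C (Suc (k - Suc j))" "(deriv ^^ j) (L f) = L ((P ^^ j) f)"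
    by (auto simp: Suc_diff_Suc)
  have le: "Suc (k - Suc j) \<le> N" using Suc.prems by auto
  have "deriv (L ((P ^^ j) f)) = L (P ((P ^^ j) f))"
    by (intro ext DERIV_imp_deriv L_DERIV[OF IH(1) le])
  then show ?case using P_periodic_C[OF IH(1) le] IH(2) by simp
qed simp

text \<open>Iterating f \<mapsto> (w f)' gives a differential operator with leading coefficient w^j, and each
application costs its coefficients one derivative. The coefficients beyond the order are set to 0 so that
the recursion for them has a single form.\<close>

lemma P_iterate_expansion:
  "j \<le> N \<Longrightarrow> \<exists>c. (\<forall>i. c i \<in> periodic_C (N - j)) \<and> c j = (\<lambda>x. w x ^ j) \<and> (\<forall>i>j. c i = (\<lambda>x. 0)) \<and>
     (\<forall>f\<in>periodic_C j. (P ^^ j) f = (\<lambda>x. \<Sum>i\<le>j. c i x * (deriv ^^ i) f x))"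
proof (induction j)
  case 0
  show ?case
    by (rule exI[of _ "\<lambda>i. if i = 0 then (\<lambda>x. 1) else (\<lambda>x. 0)"]) (auto intro: periodic_C_const)
next
  case (Suc j)
  then obtain c where c: "\<And>i. c i \<in> periodic_C (N - j)" "c j = (\<lambda>x. w x ^ j)"
    "\<And>i. j < i \<Longrightarrow> c i = (\<lambda>x. 0)"
    and P: "\<And>f. f \<in> periodic_C j \<Longrightarrow> (P ^^ j) f = (\<lambda>x. \<Sum>i\<le>j. c i x * (deriv ^^ i) f x)"
    by auto
  have Nj: "N - j = Suc (N - Suc j)" using Suc.prems by simp
  have wc: "(\<lambda>x. w x * c i x) \<in> periodic_C (Suc (N - Suc j))" for i
    using c(1)[of i] periodic_C_le[OF w_periodic_C, of "N - j"] unfolding Nj[symmetric]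
    by (intro periodic_C_mult) auto
  define c' where "c' i = (\<lambda>x. deriv (\<lambda>x. w x * c i x) x + (case i of 0 \<Rightarrow> 0 | Suc m \<Rightarrow> w x * c m x))" for i
  have "c' i \<in> periodic_C (N - Suc j)" for i
  proof -
    have "(\<lambda>x. case i of 0 \<Rightarrow> 0 | Suc m \<Rightarrow> w x * c m x) \<in> periodic_C (N - Suc j)"
      using periodic_C_le[OF wc] by (cases i) (auto intro: periodic_C_const)
    then show ?thesis
      unfolding c'_def by (intro periodic_C_add periodic_C_deriv wc)
  qed
  moreover have "c' (Suc j) = (\<lambda>x. w x ^ Suc j)" "\<forall>i>Suc j. c' i = (\<lambda>x. 0)"
    using deriv_iterate_const[of 1 0] by (auto simp: c'_def c(2,3) split: nat.split)
  moreover have "(P ^^ Suc j) f = (\<lambda>x. \<Sum>i\<le>Suc j. c' i x * (deriv ^^ i) f x)"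
    if f: "f \<in> periodic_C (Suc j)" for f
  proof
    fix x
    have "((\<lambda>x. w x * c i x * (deriv ^^ i) f x) has_real_derivative
        deriv (\<lambda>x. w x * c i x) x * (deriv ^^ i) f x + w x * c i x * (deriv ^^ Suc i) f x) (at x)"
      if "i \<in> {..j}" for i
    proof -
      have "((deriv ^^ i) f has_real_derivative (deriv ^^ Suc i) f x) (at x)"
        using periodic_C_DERIV[OF f] that by auto
      moreover have "((\<lambda>x. w x * c i x) has_real_derivative deriv (\<lambda>x. w x * c i x) x) (at x)"
        using periodic_C_DERIV[OF wc, of 0] by simp
      ultimately show ?thesis
        by (auto dest: DERIV_mult simp: mult_ac)
    qed
    then have "((\<lambda>x. \<Sum>i\<le>j. w x * c i x * (deriv ^^ i) f x) has_real_derivative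
        (\<Sum>i\<le>j. deriv (\<lambda>x. w x * c i x) x * (deriv ^^ i) f x + w x * c i x * (deriv ^^ Suc i) f x)) (at x)"
      by (rule DERIV_sum)
    moreover have "(\<lambda>x. \<Sum>i\<le>j. w x * c i x * (deriv ^^ i) f x) = (\<lambda>x. w x * (P ^^ j) f x)"
      using P[OF periodic_C_le[OF f]] by (auto simp: sum_distrib_left mult.assoc)
    ultimately have "(P ^^ Suc j) f x
      = (\<Sum>i\<le>j. deriv (\<lambda>x. w x * c i x) x * (deriv ^^ i) f x + w x * c i x * (deriv ^^ Suc i) f x)"
      using P_def by (auto intro: DERIV_imp_deriv)
    also have "\<dots> = (\<Sum>i\<le>j. deriv (\<lambda>x. w x * c i x) x * (deriv ^^ i) f x)
        + (\<Sum>i\<le>j. w x * c i x * (deriv ^^ Suc i) f x)"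
      by (rule sum.distrib)
    also have "(\<Sum>i\<le>j. deriv (\<lambda>x. w x * c i x) x * (deriv ^^ i) f x)
        = (\<Sum>i\<le>Suc j. deriv (\<lambda>x. w x * c i x) x * (deriv ^^ i) f x)"
      using deriv_iterate_const[of 1 0] by (simp add: c(3))
    also have "(\<Sum>i\<le>j. w x * c i x * (deriv ^^ Suc i) f x)
        = (\<Sum>i\<le>Suc j. (case i of 0 \<Rightarrow> 0 | Suc m \<Rightarrow> w x * c m x) * (deriv ^^ i) f x)"
      by (subst sum.atMost_Suc_shift) simp
    also have "(\<Sum>i\<le>Suc j. deriv (\<lambda>x. w x * c i x) x * (deriv ^^ i) f x) + \<dots>
        = (\<Sum>i\<le>Suc j. c' i x * (deriv ^^ i) f x)"
      by (simp only: sum.distrib[symmetric] c'_def distrib_right)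
    finally show "(P ^^ Suc j) f x = (\<Sum>i\<le>Suc j. c' i x * (deriv ^^ i) f x)" .
  qed
  ultimately show ?case by blast
qed

text \<open>The leading coefficient of order j is at most \<alpha>^j in modulus: this is where the expansion of T enters.
The lower coefficients are only bounded.\<close>

lemma P_iterate_bound:
  obtains B where "0 \<le> B"
    "\<And>j f x. j \<le> N \<Longrightarrow> f \<in> periodic_C j \<Longrightarrow>
      \<bar>(P ^^ j) f x\<bar> \<le> \<alpha> ^ j * \<bar>(deriv ^^ j) f x\<bar> + B * (\<Sum>i<j. \<bar>(deriv ^^ i) f x\<bar>)"
proof -
  have "\<exists>B\<ge>0. \<forall>f\<in>periodic_C j. \<forall>x.
      \<bar>(P ^^ j) f x\<bar> \<le> \<alpha> ^ j * \<bar>(deriv ^^ j) f x\<bar> + B * (\<Sum>i<j. \<bar>(deriv ^^ i) f x\<bar>)"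
    if j: "j \<le> N" for j
  proof -
    obtain c where c: "\<And>i. c i \<in> periodic_C (N - j)" "c j = (\<lambda>x. w x ^ j)"
      and P: "\<And>f. f \<in> periodic_C j \<Longrightarrow> (P ^^ j) f = (\<lambda>x. \<Sum>i\<le>j. c i x * (deriv ^^ i) f x)"
      using P_iterate_expansion[OF j] by auto
    have "\<forall>i. \<exists>M\<ge>0. \<forall>x. \<bar>c i x\<bar> \<le> M" using periodic_C_bounded[OF c(1)] by metis
    then obtain M where M: "\<And>i. 0 \<le> M i" "\<And>i x. \<bar>c i x\<bar> \<le> M i" by metis
    define B where "B = (\<Sum>i<j. M i)"
    show ?thesis
    proof (intro exI[of _ B] conjI ballI allI)
      show "0 \<le> B" unfolding B_def using M(1) by (intro sum_nonneg) auto
      fix f x assume f: "f \<in> periodic_C j"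
      have "\<bar>(P ^^ j) f x\<bar> \<le> (\<Sum>i\<le>j. \<bar>c i x * (deriv ^^ i) f x\<bar>)"
        unfolding P[OF f] by (rule sum_abs)
      also have "\<dots> = \<bar>w x\<bar> ^ j * \<bar>(deriv ^^ j) f x\<bar> + (\<Sum>i<j. \<bar>c i x\<bar> * \<bar>(deriv ^^ i) f x\<bar>)"
        by (simp add: lessThan_Suc_atMost[symmetric] c(2) abs_mult power_abs)
      also have "\<dots> \<le> \<alpha> ^ j * \<bar>(deriv ^^ j) f x\<bar> + (\<Sum>i<j. B * \<bar>(deriv ^^ i) f x\<bar>)"
      proof (intro add_mono mult_right_mono sum_mono power_mono abs_w_le)
        fix i assume "i \<in> {..<j}"
        then have "M i \<le> B" unfolding B_def using M(1) by (intro member_le_sum) auto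
        then show "\<bar>c i x\<bar> \<le> B" using M(2)[of i x] by linarith
      qed auto
      finally show "\<bar>(P ^^ j) f x\<bar> \<le> \<alpha> ^ j * \<bar>(deriv ^^ j) f x\<bar> + B * (\<Sum>i<j. \<bar>(deriv ^^ i) f x\<bar>)"
        by (simp add: sum_distrib_left)
    qed
  qed
  then have "\<forall>j. \<exists>B. j \<le> N \<longrightarrow> B \<ge> 0 \<and> (\<forall>f\<in>periodic_C j. \<forall>x.
      \<bar>(P ^^ j) f x\<bar> \<le> \<alpha> ^ j * \<bar>(deriv ^^ j) f x\<bar> + B * (\<Sum>i<j. \<bar>(deriv ^^ i) f x\<bar>))" by blast
  then obtain B where B: "\<And>j. j \<le> N \<Longrightarrow> 0 \<le> B j" "\<And>j f x. j \<le> N \<Longrightarrow> f \<in> periodic_C j \<Longrightarrow>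
      \<bar>(P ^^ j) f x\<bar> \<le> \<alpha> ^ j * \<bar>(deriv ^^ j) f x\<bar> + B j * (\<Sum>i<j. \<bar>(deriv ^^ i) f x\<bar>)"
    unfolding choice_iff by blast
  show ?thesis
  proof (rule that[of "\<Sum>j\<le>N. B j"])
    show "0 \<le> (\<Sum>j\<le>N. B j)" using B(1) by (auto intro: sum_nonneg)
    fix j f x assume j: "j \<le> N" and f: "f \<in> periodic_C j"
    have "B j \<le> (\<Sum>j\<le>N. B j)" using j B(1) by (intro member_le_sum) auto
    then have "B j * (\<Sum>i<j. \<bar>(deriv ^^ i) f x\<bar>) \<le> (\<Sum>j\<le>N. B j) * (\<Sum>i<j. \<bar>(deriv ^^ i) f x\<bar>)"
      by (intro mult_right_mono) (auto intro: sum_nonneg)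
    then show "\<bar>(P ^^ j) f x\<bar> \<le> \<alpha> ^ j * \<bar>(deriv ^^ j) f x\<bar> + (\<Sum>j\<le>N. B j) * (\<Sum>i<j. \<bar>(deriv ^^ i) f x\<bar>)"
      using B(2)[OF j f, of x] by linarith
  qed
qed

end

section \<open>Pushforward of measures and invariance of the mean\<close>

context expanding_circle_map
begin

lemma S_image_period:
  "S ` {0..<real deg} = (if \<sigma> = 1 then {S 0..<S 0 + 1} else {S 0 - 1<..S 0})"
proof -
  have iff: "0 \<le> x \<and> x < real deg \<longleftrightarrow> (if \<sigma> = 1 then S 0 \<le> S x \<and> S x < S 0 + 1 else S 0 - 1 < S x \<and> S x \<le> S 0)" for x
  proof -
    have mono: "a \<le> b \<longleftrightarrow> \<sigma> * S a \<le> \<sigma> * S b" for a b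
    proof -
      have "a = b" if "S a = S b" using arg_cong[OF that, of T] by (simp add: T_S)
      then show ?thesis
        using T_expands[of "S a" "S b", unfolded T_S] T_expands[of "S b" "S a", unfolded T_S] \<sigma>(1)
        by (cases "S a = S b"; cases "S a \<le> S b") auto
    qed
    show ?thesis
      using mono[of 0 x] mono[of "real deg" x] S_add_deg[of 0] \<sigma>(1) by auto
  qed
  show ?thesis
  proof (intro set_eqI iffI)
    fix y assume "y \<in> S ` {0..<real deg}"
    then obtain x where "0 \<le> x \<and> x < real deg" "y = S x" by auto
    then show "y \<in> (if \<sigma> = 1 then {S 0..<S 0 + 1} else {S 0 - 1<..S 0})"
      using iff[of x] by (cases "\<sigma> = 1") simp_all
  next
    fix y assume y: "y \<in> (if \<sigma> = 1 then {S 0..<S 0 + 1} else {S 0 - 1<..S 0})"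
    then have "T y \<in> {0..<real deg}" using iff[of "T y"] by (cases "\<sigma> = 1") (simp_all add: S_T)
    then have "S (T y) \<in> S ` {0..<real deg}" by (rule imageI)
    then show "y \<in> S ` {0..<real deg}" by (simp add: S_T)
  qed
qed

text \<open>For an orientation reversing map the image is the half-open interval with the other endpoint, which
changes the integral by a null set only.\<close>

lemma integral_S_image_period:
  assumes u: "circle_fun u" "set_integrable lborel {0..<1} u"
  shows "set_integrable lborel (S ` {0..<real deg}) u"
    and "(LINT y:S ` {0..<real deg}|lborel. u y) = (LINT y:{0..<1}|lborel. (u y :: real))"
proof -
  define a where "a = (if \<sigma> = 1 then S 0 else S 0 - 1)"
  have ae: "AE y in lborel. y \<in> S ` {0..<real deg} \<longleftrightarrow> y \<in> {a..<a + 1}"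
    using AE_lborel_singleton[of a] AE_lborel_singleton[of "a + 1"]
    by eventually_elim (auto simp: S_image_period a_def split: if_splits)

  note p = circle_fun_set_integral_period[OF u, of a]
  show int: "set_integrable lborel (S ` {0..<real deg}) u"
  proof (rule set_integrable_subset)
    show "set_integrable lborel ({a..<a + 1} \<union> {a + 1}) u"
      using p(1) by (intro set_integrable_Un) auto
  qed (auto simp: S_image_period a_def)
  have "(LINT y:S ` {0..<real deg}|lborel. u y) = (LINT y:{a..<a + 1}|lborel. u y)"
    unfolding set_lebesgue_integral_def
  proof (rule integral_cong_AE)
    show "AE y in lborel. indicator (S ` {0..<real deg}) y *\<^sub>R u y = indicator {a..<a + 1} y *\<^sub>R u y"
      using ae by eventually_elim (simp add: indicator_def)
  qed (use int p(1) in \<open>auto simp: set_integrable_def borel_measurable_integrable\<close>)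
  then show "(LINT y:S ` {0..<real deg}|lborel. u y) = (LINT y:{0..<1}|lborel. u y)"
    using p(2) by simp
qed

text \<open>The sum over i < deg glues the translates of [0,1) to the interval from 0 to deg; the substitution
by S then turns it into one period of the function that is to be integrated over the preimage of A.\<close>

lemma L_pushforward:
  assumes F: "F \<in> periodic_C k" and A: "A \<in> circle_borel"
  shows "signed_measure (L F) A = signed_measure F (T -` A)"
proof -
  have [measurable]: "F \<in> borel_measurable borel" using F by (rule periodic_C_measurable)
  have [measurable]: "w \<in> borel_measurable borel" using w_periodic_C by (rule periodic_C_measurable)
  have [measurable]: "T \<in> borel_measurable borel"
    using C_class_continuous[OF smooth] by (intro borel_measurable_continuous_onI)
  have [measurable]: "S \<in> borel_measurable borel"
    using S_isCont by (intro borel_measurable_continuous_onI continuous_at_imp_continuous_on) auto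
  have [measurable]: "A \<in> sets borel" using A by (simp add: circle_borel_def)
  have indA: "circle_fun (indicator A :: real \<Rightarrow> real)"
    using A by (auto simp: circle_fun_def circle_borel_def indicator_def)
  obtain M where M: "0 \<le> M" "\<And>x. \<bar>F x\<bar> \<le> M" using periodic_C_bounded[OF F] by blast
  define u where "u y = indicator A (T y) * F y" for y
  have [measurable]: "u \<in> borel_measurable borel" unfolding u_def by measurable
  have u_per: "circle_fun u"
    using circle_fun_shift_int[OF indA] periodic_C_circle[OF F]
    by (simp add: circle_fun_def u_def T_add_1)
  have u_bound: "\<bar>u y\<bar> \<le> M" for y using M by (auto simp: u_def indicator_def)
  have u_int: "set_integrable lborel {0..<1} u"
    unfolding set_integrable_def
    by (rule integrableI_bounded_set[of "{0..<1}" _ _ M]) (use u_bound in \<open>auto simp: indicator_def\<close>)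
  define v where "v x = u (S x) * \<bar>w (S x)\<bar>" for x
  have [measurable]: "v \<in> borel_measurable borel" unfolding v_def by measurable
  have v_bound: "\<bar>v x\<bar> \<le> M * \<alpha>" for x
    unfolding v_def abs_mult using u_bound abs_w_le M(1) by (intro mult_mono) auto
  have v_int: "set_integrable lborel {a..<b} v" if "a \<le> b" for a b :: real
    unfolding set_integrable_def
    by (rule integrableI_bounded_set[of "{a..<b}" _ _ "M * \<alpha>"])
       (use v_bound that in \<open>auto simp: indicator_def emeasure_lborel_Ico\<close>)
  have shift: "(LINT x:{0..<1}|lborel. v (x + real i)) = (LINT x:{real i..<real (Suc i)}|lborel. v x)" for i
  proof -
    have "(\<lambda>x. indicator {real i..<real (Suc i)} (real i + 1 * x) *\<^sub>R v (real i + 1 * x))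
        = (\<lambda>x. indicator {0..<1} x *\<^sub>R v (x + real i))"
      by (rule ext) (auto simp: indicator_def add.commute)
    then show ?thesis
      unfolding set_lebesgue_integral_def
      by (subst (2) lborel_integral_real_affine[of 1 _ "real i"]) simp_all
  qed
  have shift_int: "set_integrable lborel {0..<1} (\<lambda>x. v (x + real i))" for i
    unfolding set_integrable_def
    by (rule integrableI_bounded_set[of "{0..<1}" _ _ "M * \<alpha>"])
       (use v_bound in \<open>auto simp: indicator_def\<close>)
  have "signed_measure (L F) A = (LINT x:{0..<1}|lborel. \<Sum>i<deg. v (x + real i))"
    unfolding signed_measure_def set_lebesgue_integral_def
  proof (intro Bochner_Integration.integral_cong refl)
    fix x
    have "indicator A (x + real i) = (indicator A x :: real)" for i
      using circle_fun_shift_int[OF indA, of x "int i"] by simp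
    then show "indicator ({0..<1} \<inter> A) x *\<^sub>R L F x = indicator {0..<1} x *\<^sub>R (\<Sum>i<deg. v (x + real i))"
      by (cases "x \<in> A") (simp_all add: v_def u_def T_S L_def indicator_inter_arith)
  qed
  also have "\<dots> = (\<Sum>i<deg. LINT x:{0..<1}|lborel. v (x + real i))"
    unfolding set_lebesgue_integral_def scaleR_sum_right
    by (rule Bochner_Integration.integral_sum) (use shift_int in \<open>simp only: set_integrable_def\<close>)
  also have "\<dots> = (\<Sum>i<deg. LINT x:{real i..<real (Suc i)}|lborel. v x)"
    by (simp only: shift)
  also have "(\<Sum>i<n. LINT x:{real i..<real (Suc i)}|lborel. v x) = (LINT x:{0..<real n}|lborel. v x)" for n
  proof (induction n)
    case (Suc n)
    have un: "{0..<real (Suc n)} = {0..<real n} \<union> {real n..<real (Suc n)}" by auto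
    show ?case
      unfolding un using Suc v_int by (subst set_integral_Un) auto
  qed (simp add: set_lebesgue_integral_def)
  also have "(LINT x:{0..<real deg}|lborel. v x) = integral {0..<real deg} v"
    by (intro set_borel_integral_eq_integral(2) v_int) simp
  also have "\<dots> = integral (S ` {0..<real deg}) u"
  proof -
    have "v absolutely_integrable_on {0..<real deg}"
      unfolding set_integrable_def
      by (subst integrable_completion) (use v_int in \<open>auto simp: set_integrable_def[symmetric] simp del: real_scaleR_def\<close>)
    moreover have "(S has_real_derivative w (S x)) (at x within {0..<real deg})" for x
      using S_DERIV by (rule has_field_derivative_at_within)
    moreover have "inj_on S {0..<real deg}" using T_S by (metis inj_on_def)
    ultimately show ?thesis
      using has_absolute_integral_change_of_variables_1'[of "{0..<real deg}" S "\<lambda>x. w (S x)" u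
          "integral {0..<real deg} v"]
      by (auto simp: v_def[abs_def] mult.commute)
  qed
  also have "\<dots> = (LINT y:S ` {0..<real deg}|lborel. u y)"
    using integral_S_image_period(1)[OF u_per u_int] by (intro set_borel_integral_eq_integral(2)[symmetric])
  also have "\<dots> = (LINT y:{0..<1}|lborel. u y)"
    by (rule integral_S_image_period(2)[OF u_per u_int])
  also have "\<dots> = signed_measure F (T -` A)"
    unfolding signed_measure_def set_lebesgue_integral_def u_def
    by (intro Bochner_Integration.integral_cong refl) (auto simp: indicator_def)
  finally show ?thesis .
qed

lemma L_mean:
  assumes "F \<in> periodic_C k" shows "circle_mean (L F) = circle_mean F"
  using L_pushforward[OF assms, of UNIV] by (simp add: circle_mean_def signed_measure_def circle_borel_def)

end

section \<open>Cones invariant under the noisy transfer operators\<close>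

locale noisy_circle_map = expanding_circle_map T \<alpha> N + jitter \<nu>
  for T \<alpha> N \<nu>
begin

text \<open>Averaging commutes with differentiation and is a positive operator, so it preserves the cones for
every \<delta>. The gain \<eta> comes from L alone, which is why the parameters can be chosen independently of \<delta>.\<close>

lemma cone_parameters:
  obtains \<kappa> \<eta> where
    "\<And>\<delta> k. 1 \<le> k \<Longrightarrow> k \<le> N \<Longrightarrow> cone_contraction (\<lambda>f. avg \<delta> (L f)) \<kappa> \<eta> k"
proof -
  obtain B where B: "0 \<le> B"
    "\<And>j f x. j \<le> N \<Longrightarrow> f \<in> periodic_C j \<Longrightarrow>
      \<bar>(P ^^ j) f x\<bar> \<le> \<alpha> ^ j * \<bar>(deriv ^^ j) f x\<bar> + B * (\<Sum>i<j. \<bar>(deriv ^^ i) f x\<bar>)"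
    using P_iterate_bound by blast
  define \<eta> where "\<eta> = (1 + \<alpha>) / 2"
  have \<eta>: "0 < \<eta>" "\<eta> < 1" "\<alpha> < \<eta>" using \<alpha>_bounds by (auto simp: \<eta>_def)
  \<comment> \<open>with \<kappa> j = K^j the lower order terms sum to less than K^j / (K - 1), and K is so large that B times
    this fits into the gap between \<alpha> K^j and \<eta> K^j; the additional 1 ensures K > 1 when B = 0\<close>
  define K where "K = 1 + (B + 1) / (\<eta> - \<alpha>)"
  define \<kappa> where "\<kappa> j = K ^ j" for j
  have K: "1 < K" using B(1) \<eta> by (simp add: K_def add_pos_pos add_nonneg_pos)
  have \<kappa>1: "1 \<le> \<kappa> j" for j using K by (simp add: \<kappa>_def one_le_power)
  have gain: "\<alpha> ^ j * \<kappa> j + B * (\<Sum>i<j. \<kappa> i) \<le> \<eta> * \<kappa> j" if "1 \<le> j" for j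
  proof -
    have "B \<le> (\<eta> - \<alpha>) * (K - 1)" using \<eta> by (simp add: K_def)
    moreover have s: "(\<Sum>i<j. \<kappa> i) * (K - 1) = K ^ j - 1"
      unfolding \<kappa>_def using K by (simp add: geometric_sum)
    moreover have "0 \<le> (\<Sum>i<j. \<kappa> i)" using \<kappa>1 by (intro sum_nonneg) (auto intro: order_trans[of 0 1])
    ultimately have "B * (\<Sum>i<j. \<kappa> i) \<le> (\<eta> - \<alpha>) * (K - 1) * (\<Sum>i<j. \<kappa> i)"
      by (intro mult_right_mono)
    also have "\<dots> = (\<eta> - \<alpha>) * (K ^ j - 1)" using s by (simp add: mult_ac)
    also have "\<dots> \<le> (\<eta> - \<alpha>) * \<kappa> j" using \<eta> by (simp add: \<kappa>_def)
    finally have "B * (\<Sum>i<j. \<kappa> i) \<le> (\<eta> - \<alpha>) * \<kappa> j" .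
    moreover have "\<alpha> ^ j * \<kappa> j \<le> \<alpha> * \<kappa> j"
      using power_decreasing[OF that, of \<alpha>] \<alpha>_bounds \<kappa>1[of j] by (intro mult_right_mono) auto
    ultimately show ?thesis by (simp add: algebra_simps)
  qed
  have "cone_contraction (\<lambda>f. avg \<delta> (L f)) \<kappa> \<eta> k" if k: "1 \<le> k" "k \<le> N" for \<delta> k
  proof
    fix f assume f: "f \<in> periodic_C k"
    show "avg \<delta> (L f) \<in> periodic_C k" by (intro avg_periodic_C L_periodic_C f k)
    show "circle_mean (avg \<delta> (L f)) = circle_mean f"
      using avg_mean[OF L_periodic_C[OF f k(2)]] L_mean[OF f] by simp
    fix g a b assume g: "g \<in> periodic_C k"
    show "avg \<delta> (L (\<lambda>x. a * f x + b * g x)) = (\<lambda>x. a * avg \<delta> (L f) x + b * avg \<delta> (L g) x)"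
      using avg_lincomb[OF L_periodic_C[OF f k(2)] L_periodic_C[OF g k(2)]] by (simp add: L_lincomb)
  next
    fix f assume fc: "f \<in> deriv_cone \<kappa> k"
    then have f: "f \<in> periodic_C k" and d: "\<And>j x. j \<le> k \<Longrightarrow> \<bar>(deriv ^^ j) f x\<bar> \<le> \<kappa> j * f x"
      by (auto simp: deriv_cone_def)
    have f0: "0 \<le> f x" for x using d[of 0 x] by (simp add: \<kappa>_def)
    have Lf: "L f \<in> periodic_C k" using f k(2) by (rule L_periodic_C)
    have "\<bar>(deriv ^^ j) (L f) x\<bar> \<le> (if j = 0 then 1 else \<eta> * \<kappa> j) * L f x" if j: "j \<le> k" for j x
    proof (cases "j = 0")
      case True
      then show ?thesis using L_abs_le[of f f x] f0 by simp
    next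
      case False
      \<comment> \<open>the vacuous summand gives the right-hand side the form of a linear combination, on which L can
        be evaluated\<close>
      have "\<bar>(P ^^ j) f y\<bar> \<le> \<eta> * \<kappa> j * f y + 0 * f y" for y
      proof -
        have "\<bar>(P ^^ j) f y\<bar> \<le> \<alpha> ^ j * \<bar>(deriv ^^ j) f y\<bar> + B * (\<Sum>i<j. \<bar>(deriv ^^ i) f y\<bar>)"
          using B(2)[of j f y] j k(2) periodic_C_le[OF f j] by simp
        also have "\<dots> \<le> \<alpha> ^ j * (\<kappa> j * f y) + B * (\<Sum>i<j. \<kappa> i * f y)"
          using d j B(1) \<alpha>_bounds by (intro add_mono mult_left_mono sum_mono) auto
        also have "\<dots> = (\<alpha> ^ j * \<kappa> j + B * (\<Sum>i<j. \<kappa> i)) * f y"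
          by (simp add: sum_distrib_right distrib_right mult.assoc)
        also have "\<dots> \<le> \<eta> * \<kappa> j * f y"
          using gain[of j] False f0 by (intro mult_right_mono) auto
        finally show ?thesis by simp
      qed
      then have "\<bar>L ((P ^^ j) f) x\<bar> \<le> L (\<lambda>y. \<eta> * \<kappa> j * f y + 0 * f y) x" by (rule L_abs_le)
      then show ?thesis
        using L_deriv_iterate[OF f k(2) j] False unfolding L_lincomb by simp
    qed
    then have "\<bar>avg \<delta> ((deriv ^^ j) (L f)) x\<bar> \<le> avg \<delta> (\<lambda>y. (if j = 0 then 1 else \<eta> * \<kappa> j) * L f y) x"
      if "j \<le> k" for j x
      using that periodic_C_deriv_iterate[OF Lf, of j 0]
      by (intro avg_abs_le[of _ 0 _ k] periodic_C_cmult Lf) auto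
    moreover have "avg \<delta> (\<lambda>y. c * L f y) x = c * avg \<delta> (L f) x" for c x
      using avg_lincomb[OF Lf Lf, of \<delta> c 0] by simp
    ultimately show "avg \<delta> (L f) \<in> deriv_cone (\<lambda>j. if j = 0 then 1 else \<eta> * \<kappa> j) k"
      unfolding deriv_cone_def using avg_periodic_C[OF Lf] avg_deriv_iterate[OF Lf] by auto
  qed (use \<eta> \<kappa>1 k in \<open>auto simp: \<kappa>_def\<close>)
  then show ?thesis by (rule that)
qed

end

section \<open>Second order response for smooth densities\<close>

lemma circle_mean_deriv:
  assumes "f \<in> periodic_C (Suc k)" shows "circle_mean (deriv f) = 0"
proof -
  have f': "deriv f \<in> periodic_C k" using assms by (rule periodic_C_deriv)
  have "integral {0..1} (deriv f) = f 1 - f 0"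
    using periodic_C_DERIV[OF assms, of 0]
    by (intro integral_unique fundamental_theorem_of_calculus)
       (auto simp: has_real_derivative_iff_has_vector_derivative[symmetric] intro: has_field_derivative_at_within)
  also have "\<dots> = 0" using periodic_C_circle[OF assms] by (auto simp: circle_fun_def dest: spec[of _ 0])
  finally have "(LINT x:{0..1}|lborel. deriv f x) = 0"
    using set_borel_integral_eq_integral(2)[OF borel_integrable_atLeastAtMost'[OF periodic_C_continuous[OF f', of "{0..1}"]]]
    by simp
  moreover have "(LINT x:{0..1}|lborel. deriv f x) = circle_mean (deriv f)"
    unfolding circle_mean_def set_lebesgue_integral_def
  proof (rule integral_cong_AE)
    show "AE x in lborel. indicator {0..1} x *\<^sub>R deriv f x = indicator {0..<1} x *\<^sub>R deriv f x"
      using AE_lborel_singleton[of "1::real"] by eventually_elim (auto simp: indicator_def)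
  qed (use periodic_C_measurable[OF f'] in auto)
  ultimately show ?thesis by simp
qed

context jitter
begin

lemma integral_abs_le_const:
  assumes "integrable \<nu> F" "AE z in \<nu>. \<bar>F z\<bar> \<le> B"
  shows "\<bar>LINT z|\<nu>. F z\<bar> \<le> (B::real)"
proof -
  have "\<bar>LINT z|\<nu>. F z\<bar> \<le> (LINT z|\<nu>. \<bar>F z\<bar>)" by (rule integral_abs_bound)
  also have "\<dots> \<le> (LINT z|\<nu>. B)" using assms by (intro integral_mono_AE) auto
  finally show ?thesis by (simp add: prob_space)
qed

lemma integrable_power: "integrable \<nu> (\<lambda>z. z ^ n)"
proof (rule integrable_const_bound[of _ 1])
  show "AE z in \<nu>. norm (z ^ n) \<le> 1"
    using support by eventually_elim (simp add: power_abs power_le_one)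
qed simp

lemma second_moment_bounds: "0 \<le> (LINT z|\<nu>. z\<^sup>2)" "(LINT z|\<nu>. z\<^sup>2) \<le> 1"
proof -
  have "AE z in \<nu>. \<bar>z\<^sup>2\<bar> \<le> 1"
    using support by eventually_elim (simp add: abs_square_le_1)
  then show "(LINT z|\<nu>. z\<^sup>2) \<le> 1" using integral_abs_le_const[OF integrable_power[of 2]] by simp
qed simp

lemma avg_first_order:
  assumes g: "g \<in> periodic_C (Suc k)" and A: "\<And>y. \<bar>deriv g y\<bar> \<le> A" and \<delta>: "0 \<le> \<delta>"
  shows "\<bar>avg \<delta> g x - g x\<bar> \<le> A * \<delta>"
proof -
  have lip: "\<bar>g a - g b\<bar> \<le> A * \<bar>a - b\<bar>" for a b
    using field_differentiable_bound[of UNIV g "deriv g" A a b] A periodic_C_DERIV[OF g, of 0]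
    by (auto intro: has_field_derivative_at_within)
  have "0 \<le> A" using A[of 0] by linarith
  have "avg \<delta> g x - g x = (LINT z|\<nu>. g (x - \<delta> * z) - g x)"
    unfolding avg_def using avg_integrable[OF g] by (simp add: prob_space)
  also have "\<bar>\<dots>\<bar> \<le> A * \<delta>"
  proof (rule integral_abs_le_const)
    show "AE z in \<nu>. \<bar>g (x - \<delta> * z) - g x\<bar> \<le> A * \<delta>"
      using support
    proof eventually_elim
      case (elim z)
      have "A * (\<delta> * \<bar>z\<bar>) \<le> A * (\<delta> * 1)"
        using elim \<delta> \<open>0 \<le> A\<close> by (intro mult_left_mono) auto
      then show ?case using lip[of "x - \<delta> * z" x] \<delta> by (simp add: abs_mult)
    qed
  qed (use avg_integrable[OF g] in simp)
  finally show ?thesis .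
qed

text \<open>Taylor expansion of the translate by \<delta> z: the linear term averages to 0 since \<nu> is centred, the
quadratic one to half of the second moment, and the remainder is cubic in \<delta>.\<close>

lemma avg_second_order:
  assumes g: "g \<in> periodic_C (k + 3)" and A: "\<And>y. \<bar>(deriv ^^ 3) g y\<bar> \<le> A" and \<delta>: "0 \<le> \<delta>"
    and centred: "(LINT z|\<nu>. z) = 0"
  shows "\<bar>avg \<delta> g x - g x - \<delta>\<^sup>2 / 2 * (LINT z|\<nu>. z\<^sup>2) * (deriv ^^ 2) g x\<bar> \<le> A * \<delta> ^ 3"
proof -
  have A0: "0 \<le> A" using A[of 0] by linarith
  have taylor: "\<bar>g (x + t) - g x - t * deriv g x - t\<^sup>2 / 2 * (deriv ^^ 2) g x\<bar> \<le> A * \<bar>t\<bar> ^ 3" for t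
  proof -
    have D: "((\<lambda>s. (deriv ^^ m) g (x + s)) has_real_derivative (deriv ^^ Suc m) g (x + s)) (at s)"
      if "m < 3" for m s
      using periodic_C_DERIV[OF g, of m "s + x"] that DERIV_shift[of "(deriv ^^ m) g" _ s x]
      by (simp add: add.commute)
    have "\<forall>m s. m < 3 \<and> \<bar>s\<bar> \<le> \<bar>t\<bar> \<longrightarrow>
      ((\<lambda>s. (deriv ^^ m) g (x + s)) has_real_derivative (deriv ^^ Suc m) g (x + s)) (at s)"
      using D by blast
    from Maclaurin_bi_le[OF _ this, of "\<lambda>s. g (x + s)"]
    obtain s where "g (x + t) = (\<Sum>m<3. (deriv ^^ m) g (x + 0) / fact m * t ^ m)
        + (deriv ^^ 3) g (x + s) / fact 3 * t ^ 3"
      by auto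
    then have "g (x + t) - g x - t * deriv g x - t\<^sup>2 / 2 * (deriv ^^ 2) g x
        = (deriv ^^ 3) g (x + s) / 6 * t ^ 3"
      by (simp add: eval_nat_numeral fact_numeral algebra_simps)
    also have "\<bar>\<dots>\<bar> \<le> A * \<bar>t\<bar> ^ 3"
    proof -
      have "\<bar>(deriv ^^ 3) g (x + s)\<bar> * \<bar>t\<bar> ^ 3 \<le> A * \<bar>t\<bar> ^ 3"
        by (intro mult_right_mono A) simp
      moreover have "0 \<le> A * \<bar>t\<bar> ^ 3" using A0 by simp
      ultimately show ?thesis by (simp add: abs_mult power_abs)
    qed
    finally show ?thesis .
  qed
  have i1: "integrable \<nu> (\<lambda>z. z)" and i2: "integrable \<nu> (\<lambda>z. z\<^sup>2)"
    using integrable_power[of 1] integrable_power[of 2] by simp_all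
  note ig = avg_integrable[OF g, of x \<delta>]
  define F where "F z = g (x - \<delta> * z) - g x + \<delta> * z * deriv g x - \<delta>\<^sup>2 * z\<^sup>2 / 2 * (deriv ^^ 2) g x" for z
  have iF: "integrable \<nu> F" unfolding F_def using i1 i2 ig by simp
  have "(LINT z|\<nu>. F z) = avg \<delta> g x - g x + \<delta> * (LINT z|\<nu>. z) * deriv g x
      - \<delta>\<^sup>2 * (LINT z|\<nu>. z\<^sup>2) / 2 * (deriv ^^ 2) g x"
    unfolding F_def avg_def using i1 i2 ig by (simp add: prob_space)
  then have "avg \<delta> g x - g x - \<delta>\<^sup>2 / 2 * (LINT z|\<nu>. z\<^sup>2) * (deriv ^^ 2) g x = (LINT z|\<nu>. F z)"
    using centred by simp
  also have "\<bar>\<dots>\<bar> \<le> A * \<delta> ^ 3"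
  proof (rule integral_abs_le_const[OF iF])
    show "AE z in \<nu>. \<bar>F z\<bar> \<le> A * \<delta> ^ 3"
      using support
    proof eventually_elim
      case (elim z)
      have "\<bar>F z\<bar> \<le> A * \<bar>- (\<delta> * z)\<bar> ^ 3"
        using taylor[of "- (\<delta> * z)"] by (simp add: F_def power_mult_distrib)
      also have "\<dots> \<le> A * \<delta> ^ 3"
        using elim \<delta> A0 mult_left_le[of "\<bar>z\<bar>" \<delta>] by (intro mult_left_mono power_mono) (auto simp: abs_mult)
      finally show ?case .
    qed
  qed
  finally show ?thesis .
qed

end

context noisy_circle_map
begin

text \<open>With E = H \<delta> - H 0, G = L (H \<delta>) and W = avg \<delta> G - G the fixed point equations give E - L E = W. The
C^4 bound on H \<delta>, uniform in \<delta>, makes W of order \<delta> in C^3, hence also E and L E = G - H 0. Therefore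
W / \<delta>^2, which is close to m2 / 2 times G'' in C^1 by the second order expansion, is close to m2 / 2 times
(H 0)'' as well, where m2 is the second moment of \<nu>, and applying the inverse of Id - L gives the claim. Three orders of smoothness occur: 4 for
the uniform bounds, 3 to control G'' - (H 0)'' in C^1, and 1 for the conclusion.\<close>

theorem smooth_second_order_response:
  assumes N: "4 \<le> N" and centred: "(LINT z|\<nu>. z) = 0"
  obtains H u C r where
    "\<And>\<delta>. H \<delta> \<in> periodic_C 4" "\<And>\<delta> x. 0 \<le> H \<delta> x" "\<And>\<delta>. circle_mean (H \<delta>) = 1"
    "\<And>\<delta>. avg \<delta> (L (H \<delta>)) = H \<delta>"
    "u \<in> periodic_C 1" "circle_mean u = 0" "0 \<le> r" "r < 1"
    "\<And>n. C_norm_le 1 (\<lambda>x. u x - (\<Sum>i<n. (L ^^ i) ((deriv ^^ 2) (H 0)) x)) (C * r ^ n)"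
    "\<And>\<delta>. 0 < \<delta> \<Longrightarrow>
      C_norm_le 1 (\<lambda>x. (H \<delta> x - H 0 x) / \<delta>\<^sup>2 - (LINT z|\<nu>. z\<^sup>2) / 2 * u x) (C * \<delta>)"
proof -
  obtain \<kappa> \<eta> where cc: "\<And>\<delta> k. 1 \<le> k \<Longrightarrow> k \<le> N \<Longrightarrow> cone_contraction (\<lambda>f. avg \<delta> (L f)) \<kappa> \<eta> k"
    using cone_parameters by blast
  have L: "cone_contraction L \<kappa> \<eta> k" if "1 \<le> k" "k \<le> N" for k
    using cc[OF that, of 0] by (simp add: avg_0)
  interpret L1: cone_contraction L \<kappa> \<eta> 1 using L N by simp
  interpret L3: cone_contraction L \<kappa> \<eta> 3 using L N by simp
  interpret L4: cone_contraction L \<kappa> \<eta> 4 using L N by simp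
  define m2 where "m2 = (LINT z|\<nu>. z\<^sup>2)"
  have m2: "0 \<le> m2" "m2 \<le> 1" unfolding m2_def by (rule second_moment_bounds)+
  have "\<forall>\<delta>. \<exists>h. h \<in> deriv_cone \<kappa> 4 \<and> circle_mean h = 1 \<and> avg \<delta> (L h) = h"
    using cone_contraction.fixed_point_in_cone[OF cc] N by (metis one_le_numeral)
  then obtain H where H_cone: "\<And>\<delta>. H \<delta> \<in> deriv_cone \<kappa> 4" and H_mean: "\<And>\<delta>. circle_mean (H \<delta>) = 1"
    and H_fix: "\<And>\<delta>. avg \<delta> (L (H \<delta>)) = H \<delta>" by metis
  have H: "H \<delta> \<in> periodic_C 4" and H_nonneg: "0 \<le> H \<delta> x" for \<delta> x
    using L4.coneD(1)[OF H_cone] L4.cone_nonneg[OF H_cone] by auto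
  have H0_fix: "L (H 0) = H 0" using H_fix[of 0] by (simp add: avg_0)
  define A where "A = L4.C\<^sub>0 * (L4.C\<^sub>0 / 5)"
  define G where "G \<delta> = L (H \<delta>)" for \<delta>
  have G: "G \<delta> \<in> periodic_C 4" for \<delta> unfolding G_def by (rule L4.Q_periodic_C[OF H])
  have "C_norm_le 4 (H \<delta>) (L4.C\<^sub>0 / 5)" for \<delta>
    using L4.cone_deriv_le[OF H_cone] by (simp add: C_norm_le_def H_mean)
  then have G_bound: "C_norm_le 4 (G \<delta>) A" for \<delta>
    unfolding G_def A_def by (intro L4.Q_bounded H)
  have A0: "0 \<le> A" using G_bound by (rule C_norm_le_nonneg)
  define h2 where "h2 = (deriv ^^ 2) (H 0)"
  have h2: "h2 \<in> periodic_C 2" unfolding h2_def using H by (intro periodic_C_deriv_iterate[of _ 4]) auto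
  have h2_1: "h2 \<in> periodic_C 1" using h2 by (rule periodic_C_le) simp
  have h2_mean: "circle_mean h2 = 0"
    using circle_mean_deriv[of "deriv (H 0)" 2] periodic_C_deriv[of "H 0" 3] H[of 0]
    by (simp add: h2_def eval_nat_numeral)
  define u where "u = L1.R h2"
  have u: "u \<in> periodic_C 1" "circle_mean u = 0"
    unfolding u_def using L1.R_periodic_C[OF h2_1 h2_mean] L1.R_mean[OF h2_1 h2_mean] by auto
  obtain M where M: "C_norm_le 1 h2 M" using C_norm_le_exists[OF h2_1] .
  have u_lim: "C_norm_le 1 (\<lambda>x. u x - (\<Sum>i<n. (L ^^ i) h2 x)) (L1.C\<^sub>1 * M * L1.\<theta> ^ n)" for n
    unfolding u_def by (rule L1.R_remainder[OF h2_1 M h2_mean])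
  define W where "W \<delta> = (\<lambda>x. H \<delta> x - G \<delta> x)" for \<delta>
  have W: "W \<delta> \<in> periodic_C 4" for \<delta> unfolding W_def using H G by (rule periodic_C_diff)
  have W3: "W \<delta> \<in> periodic_C 3" for \<delta> using W by (rule periodic_C_le) simp
  have W_deriv: "(deriv ^^ j) (W \<delta>) x = avg \<delta> ((deriv ^^ j) (G \<delta>)) x - (deriv ^^ j) (G \<delta>) x"
    if "j \<le> 4" for j \<delta> x
  proof -
    have "H \<delta> = avg \<delta> (G \<delta>)" using H_fix by (simp add: G_def)
    then have "(deriv ^^ j) (H \<delta>) = avg \<delta> ((deriv ^^ j) (G \<delta>))"
      using avg_deriv_iterate[OF G that] by metis
    then show ?thesis unfolding W_def using periodic_C_deriv_iterate_diff[OF H G that] by simp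
  qed
  have W_bound: "C_norm_le 3 (W \<delta>) (A * \<delta>)" if \<delta>: "0 < \<delta>" for \<delta>
    unfolding C_norm_le_def
  proof (intro allI impI)
    fix j :: nat and x assume j: "j \<le> 3"
    have "(deriv ^^ j) (G \<delta>) \<in> periodic_C (Suc 0)"
      using j by (intro periodic_C_deriv_iterate[OF G]) auto
    moreover have "\<bar>deriv ((deriv ^^ j) (G \<delta>)) y\<bar> \<le> A" for y
      using C_norm_leD[OF G_bound, of "Suc j"] j by simp
    ultimately show "\<bar>(deriv ^^ j) (W \<delta>) x\<bar> \<le> A * \<delta>"
      using avg_first_order[of "(deriv ^^ j) (G \<delta>)" 0 A \<delta> x] W_deriv[of j] j \<delta> by simp
  qed
  define E where "E \<delta> = (\<lambda>x. H \<delta> x - H 0 x)" for \<delta>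
  have E: "E \<delta> \<in> periodic_C 4" for \<delta> unfolding E_def using H H by (rule periodic_C_diff)
  have E_mean: "circle_mean (E \<delta>) = 0" for \<delta>
    unfolding E_def using circle_mean_diff[OF H H] by (simp add: H_mean)
  have LE: "L (E \<delta>) = (\<lambda>x. G \<delta> x - H 0 x)" for \<delta>
    unfolding E_def G_def using L4.Q_diff[OF H H] by (simp add: H0_fix)
  have EW: "E \<delta> x - L (E \<delta>) x = W \<delta> x" for \<delta> x
    by (simp add: LE) (simp add: E_def W_def)
  have E3: "E \<delta> \<in> periodic_C 3" for \<delta> using E by (rule periodic_C_le) simp
  have W_mean: "circle_mean (W \<delta>) = 0" for \<delta>
    unfolding W_def using circle_mean_diff[OF H G] L4.Q_mean[OF H] by (simp add: G_def)
  define B where "B = L3.C\<^sub>0 * (L3.C\<^sub>1 * A)"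
  have LE_bound: "C_norm_le 3 (L (E \<delta>)) (B * \<delta>)" if "0 < \<delta>" for \<delta>
  proof -
    have "E \<delta> = L3.R (W \<delta>)" using E3 E_mean W3 EW by (rule L3.R_unique)
    then have "C_norm_le 3 (E \<delta>) (L3.C\<^sub>1 * (A * \<delta>))"
      using L3.R_bounded[OF W3 W_bound[OF that] W_mean] by simp
    from L3.Q_bounded[OF E3 this] show ?thesis by (simp add: B_def mult.assoc)
  qed
  \<comment> \<open>v - L v = V for the error v in the claim, so it remains to bound V in C^1\<close>
  define V where "V \<delta> = (\<lambda>x. 1 / \<delta>\<^sup>2 * W \<delta> x + (- (m2 / 2)) * h2 x)" for \<delta>
  have V: "V \<delta> \<in> periodic_C 2" for \<delta>
    unfolding V_def using periodic_C_le[OF W, of 2] h2 by (intro periodic_C_lincomb) auto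
  have V1: "V \<delta> \<in> periodic_C 1" for \<delta> using V by (rule periodic_C_le) simp
  have V_mean: "circle_mean (V \<delta>) = 0" for \<delta>
    unfolding V_def circle_mean_lincomb[OF W h2] W_mean h2_mean by simp
  have V_bound: "C_norm_le 1 (V \<delta>) ((A + B) * \<delta>)" if \<delta>: "0 < \<delta>" for \<delta>
    unfolding C_norm_le_def
  proof (intro allI impI)
    fix j :: nat and x assume j: "j \<le> 1"
    define g where "g = (deriv ^^ j) (G \<delta>)"
    have g: "g \<in> periodic_C (0 + 3)"
      unfolding g_def using j by (intro periodic_C_deriv_iterate[OF G]) auto
    have it: "(deriv ^^ m) g = (deriv ^^ (m + j)) (G \<delta>)" for m
      by (simp add: g_def funpow_add)
    have "\<bar>(deriv ^^ 3) g y\<bar> \<le> A" for y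
      unfolding it using j by (intro C_norm_leD[OF G_bound]) auto
    then have 1: "\<bar>avg \<delta> g x - g x - \<delta>\<^sup>2 / 2 * m2 * (deriv ^^ 2) g x\<bar> \<le> A * \<delta> ^ 3"
      unfolding m2_def using \<delta> by (intro avg_second_order[OF g] centred) auto
    have "(deriv ^^ j) (V \<delta>) x = 1 / \<delta>\<^sup>2 * (deriv ^^ j) (W \<delta>) x + (- (m2 / 2)) * (deriv ^^ j) h2 x"
      unfolding V_def using periodic_C_le[OF W, of 2] h2 j by (intro periodic_C_deriv_iterate_lincomb[of _ 2]) auto
    also have "\<dots> = 1 / \<delta>\<^sup>2 * (avg \<delta> g x - g x) - m2 / 2 * (deriv ^^ (2 + j)) (H 0) x"
    proof -
      have "(deriv ^^ j) h2 = (deriv ^^ (2 + j)) (H 0)"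
        unfolding h2_def add.commute[of 2 j] funpow_add o_apply ..
      then show ?thesis using W_deriv[of j] j by (simp add: g_def del: funpow.simps)
    qed
    also have "\<dots> = (avg \<delta> g x - g x - \<delta>\<^sup>2 / 2 * m2 * (deriv ^^ 2) g x) / \<delta>\<^sup>2
        + m2 / 2 * (deriv ^^ (2 + j)) (L (E \<delta>)) x"
    proof -
      have e: "(deriv ^^ (2 + j)) (L (E \<delta>)) x = (deriv ^^ (2 + j)) (G \<delta>) x - (deriv ^^ (2 + j)) (H 0) x"
        unfolding LE using j by (intro periodic_C_deriv_iterate_diff[OF G H]) auto
      show ?thesis unfolding it e using \<delta> by (simp add: field_simps del: funpow.simps)
    qed
    also have "\<bar>\<dots>\<bar> \<le> A * \<delta> ^ 3 / \<delta>\<^sup>2 + 1 * (B * \<delta>)"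
    proof (intro order_trans[OF abs_triangle_ineq] add_mono)
      show "\<bar>(avg \<delta> g x - g x - \<delta>\<^sup>2 / 2 * m2 * (deriv ^^ 2) g x) / \<delta>\<^sup>2\<bar> \<le> A * \<delta> ^ 3 / \<delta>\<^sup>2"
        using 1 by (simp add: abs_divide divide_right_mono)
      show "\<bar>m2 / 2 * (deriv ^^ (2 + j)) (L (E \<delta>)) x\<bar> \<le> 1 * (B * \<delta>)"
        unfolding abs_mult using m2 j by (intro mult_mono C_norm_leD[OF LE_bound[OF \<delta>]]) auto
    qed
    also have "\<dots> = (A + B) * \<delta>" using \<delta> by (simp add: field_simps eval_nat_numeral)
    finally show "\<bar>(deriv ^^ j) (V \<delta>) x\<bar> \<le> (A + B) * \<delta>" .
  qed
  define v where "v \<delta> = (\<lambda>x. 1 / \<delta>\<^sup>2 * E \<delta> x + (- (m2 / 2)) * u x)" for \<delta>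
  have E1: "E \<delta> \<in> periodic_C 1" for \<delta> using E by (rule periodic_C_le) simp
  have v: "v \<delta> \<in> periodic_C 1" "circle_mean (v \<delta>) = 0" for \<delta>
    unfolding v_def circle_mean_lincomb[OF E1 u(1)] E_mean u(2)
    by (rule periodic_C_lincomb[OF E1 u(1)]) simp
  have "v \<delta> x - L (v \<delta>) x = V \<delta> x" for \<delta> x
  proof -
    have "L (v \<delta>) = (\<lambda>x. 1 / \<delta>\<^sup>2 * L (E \<delta>) x + (- (m2 / 2)) * L u x)"
      unfolding v_def by (rule L1.Q_lincomb[OF E1 u(1)])
    moreover have "L u x = u x - h2 x"
      using L1.R_inverse_left[OF h2_1 h2_mean, of x] by (simp add: u_def)
    moreover have "L (E \<delta>) x = E \<delta> x - W \<delta> x" using EW[of \<delta> x] by simp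
    ultimately have "L (v \<delta>) x = 1 / \<delta>\<^sup>2 * (E \<delta> x - W \<delta> x) + (- (m2 / 2)) * (u x - h2 x)"
      by (simp only:)
    then show ?thesis by (simp add: v_def V_def algebra_simps diff_divide_distrib)
  qed
  then have "v \<delta> = L1.R (V \<delta>)" for \<delta> using v V1 by (intro L1.R_unique)
  then have v_bound: "C_norm_le 1 (v \<delta>) (L1.C\<^sub>1 * ((A + B) * \<delta>))" if "0 < \<delta>" for \<delta>
    using L1.R_bounded[OF V1 V_bound[OF that] V_mean] by simp
  define C where "C = max (L1.C\<^sub>1 * M) (L1.C\<^sub>1 * (A + B))"
  show ?thesis
  proof (rule that[of H u L1.\<theta> C])
    show "C_norm_le 1 (\<lambda>x. u x - (\<Sum>i<n. (L ^^ i) ((deriv ^^ 2) (H 0)) x)) (C * L1.\<theta> ^ n)" for n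
    proof (rule C_norm_le_mono)
      show "C_norm_le 1 (\<lambda>x. u x - (\<Sum>i<n. (L ^^ i) ((deriv ^^ 2) (H 0)) x)) (L1.C\<^sub>1 * M * L1.\<theta> ^ n)"
        using u_lim by (simp add: h2_def)
      show "L1.C\<^sub>1 * M * L1.\<theta> ^ n \<le> C * L1.\<theta> ^ n"
        using L1.\<theta>(1) by (intro mult_right_mono) (auto simp: C_def)
    qed simp
    show "C_norm_le 1 (\<lambda>x. (H \<delta> x - H 0 x) / \<delta>\<^sup>2 - (LINT z|\<nu>. z\<^sup>2) / 2 * u x) (C * \<delta>)"
      if "0 < \<delta>" for \<delta>
    proof (rule C_norm_le_mono)
      show "C_norm_le 1 (\<lambda>x. (H \<delta> x - H 0 x) / \<delta>\<^sup>2 - (LINT z|\<nu>. z\<^sup>2) / 2 * u x) (L1.C\<^sub>1 * ((A + B) * \<delta>))"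
        using v_bound[OF that] by (simp add: v_def E_def m2_def)
      have "L1.C\<^sub>1 * (A + B) * \<delta> \<le> C * \<delta>"
        using that by (intro mult_right_mono) (auto simp: C_def)
      then show "L1.C\<^sub>1 * ((A + B) * \<delta>) \<le> C * \<delta>" by (simp add: mult.assoc)
    qed simp
  qed (use H H_nonneg H_mean H_fix u L1.\<theta> in auto)
qed

end

section \<open>Weak derivatives of functions with a smooth representative\<close>

text \<open>Both trigonometric functions are treated at once so that the derivative has the same form.\<close>

lemma C_class_trig: "C_class k (\<lambda>x. A * cos (c * x + b) + B * sin (c * x + b))"
proof (induction k arbitrary: A B)
  case 0
  then show ?case by (auto simp: C_class_0 intro!: continuous_intros)
next
  case (Suc k)
  show ?case
  proof (rule C_class_SucI)
    show "((\<lambda>x. A * cos (c * x + b) + B * sin (c * x + b)) has_real_derivative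
        (B * c) * cos (c * x + b) + (- A * c) * sin (c * x + b)) (at x)" for x
      by (auto intro!: derivative_eq_intros simp: algebra_simps)
  qed (rule Suc)
qed

lemma AE_eq_0_of_integral_sign_sets:
  fixes G :: "'a \<Rightarrow> real"
  assumes G: "integrable M G"
    and pos: "(LINT x:{x\<in>space M. 0 < G x}|M. G x) = 0"
    and neg: "(LINT x:{x\<in>space M. G x < 0}|M. G x) = 0"
  shows "AE x in M. G x = 0"
proof -
  have [measurable]: "G \<in> borel_measurable M" using G by auto
  have int: "integrable M (\<lambda>x. indicator A x *\<^sub>R G x)" if "A \<in> sets M" for A
    using that G by (rule integrable_mult_indicator)
  have "AE x in M. indicator {x\<in>space M. 0 < G x} x *\<^sub>R G x = 0"
  proof (subst integral_nonneg_eq_0_iff_AE[symmetric])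
    show "AE x in M. 0 \<le> indicator {x\<in>space M. 0 < G x} x *\<^sub>R G x"
      by (auto simp: indicator_def)
  qed (use pos in \<open>auto simp: set_lebesgue_integral_def simp del: real_scaleR_def intro!: int\<close>)
  moreover have "AE x in M. - (indicator {x\<in>space M. G x < 0} x *\<^sub>R G x) = 0"
  proof (subst integral_nonneg_eq_0_iff_AE[symmetric])
    show "AE x in M. 0 \<le> - (indicator {x\<in>space M. G x < 0} x *\<^sub>R G x)"
      by (auto simp: indicator_def)
  qed (use neg in \<open>auto simp: set_lebesgue_integral_def simp del: real_scaleR_def intro!: int\<close>)
  ultimately show ?thesis
    using AE_space by eventually_elim (auto simp: indicator_def split: if_splits)
qed

lemma AE_lborel_of_AE_period:
  assumes AE: "AE x in lborel. x \<in> {0..<1} \<longrightarrow> P x" and periodic: "circle_fun P"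
    and [measurable]: "Measurable.pred borel P"
  shows "AE x in lborel. P x"
proof -
  have "AE x in lborel. - of_int n + 1 * x \<in> {0..<1} \<longrightarrow> P (- of_int n + 1 * x)" for n
    by (rule AE_borel_affine[OF _ _ AE]) auto
  then have "AE x in lborel. \<forall>n::int. - of_int n + 1 * x \<in> {0..<1} \<longrightarrow> P (- of_int n + 1 * x)"
    by (simp only: AE_all_countable) auto
  then show ?thesis
  proof eventually_elim
    case (elim x)
    have "- of_int \<lfloor>x\<rfloor> + 1 * x \<in> {0..<1}" by (auto; linarith)
    then have "P (- of_int \<lfloor>x\<rfloor> + 1 * x)" using elim by blast
    then show ?case using circle_fun_shift_int[OF periodic, of x "- \<lfloor>x\<rfloor>"] by (simp add: add.commute)
  qed
qed

lemma circle_L1D: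
  assumes "f \<in> circle_L1"
  shows "circle_fun f" "f \<in> borel_measurable borel" "set_integrable lborel {0..<1} f"
  using assms by (auto simp: circle_L1_def)

lemma periodic_C_circle_L1: "F \<in> periodic_C k \<Longrightarrow> F \<in> circle_L1"
  using periodic_C_integrable[of F k] by (auto simp: circle_L1_def periodic_C_circle intro: periodic_C_measurable)

lemma circle_L1_lincomb: "f \<in> circle_L1 \<Longrightarrow> g \<in> circle_L1 \<Longrightarrow> (\<lambda>x. a * f x + b * g x) \<in> circle_L1"
  unfolding circle_L1_def by (auto simp: circle_fun_def intro!: set_integral_add)

lemma circle_L1_mult_bounded:
  assumes f: "f \<in> circle_L1" and \<phi>: "\<phi> \<in> periodic_C k"
  shows "set_integrable lborel {0..<1} (\<lambda>x. f x * \<phi> x)"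
proof -
  obtain M where M: "0 \<le> M" "\<And>x. \<bar>\<phi> x\<bar> \<le> M" using periodic_C_bounded[OF \<phi>] by blast
  have [measurable]: "f \<in> borel_measurable borel" "\<phi> \<in> borel_measurable borel"
    using circle_L1D(2)[OF f] periodic_C_measurable[OF \<phi>] by auto
  have "integrable lborel (\<lambda>x. M * (indicator {0..<1} x *\<^sub>R f x))"
    using circle_L1D(3)[OF f] by (simp add: set_integrable_def)
  then show ?thesis
    unfolding set_integrable_def
  proof (rule Bochner_Integration.integrable_bound)
    show "AE x in lborel. norm (indicator {0..<1} x *\<^sub>R (f x * \<phi> x)) \<le> norm (M * (indicator {0..<1} x *\<^sub>R f x))"
    proof (intro AE_I2)
      fix x
      have "\<bar>f x\<bar> * \<bar>\<phi> x\<bar> \<le> \<bar>f x\<bar> * M" using M by (intro mult_left_mono) auto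
      then show "norm (indicator {0..<1} x *\<^sub>R (f x * \<phi> x)) \<le> norm (M * (indicator {0..<1} x *\<^sub>R f x))"
        using M(1) by (auto simp: indicator_def abs_mult mult.commute)
    qed
  qed simp
qed

lemma circle_L1_AE_eq_mean:
  assumes "f \<in> circle_L1" "g \<in> circle_L1" "AE x in lborel. f x = g x"
  shows "(LINT x:{0..<1}|lborel. f x) = (LINT x:{0..<1}|lborel. g x)"
  unfolding set_lebesgue_integral_def
  by (rule integral_cong_AE)
     (use assms circle_L1D(2)[OF assms(1)] circle_L1D(2)[OF assms(2)] in \<open>auto\<close>)

text \<open>A smooth approximation of the indicator function of {q > 0} that is bounded by 1 and converges
pointwise everywhere, built from exponentials only. The term n in the exponent decides the case q = 0.\<close>

lemma smooth_cutoff_limit: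
  fixes q :: real
  shows "(\<lambda>n. exp (- exp (real n - (real n)\<^sup>2 * q))) \<longlonglongrightarrow> (if 0 < q then 1 else 0)"
proof -
  consider "0 < q" | "q = 0" | "q < 0" by linarith
  then show ?thesis
  proof cases
    case 1
    then have "(\<lambda>n. exp (- exp (real n - (real n)\<^sup>2 * q))) \<longlonglongrightarrow> 1" by real_asymp
    then show ?thesis using 1 by simp
  next
    case 2
    have "(\<lambda>n. exp (- exp (real n))) \<longlonglongrightarrow> 0" by real_asymp
    then show ?thesis using 2 by simp
  next
    case 3
    then have "(\<lambda>n. exp (- exp (real n - (real n)\<^sup>2 * q))) \<longlonglongrightarrow> 0" by real_asymp
    then show ?thesis using 3 by simp
  qed
qed

text \<open>The fundamental lemma of the calculus of variations. On (0,1) the trigonometric polynomial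
q x = cos (2 \<pi> x - \<pi> a) - cos (\<pi> a) is positive exactly for x < a, so the smooth cutoffs of q show that the
integral of g vanishes over [0,a) for each a. These intervals generate the Borel sets.\<close>

lemma fundamental_lemma_circle:
  assumes g: "g \<in> circle_L1"
    and test: "\<And>\<phi>. circle_fun \<phi> \<Longrightarrow> (\<And>n. C_class n \<phi>) \<Longrightarrow> (LINT x:{0..<1}|lborel. g x * \<phi> x) = 0"
  shows "AE x in lborel. g x = 0"
proof -
  have [measurable]: "g \<in> borel_measurable borel" using g by (rule circle_L1D)
  define G where "G x = indicator {0..<1} x * g x" for x
  have G: "integrable lborel G" using circle_L1D(3)[OF g] by (simp add: set_integrable_def G_def[abs_def])
  have [measurable]: "G \<in> borel_measurable borel" unfolding G_def by measurable
  have G_test: "(LINT x|lborel. G x * \<phi> x) = 0" if "circle_fun \<phi>" "\<And>n. C_class n \<phi>" for \<phi>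
    using test[OF that] by (simp add: set_lebesgue_integral_def G_def mult.assoc)
  have G_total: "(LINT x|lborel. G x) = 0"
    using G_test[of "\<lambda>x. 1"] by (simp add: circle_fun_def C_class_const)
  have half_line: "(LINT x:{..<a}|lborel. G x) = 0" for a
  proof -
    consider "a \<le> 0" | "1 \<le> a" | "0 < a" "a < 1" by linarith
    then show ?thesis
    proof cases
      case 1
      then have "(\<lambda>x. indicator {..<a} x *\<^sub>R G x) = (\<lambda>x. 0)" by (auto simp: G_def indicator_def)
      then show ?thesis by (simp add: set_lebesgue_integral_def)
    next
      case 2
      then have "(\<lambda>x. indicator {..<a} x *\<^sub>R G x) = G" by (auto simp: G_def indicator_def)
      then show ?thesis using G_total by (simp add: set_lebesgue_integral_def)
    next
      case 3
      define q where "q x = cos (2 * pi * x + (- pi * a)) - cos (pi * a)" for x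
      define \<phi> where "\<phi> n x = exp (- exp (real n - (real n)\<^sup>2 * q x))" for n x
      have q_smooth: "C_class k q" for k
        using C_class_add[OF C_class_trig[of k 1 "2 * pi" "- pi * a" 0] C_class_const[of k "- cos (pi * a)"]]
        by (simp add: q_def[abs_def])
      have \<phi>_smooth: "C_class k (\<phi> n)" for n k
      proof -
        have "C_class k (\<lambda>x. real n + (- (real n)\<^sup>2) * q x)"
          by (intro C_class_add C_class_mult C_class_const q_smooth)
        then have "C_class k (\<lambda>x. exp ((-1) * exp (real n + (- (real n)\<^sup>2) * q x)))"
          by (intro C_class_exp C_class_mult C_class_const)
        then show ?thesis by (simp add: \<phi>_def[abs_def])
      qed
      have "q (x + 1) = q x" for x
      proof -
        have "2 * pi * (x + 1) + (- pi * a) = (2 * pi * x + (- pi * a)) + 2 * pi" by (simp add: algebra_simps)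
        then show ?thesis unfolding q_def by (simp only: cos_periodic)
      qed
      then have \<phi>_per: "circle_fun (\<phi> n)" for n by (simp add: circle_fun_def \<phi>_def)
      have q_sign: "0 < q x \<longleftrightarrow> x < a" if "0 < x" "x < 1" for x
      proof -
        have q_prod: "q x = 2 * (sin (pi * x) * sin (pi * (a - x)))"
          unfolding q_def by (simp add: cos_diff_cos algebra_simps diff_divide_distrib)
        have "0 < sin (pi * x)" using that by (intro sin_gt_zero) auto
        moreover have "0 < sin (pi * (a - x)) \<longleftrightarrow> x < a"
        proof
          assume "x < a"
          then show "0 < sin (pi * (a - x))"
            using that 3 mult_strict_left_mono[of "a - x" 1 pi] by (intro sin_gt_zero) auto
        next
          assume *: "0 < sin (pi * (a - x))"
          show "x < a"
          proof (rule ccontr)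
            assume "\<not> x < a"
            then have "0 \<le> sin (pi * (x - a))"
              using that 3 mult_left_mono[of "x - a" 1 pi] by (intro sin_ge_zero) auto
            then show False using * sin_minus[of "pi * (a - x)"] by (simp add: algebra_simps)
          qed
        qed
        ultimately show ?thesis unfolding q_prod by (simp add: zero_less_mult_iff)
      qed
      have "(\<lambda>n. LINT x|lborel. G x * \<phi> n x) \<longlonglongrightarrow> (LINT x|lborel. indicator {..<a} x *\<^sub>R G x)"
      proof (rule integral_dominated_convergence[where w = "\<lambda>x. \<bar>G x\<bar>"])
        show "AE x in lborel. (\<lambda>n. G x * \<phi> n x) \<longlonglongrightarrow> indicator {..<a} x *\<^sub>R G x"
          using AE_lborel_singleton[of "0::real"]
        proof eventually_elim
          case (elim x)
          have "(\<lambda>n. G x * \<phi> n x) \<longlonglongrightarrow> G x * (if 0 < q x then 1 else 0)"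
            unfolding \<phi>_def by (intro tendsto_mult_left smooth_cutoff_limit)
          moreover have "G x * (if 0 < q x then 1 else 0) = indicator {..<a} x *\<^sub>R G x"
            using elim q_sign[of x] by (auto simp: G_def indicator_def)
          ultimately show ?case by simp
        qed
        show "AE x in lborel. norm (G x * \<phi> n x) \<le> \<bar>G x\<bar>" for n
          by (auto simp: abs_mult \<phi>_def intro!: AE_I2 mult_left_le)
        show "(\<lambda>x. G x * \<phi> n x) \<in> borel_measurable lborel" for n
        proof -
          have [measurable]: "\<phi> n \<in> borel_measurable borel"
            using C_class_continuous[OF \<phi>_smooth] by (intro borel_measurable_continuous_onI)
          show ?thesis by measurable
        qed
      qed (use G in auto)
      then have "(\<lambda>n. 0) \<longlonglongrightarrow> (LINT x|lborel. indicator {..<a} x *\<^sub>R G x)"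
        using G_test[OF \<phi>_per \<phi>_smooth] by simp
      then show ?thesis by (simp add: LIMSEQ_const_iff set_lebesgue_integral_def)
    qed
  qed
  have borel: "sets (borel :: real measure) = sigma_sets UNIV (range lessThan)"
    by (subst borel_Iio) (simp add: sets_measure_of)
  have null: "(LINT x:A|lborel. G x) = 0" if A: "A \<in> sets borel" for A
  proof -
    have sint: "set_integrable lborel B G" if "B \<in> sets borel" for B
      unfolding set_integrable_def using that G by (intro integrable_mult_indicator) auto
    have "Int_stable (range (lessThan :: real \<Rightarrow> real set))"
    proof -
      have "{..<a} \<inter> {..<b} = {..<min a b}" for a b :: real by auto
      then show ?thesis by (auto simp: Int_stable_def)
    qed
    moreover have "range lessThan \<subseteq> Pow (UNIV :: real set)" by simp
    moreover note A[unfolded borel]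
    ultimately show ?thesis
    proof (induction rule: sigma_sets_induct_disjoint)
      case (compl B)
      then have B: "B \<in> sets borel" by (simp add: borel)
      have "(LINT x:B \<union> (UNIV - B)|lborel. G x) = (LINT x:B|lborel. G x) + (LINT x:UNIV - B|lborel. G x)"
        using B by (intro set_integral_Un sint) auto
      then show ?case using compl G_total by (simp add: set_lebesgue_integral_def)
    next
      case (union B)
      then have B: "B i \<in> sets borel" for i by (auto simp: borel)
      have "(LINT x:(\<Union>i. B i)|lborel. G x) = (\<Sum>i. LINT x:B i|lborel. G x)"
        using B union(1) by (intro lebesgue_integral_countable_add sint) (auto simp: disjoint_family_on_def)
      then show ?case using union by simp
    qed (use half_line in \<open>auto simp: set_lebesgue_integral_def\<close>)
  qed
  have "AE x in lborel. G x = 0"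
    by (rule AE_eq_0_of_integral_sign_sets[OF G]) (auto intro!: null)
  then have "AE x in lborel. x \<in> {0..<1} \<longrightarrow> g x = 0"
    by eventually_elim (auto simp: G_def)
  moreover have "circle_fun (\<lambda>x. g x = 0)"
    using circle_L1D(1)[OF g] by (simp add: circle_fun_def)
  ultimately show ?thesis by (rule AE_lborel_of_AE_period) simp
qed

lemma has_weak_deriv_unique:
  assumes "has_weak_deriv k f g" "has_weak_deriv k f g'"
  shows "AE x in lborel. g x = g' x"
proof -
  have L1: "g \<in> circle_L1" "g' \<in> circle_L1" using assms by (auto simp: has_weak_deriv_def)
  have d: "(\<lambda>x. 1 * g x + (-1) * g' x) \<in> circle_L1" using L1 by (rule circle_L1_lincomb)
  have "AE x in lborel. 1 * g x + (-1) * g' x = 0"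
  proof (rule fundamental_lemma_circle[OF d])
    fix \<phi> assume \<phi>: "circle_fun \<phi>" "\<And>n. C_class n \<phi>"
    then have "\<phi> \<in> periodic_C 0" by (simp add: periodic_C_def)
    note i = circle_L1_mult_bounded[OF L1(1) this] circle_L1_mult_bounded[OF L1(2) this]
    have "(LINT x:{0..<1}|lborel. g x * \<phi> x) = (LINT x:{0..<1}|lborel. g' x * \<phi> x)"
      using assms \<phi> by (auto simp: has_weak_deriv_def)
    then show "(LINT x:{0..<1}|lborel. (1 * g x + (-1) * g' x) * \<phi> x) = 0"
      using set_integral_diff(2)[OF i] by (simp add: left_diff_distrib)
  qed
  then show ?thesis by eventually_elim simp
qed

lemma integral_by_parts_circle:
  assumes "F \<in> periodic_C k" "\<phi> \<in> periodic_C k"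
  shows "(LINT x:{0..<1}|lborel. F x * (deriv ^^ k) \<phi> x)
    = (-1) ^ k * (LINT x:{0..<1}|lborel. (deriv ^^ k) F x * \<phi> x)"
  using assms
proof (induction k arbitrary: \<phi>)
  case (Suc k)
  have \<phi>': "deriv \<phi> \<in> periodic_C k" using Suc.prems(2) by (rule periodic_C_deriv)
  have Fk: "(deriv ^^ k) F \<in> periodic_C 1" using Suc.prems(1) by (rule periodic_C_deriv_iterate) simp
  have \<phi>1: "\<phi> \<in> periodic_C 1" using Suc.prems(2) by (rule periodic_C_le) simp
  have p: "(\<lambda>x. (deriv ^^ k) F x * \<phi> x) \<in> periodic_C (Suc 0)"
    using Fk \<phi>1 by (intro periodic_C_mult) auto
  have "deriv (\<lambda>x. (deriv ^^ k) F x * \<phi> x) = (\<lambda>x. (deriv ^^ Suc k) F x * \<phi> x + (deriv ^^ k) F x * deriv \<phi> x)"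
    using periodic_C_DERIV[OF Fk, of 0] periodic_C_DERIV[OF \<phi>1, of 0]
    by (intro ext DERIV_imp_deriv) (auto intro!: derivative_eq_intros)
  then have "(LINT x:{0..<1}|lborel. (deriv ^^ Suc k) F x * \<phi> x + (deriv ^^ k) F x * deriv \<phi> x) = 0"
    using circle_mean_deriv[OF p] by (simp add: circle_mean_def)
  moreover have "set_integrable lborel {0..<1} (\<lambda>x. (deriv ^^ Suc k) F x * \<phi> x)"
    "set_integrable lborel {0..<1} (\<lambda>x. (deriv ^^ k) F x * deriv \<phi> x)"
    using periodic_C_deriv_iterate[OF Suc.prems(1), of "Suc k" 0] periodic_C_le[OF Fk, of 0]
      periodic_C_le[OF \<phi>1, of 0] periodic_C_le[OF \<phi>', of 0]
    by (auto intro!: periodic_C_integrable[of _ 0] periodic_C_mult simp del: funpow.simps)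
  ultimately have "(LINT x:{0..<1}|lborel. (deriv ^^ k) F x * deriv \<phi> x)
      = - (LINT x:{0..<1}|lborel. (deriv ^^ Suc k) F x * \<phi> x)"
    by (subst (asm) set_integral_add(2)) auto
  moreover have "(LINT x:{0..<1}|lborel. F x * (deriv ^^ k) (deriv \<phi>) x)
      = (-1) ^ k * (LINT x:{0..<1}|lborel. (deriv ^^ k) F x * deriv \<phi> x)"
    using Suc.IH[OF periodic_C_le[OF Suc.prems(1)] \<phi>'] by simp
  ultimately show ?case by (simp add: funpow_Suc_right del: funpow.simps)
qed simp

text \<open>f is a member of the almost everywhere class of the smooth function F. Weak derivatives, transfer
operators and resolvents are determined up to null sets only, and the results below say that they respect
this relation.\<close>

definition represents :: "nat \<Rightarrow> (real \<Rightarrow> real) \<Rightarrow> (real \<Rightarrow> real) \<Rightarrow> bool" where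
  "represents k f F \<longleftrightarrow> f \<in> circle_L1 \<and> F \<in> periodic_C k \<and> (AE x in lborel. f x = F x)"

lemma represents_self: "F \<in> periodic_C k \<Longrightarrow> represents k F F"
  by (simp add: represents_def periodic_C_circle_L1)

lemma represents_lincomb:
  assumes "represents k f F" "represents k g G"
  shows "represents k (\<lambda>x. a * f x + b * g x) (\<lambda>x. a * F x + b * G x)"
  using assms unfolding represents_def
  by (auto intro: circle_L1_lincomb periodic_C_lincomb)

lemma represents_sum:
  assumes "finite I" "\<And>i. i \<in> I \<Longrightarrow> represents k (f i) (F i)"
  shows "represents k (\<lambda>x. \<Sum>i\<in>I. f i x) (\<lambda>x. \<Sum>i\<in>I. F i x)"
  using assms
proof (induction I rule: finite_induct)
  case (insert i I)
  then show ?case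
    using represents_lincomb[of k "f i" "F i" "\<lambda>x. \<Sum>i\<in>I. f i x" "\<lambda>x. \<Sum>i\<in>I. F i x" 1 1] by simp
qed (use represents_self[OF periodic_C_const[of 0 k]] in simp)

lemma represents_mean: "represents k f F \<Longrightarrow> (LINT x:{0..<1}|lborel. f x) = circle_mean F"
  unfolding represents_def circle_mean_def by (blast intro: circle_L1_AE_eq_mean periodic_C_circle_L1)

lemma represents_has_weak_deriv:
  assumes "represents k f F" "j \<le> k"
  shows "has_weak_deriv j f ((deriv ^^ j) F)"
  unfolding has_weak_deriv_def
proof (intro conjI allI impI)
  show f: "f \<in> circle_L1" using assms by (simp add: represents_def)
  have F: "F \<in> periodic_C j" using assms by (auto simp: represents_def intro: periodic_C_le)
  show "(deriv ^^ j) F \<in> circle_L1"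
    using periodic_C_deriv_iterate[OF F, of j 0] by (auto intro: periodic_C_circle_L1)
  fix \<phi> assume \<phi>: "circle_fun \<phi> \<and> (\<forall>n. C_class n \<phi>)"
  then have \<phi>j: "\<phi> \<in> periodic_C j" by (simp add: periodic_C_def)
  have [measurable]: "f \<in> borel_measurable borel" "F \<in> borel_measurable borel"
    "(deriv ^^ j) \<phi> \<in> borel_measurable borel"
    using circle_L1D(2)[OF f] periodic_C_measurable[OF F]
      periodic_C_measurable[OF periodic_C_deriv_iterate[OF \<phi>j, of j 0]] by auto
  have "(LINT x:{0..<1}|lborel. f x * (deriv ^^ j) \<phi> x) = (LINT x:{0..<1}|lborel. F x * (deriv ^^ j) \<phi> x)"
    unfolding set_lebesgue_integral_def
  proof (rule integral_cong_AE)
    have "AE x in lborel. f x = F x" using assms by (simp add: represents_def)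
    then show "AE x in lborel. indicator {0..<1} x *\<^sub>R (f x * (deriv ^^ j) \<phi> x)
        = indicator {0..<1} x *\<^sub>R (F x * (deriv ^^ j) \<phi> x)"
      by eventually_elim simp
  qed measurable
  then show "(LINT x:{0..<1}|lborel. f x * (deriv ^^ j) \<phi> x)
      = (-1) ^ j * (LINT x:{0..<1}|lborel. (deriv ^^ j) F x * \<phi> x)"
    using integral_by_parts_circle[OF F \<phi>j] by simp
qed

lemma represents_weak_deriv:
  assumes "represents k f F" "j \<le> k"
  shows "represents (k - j) (weak_deriv j f) ((deriv ^^ j) F)"
proof -
  note w = represents_has_weak_deriv[OF assms]
  then have w': "has_weak_deriv j f (weak_deriv j f)"
    unfolding weak_deriv_def by (rule someI[of "has_weak_deriv j f"])
  have "(deriv ^^ j) F \<in> periodic_C (k - j)"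
    using assms by (intro periodic_C_deriv_iterate[of F k]) (auto simp: represents_def)
  then show ?thesis
    using has_weak_deriv_unique[OF w' w] w' by (simp add: represents_def has_weak_deriv_def)
qed

lemma represents_sobolev: "represents k f F \<Longrightarrow> f \<in> sobolev k"
  using represents_has_weak_deriv unfolding sobolev_def represents_def by blast

lemma represents_sobolev_norm_le:
  assumes f: "represents 1 f F" and F: "C_norm_le 1 F M"
  shows "sobolev_norm 1 f \<le> 2 * M"
proof -
  have "(LINT x:{0..<1}|lborel. \<bar>weak_deriv j f x\<bar>) \<le> M" if j: "j \<le> 1" for j
  proof -
    note w = represents_weak_deriv[OF f j]
    have "(LINT x:{0..<1}|lborel. \<bar>weak_deriv j f x\<bar>) \<le> (LINT x:{0..<1::real}|lborel. M)"
      unfolding set_lebesgue_integral_def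
    proof (rule integral_mono_AE)
      show "integrable lborel (\<lambda>x::real. indicator {0..<1} x *\<^sub>R M)" by simp
      show "integrable lborel (\<lambda>x. indicator {0..<1} x *\<^sub>R \<bar>weak_deriv j f x\<bar>)"
        using circle_L1D(3)[of "weak_deriv j f"] w set_integrable_abs
        by (auto simp: represents_def set_integrable_def[symmetric] simp del: real_scaleR_def)
      have "AE x in lborel. weak_deriv j f x = (deriv ^^ j) F x" using w by (simp add: represents_def)
      then show "AE x in lborel. indicator {0..<1} x *\<^sub>R \<bar>weak_deriv j f x\<bar> \<le> indicator {0..<1} x *\<^sub>R M"
      proof eventually_elim
        case (elim x)
        then show ?case using C_norm_leD[OF F j, of x] by (simp add: indicator_def)
      qed
    qed
    then show ?thesis by (simp add: set_lebesgue_integral_def)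
  qed
  from this[of 0] this[of 1] show ?thesis by (simp add: sobolev_norm_def)
qed

lemma sobolev_norm_nonneg: "0 \<le> sobolev_norm k f"
  unfolding sobolev_norm_def set_lebesgue_integral_def by (intro sum_nonneg Bochner_Integration.integral_nonneg) auto

lemma L1_norm_le_sobolev_norm:
  assumes f: "f \<in> circle_L1"
  shows "(LINT x:{0..<1}|lborel. \<bar>f x\<bar>) \<le> sobolev_norm k f"
proof -
  have w: "has_weak_deriv 0 f f" using f by (simp add: has_weak_deriv_def)
  then have w': "has_weak_deriv 0 f (weak_deriv 0 f)"
    unfolding weak_deriv_def by (rule someI[of "has_weak_deriv 0 f"])
  have L1: "weak_deriv 0 f \<in> circle_L1" using w' by (simp add: has_weak_deriv_def)
  have "(LINT x:{0..<1}|lborel. \<bar>f x\<bar>) = (LINT x:{0..<1}|lborel. \<bar>weak_deriv 0 f x\<bar>)"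
    unfolding set_lebesgue_integral_def
  proof (rule integral_cong_AE)
    show "AE x in lborel. indicator {0..<1} x *\<^sub>R \<bar>f x\<bar> = indicator {0..<1} x *\<^sub>R \<bar>weak_deriv 0 f x\<bar>"
      using has_weak_deriv_unique[OF w w'] by eventually_elim simp
  qed (use circle_L1D(2)[OF f] circle_L1D(2)[OF L1] in auto)
  also have "\<dots> \<le> sobolev_norm k f"
    unfolding sobolev_norm_def
    by (rule member_le_sum) (auto simp: set_lebesgue_integral_def intro!: Bochner_Integration.integral_nonneg)
  finally show ?thesis .
qed

section \<open>Identification of the operators and of the resolvent\<close>

text \<open>L F has the defining property of the transferred density. Two such densities agree almost everywhere,
because the sets where their difference is positive or negative are themselves Borel sets of the circle.\<close>

lemma (in expanding_circle_map) transfer_represents: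
  assumes f: "represents k f F" and k: "k \<le> N"
  shows "represents k (transfer T f) (L F)"
proof -
  have fL1: "f \<in> circle_L1" and F: "F \<in> periodic_C k" and ae: "AE x in lborel. f x = F x"
    using f by (auto simp: represents_def)
  have LF: "L F \<in> periodic_C k" using F k by (rule L_periodic_C)
  have LF1: "L F \<in> circle_L1" using LF by (rule periodic_C_circle_L1)
  have [measurable]: "f \<in> borel_measurable borel" "F \<in> borel_measurable borel"
    "L F \<in> borel_measurable borel" "T \<in> borel_measurable borel"
    using circle_L1D(2)[OF fL1] periodic_C_measurable[OF F] periodic_C_measurable[OF LF]
      C_class_continuous[OF smooth, of UNIV] by (auto intro: borel_measurable_continuous_onI)
  define pushes where "pushes g \<longleftrightarrow> g \<in> circle_L1 \<and>
     (\<forall>A\<in>circle_borel. signed_measure g A = signed_measure f (T -` A))" for g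
  have "signed_measure (L F) A = signed_measure f (T -` A)" if A: "A \<in> circle_borel" for A
  proof -
    have [measurable]: "A \<in> sets borel" using A by (simp add: circle_borel_def)
    have "T -` A \<in> sets borel" using measurable_sets[of T borel borel A] by simp
    then have [measurable]: "{0..<1} \<inter> T -` A \<in> sets borel" by simp
    have "signed_measure F (T -` A) = signed_measure f (T -` A)"
      unfolding signed_measure_def set_lebesgue_integral_def
    proof (rule integral_cong_AE)
      show "AE x in lborel. indicator ({0..<1} \<inter> T -` A) x *\<^sub>R F x = indicator ({0..<1} \<inter> T -` A) x *\<^sub>R f x"
        using ae by eventually_elim simp
    qed measurable
    then show ?thesis using L_pushforward[OF F A] by simp
  qed
  then have "pushes (L F)" using LF1 by (simp add: pushes_def)
  then have "pushes (transfer T f)"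
    unfolding transfer_def pushes_def[symmetric] by (rule someI[of pushes])
  then have g: "transfer T f \<in> circle_L1"
    and eq: "\<And>A. A \<in> circle_borel \<Longrightarrow> signed_measure (transfer T f) A = signed_measure (L F) A"
    using \<open>pushes (L F)\<close> by (auto simp: pushes_def)
  define d where "d = (\<lambda>x. 1 * transfer T f x + (-1) * L F x)"
  have d: "d \<in> circle_L1" unfolding d_def using g LF1 by (rule circle_L1_lincomb)
  have [measurable]: "d \<in> borel_measurable borel" using d by (rule circle_L1D)
  have d_null: "signed_measure d A = 0" if A: "A \<in> circle_borel" for A
  proof -
    have "{0..<1} \<inter> A \<in> sets lborel" using A by (intro sets.Int) (simp_all add: circle_borel_def)
    then have "set_integrable lborel ({0..<1} \<inter> A) (transfer T f)" "set_integrable lborel ({0..<1} \<inter> A) (L F)"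
      using circle_L1D(3)[OF g] circle_L1D(3)[OF LF1] by (auto intro: set_integrable_subset)
    then show ?thesis
      using eq[OF A] by (simp add: signed_measure_def d_def set_integral_diff(2))
  qed
  define D where "D x = indicator {0..<1} x *\<^sub>R d x" for x
  have "AE x in lborel. D x = 0"
  proof (rule AE_eq_0_of_integral_sign_sets)
    show "integrable lborel D"
      using circle_L1D(3)[OF d] by (simp add: D_def[abs_def] set_integrable_def)
    have "(\<lambda>x. indicator {x \<in> space lborel. 0 < D x} x *\<^sub>R D x)
        = (\<lambda>x. indicator ({0..<1} \<inter> {x. 0 < d x}) x *\<^sub>R d x)"
      by (auto simp: D_def indicator_def)
    moreover have "{x. 0 < d x} \<in> circle_borel"
      using circle_L1D(1)[OF d] by (auto simp: circle_borel_def circle_fun_def)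
    ultimately show "(LINT x:{x \<in> space lborel. 0 < D x}|lborel. D x) = 0"
      using d_null by (simp add: signed_measure_def set_lebesgue_integral_def)
    have "(\<lambda>x. indicator {x \<in> space lborel. D x < 0} x *\<^sub>R D x)
        = (\<lambda>x. indicator ({0..<1} \<inter> {x. d x < 0}) x *\<^sub>R d x)"
      by (auto simp: D_def indicator_def)
    moreover have "{x. d x < 0} \<in> circle_borel"
      using circle_L1D(1)[OF d] by (auto simp: circle_borel_def circle_fun_def)
    ultimately show "(LINT x:{x \<in> space lborel. D x < 0}|lborel. D x) = 0"
      using d_null by (simp add: signed_measure_def set_lebesgue_integral_def)
  qed
  then have "AE x in lborel. x \<in> {0..<1} \<longrightarrow> d x = 0"
    by eventually_elim (auto simp: D_def)
  moreover have "circle_fun (\<lambda>x. d x = 0)"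
    using circle_L1D(1)[OF d] by (simp add: circle_fun_def)
  ultimately have "AE x in lborel. d x = 0"
    by (rule AE_lborel_of_AE_period) simp
  then have "AE x in lborel. transfer T f x = L F x"
    by eventually_elim (simp add: d_def)
  then show ?thesis using g LF by (simp add: represents_def)
qed

lemma (in expanding_circle_map) transfer_iterate_represents:
  assumes "represents k f F" "k \<le> N"
  shows "represents k ((transfer T ^^ i) f) ((L ^^ i) F)"
  by (induction i) (auto intro: assms transfer_represents)

lemma (in expanding_circle_map) neumann_sum_represents:
  assumes "represents k f F" "k \<le> N"
  shows "represents k (neumann_sum T f n) (\<lambda>x. \<Sum>i<n. (L ^^ i) F x)"
  unfolding neumann_sum_def[abs_def]
  by (intro represents_sum transfer_iterate_represents assms) auto

text \<open>The Sobolev norm dominates the L^1 norm, and limits in L^1 are unique up to null sets.\<close>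

lemma is_resolvent_unique:
  assumes u: "is_resolvent T g u" and v: "is_resolvent T g v"
  shows "AE x in lborel. u x = v x"
proof -
  have L1: "u \<in> circle_L1" "v \<in> circle_L1" "\<And>n. neumann_sum T g n \<in> circle_L1"
    using u v by (auto simp: is_resolvent_def zero_average_W11_def sobolev_def)
  have diff: "(\<lambda>x. a x - b x) \<in> circle_L1" if "a \<in> circle_L1" "b \<in> circle_L1" for a b
    using circle_L1_lincomb[OF that, of 1 "-1"] by simp
  have abs_int: "set_integrable lborel {0..<1} (\<lambda>x. \<bar>a x\<bar>)" if "a \<in> circle_L1" for a
    using circle_L1D(3)[OF that] by (rule set_integrable_abs)
  note [measurable] = circle_L1D(2)[OF L1(1)] circle_L1D(2)[OF L1(2)]
  have le: "(LINT x:{0..<1}|lborel. \<bar>u x - v x\<bar>)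
      \<le> sobolev_norm 1 (\<lambda>x. neumann_sum T g n x - u x) + sobolev_norm 1 (\<lambda>x. neumann_sum T g n x - v x)" for n
  proof -
    have i: "set_integrable lborel {0..<1} (\<lambda>x. \<bar>neumann_sum T g n x - u x\<bar>)"
      "set_integrable lborel {0..<1} (\<lambda>x. \<bar>neumann_sum T g n x - v x\<bar>)"
      by (rule abs_int[OF diff[OF L1(3) L1(1)]], rule abs_int[OF diff[OF L1(3) L1(2)]])
    have "(LINT x:{0..<1}|lborel. \<bar>u x - v x\<bar>)
        \<le> (LINT x:{0..<1}|lborel. \<bar>neumann_sum T g n x - u x\<bar> + \<bar>neumann_sum T g n x - v x\<bar>)"
      using L1 by (intro set_integral_mono set_integral_add(1) i abs_int diff) auto
    also have "\<dots> = (LINT x:{0..<1}|lborel. \<bar>neumann_sum T g n x - u x\<bar>)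
        + (LINT x:{0..<1}|lborel. \<bar>neumann_sum T g n x - v x\<bar>)"
      using i by (rule set_integral_add(2))
    also have "\<dots> \<le> sobolev_norm 1 (\<lambda>x. neumann_sum T g n x - u x) + sobolev_norm 1 (\<lambda>x. neumann_sum T g n x - v x)"
      using L1 by (intro add_mono L1_norm_le_sobolev_norm diff)
    finally show ?thesis .
  qed
  have "(\<lambda>n. sobolev_norm 1 (\<lambda>x. neumann_sum T g n x - u x) + sobolev_norm 1 (\<lambda>x. neumann_sum T g n x - v x))
      \<longlonglongrightarrow> 0 + 0"
    using u v by (intro tendsto_add) (auto simp: is_resolvent_def)
  then have "(LINT x:{0..<1}|lborel. \<bar>u x - v x\<bar>) \<le> 0"
    using le by (intro LIMSEQ_le_const[of _ 0]) auto
  moreover have "0 \<le> (LINT x:{0..<1}|lborel. \<bar>u x - v x\<bar>)"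
    unfolding set_lebesgue_integral_def by (intro Bochner_Integration.integral_nonneg) auto
  ultimately have "(LINT x|lborel. indicator {0..<1} x *\<^sub>R \<bar>u x - v x\<bar>) = 0"
    unfolding set_lebesgue_integral_def by (rule antisym)
  moreover have "integrable lborel (\<lambda>x. indicator {0..<1} x *\<^sub>R \<bar>u x - v x\<bar>)"
    using abs_int[OF diff[OF L1(1,2)]] by (simp add: set_integrable_def)
  ultimately have "AE x in lborel. indicator {0..<1} x *\<^sub>R \<bar>u x - v x\<bar> = 0"
    by (subst (asm) integral_nonneg_eq_0_iff_AE) auto
  then have "AE x in lborel. x \<in> {0..<1} \<longrightarrow> u x = v x"
    by eventually_elim (auto simp: indicator_def)

  moreover have "circle_fun (\<lambda>x. u x = v x)"
    using circle_L1D(1)[OF L1(1)] circle_L1D(1)[OF L1(2)] by (simp add: circle_fun_def)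
  ultimately show ?thesis by (rule AE_lborel_of_AE_period) simp
qed

text \<open>The law of the noise; the values of \<rho> outside [-1,1] are discarded.\<close>

definition noise_measure :: "(real \<Rightarrow> real) \<Rightarrow> real measure" where
  "noise_measure \<rho> = density lborel (\<lambda>z. ennreal (indicator {-1..1} z * \<rho> z))"

context
  fixes \<rho> :: "real \<Rightarrow> real"
  assumes \<rho>_int: "set_integrable lborel {-1..1} \<rho>"
    and \<rho>_nonneg: "AE x\<in>{-1..1} in lborel. 0 \<le> \<rho> x"
begin

lemma noise_weight: "integrable lborel (\<lambda>z. indicator {-1..1} z * \<rho> z)"
  "AE z in lborel. 0 \<le> indicator {-1..1} z * \<rho> z"
proof -
  show "integrable lborel (\<lambda>z. indicator {-1..1} z * \<rho> z)"
    using \<rho>_int by (simp add: set_integrable_def)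
  show "AE z in lborel. 0 \<le> indicator {-1..1} z * \<rho> z"
    using \<rho>_nonneg by eventually_elim (auto simp: indicator_def)
qed

lemma integral_noise_measure:
  assumes [measurable]: "f \<in> borel_measurable borel"
  shows "(LINT z|noise_measure \<rho>. f z) = (LINT z|lborel. indicator {-1..1} z * \<rho> z * (f z :: real))"
  unfolding noise_measure_def
  using borel_measurable_integrable[OF noise_weight(1)] noise_weight(2)
  by (subst integral_density) auto

lemma jitter_noise_measure:
  assumes "(LINT x:{-1..1}|lborel. \<rho> x) = 1"
  shows "jitter (noise_measure \<rho>)"
proof -
  have m: "(\<lambda>z. indicator {-1..1} z * \<rho> z) \<in> borel_measurable lborel"
    by (rule borel_measurable_integrable[OF noise_weight(1)])
  have "emeasure (noise_measure \<rho>) (space (noise_measure \<rho>)) = (\<integral>\<^sup>+ z. ennreal (indicator {-1..1} z * \<rho> z) \<partial>lborel)"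
    unfolding noise_measure_def using m by (subst emeasure_density) auto
  also have "\<dots> = ennreal (LINT z|lborel. indicator {-1..1} z * \<rho> z)"
    by (intro nn_integral_eq_integral noise_weight)
  also have "\<dots> = 1" using assms by (simp add: set_lebesgue_integral_def)
  finally interpret prob_space "noise_measure \<rho>" by (rule prob_spaceI)
  show ?thesis
  proof
    show "sets (noise_measure \<rho>) = sets borel" by (simp add: noise_measure_def)
    show "AE z in noise_measure \<rho>. \<bar>z\<bar> \<le> 1"
      unfolding noise_measure_def using m by (subst AE_density) (auto simp: indicator_def)
  qed
qed

lemma circle_conv_represents:
  assumes \<delta>: "0 < \<delta>" and g: "represents k g G"
  shows "circle_conv \<rho> \<delta> g x = (LINT z|noise_measure \<rho>. G (x - \<delta> * z))"
proof -
  have G: "G \<in> periodic_C k" and g1: "g \<in> circle_L1" and ae: "AE x in lborel. g x = G x"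
    using g by (auto simp: represents_def)
  have [measurable]: "g \<in> borel_measurable borel" "G \<in> borel_measurable borel"
    using circle_L1D(2)[OF g1] periodic_C_measurable[OF G] by auto
  have m [measurable]: "(\<lambda>z. indicator {-1..1} z * \<rho> z) \<in> borel_measurable borel"
    using borel_measurable_integrable[OF noise_weight(1)] by simp
  have "circle_conv \<rho> \<delta> g x
    = (LINT z|lborel. \<delta> * (indicator {-\<delta>..\<delta>} (0 + \<delta> * z) * (1 / \<delta> * \<rho> ((0 + \<delta> * z) / \<delta>) * g (x - (0 + \<delta> * z)))))"
    unfolding circle_conv_def set_lebesgue_integral_def rescale_def
    using \<delta> by (subst lborel_integral_real_affine[of \<delta> _ 0]) simp_all
  also have "\<dots> = (LINT z|lborel. indicator {-1..1} z * \<rho> z * g (x + (- \<delta>) * z))"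
  proof (intro Bochner_Integration.integral_cong refl)
    fix z
    have "\<delta> * z \<in> {-\<delta>..\<delta>} \<longleftrightarrow> z \<in> {-1..1}"
      using \<delta> mult_le_cancel_left_pos[OF \<delta>, of z 1] mult_le_cancel_left_pos[OF \<delta>, of "-1" z] by auto
    then show "\<delta> * (indicator {-\<delta>..\<delta>} (0 + \<delta> * z) * (1 / \<delta> * \<rho> ((0 + \<delta> * z) / \<delta>) * g (x - (0 + \<delta> * z))))
        = indicator {-1..1} z * \<rho> z * g (x + (- \<delta>) * z)"
      using \<delta> by (simp add: indicator_def)
  qed
  also have "\<dots> = (LINT z|lborel. indicator {-1..1} z * \<rho> z * G (x + (- \<delta>) * z))"
  proof (rule integral_cong_AE)
    have "AE z in lborel. g (x + (- \<delta>) * z) = G (x + (- \<delta>) * z)"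
      using \<delta> by (intro AE_borel_affine[OF _ _ ae]) auto
    then show "AE z in lborel. indicator {-1..1} z * \<rho> z * g (x + (- \<delta>) * z)
        = indicator {-1..1} z * \<rho> z * G (x + (- \<delta>) * z)"
      by eventually_elim simp
  qed measurable
  also have "\<dots> = (LINT z|noise_measure \<rho>. G (x - \<delta> * z))"
    by (subst integral_noise_measure) simp_all
  finally show ?thesis .
qed

end

section \<open>The second order expansion\<close>

theorem theorem1:
  fixes T :: "real \<Rightarrow> real" and \<rho> :: "real \<Rightarrow> real" and h :: "real \<Rightarrow> real \<Rightarrow> real"
  assumes "circle_lift T" and "C_class 8 T" and "expanding T"
    and "\<rho> \<in> BV_space (-1) 1"
    and "AE x\<in>{-1..1} in lborel. 0 \<le> \<rho> x"
    and "(LINT x:{-1..1}|lborel. \<rho> x) = 1"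
    and "(LINT x:{-1..1}|lborel. x * \<rho> x) = 0"
    and "\<And>\<delta>. \<delta> \<in> {0..1} \<Longrightarrow> h \<delta> \<in> sobolev 7"
    and "\<And>\<delta>. \<delta> \<in> {0..1} \<Longrightarrow> unique_fixed_density (noisy_transfer T \<rho> \<delta>) (h \<delta>)"
  shows "is_resolvent T (weak_deriv 2 (h 0)) (resolvent T (weak_deriv 2 (h 0)))
    \<and> ((\<lambda>\<delta>. sobolev_norm 1 (\<lambda>x. (h \<delta> x - h 0 x) / \<delta>\<^sup>2
            - variance_of \<rho> / 2 * resolvent T (weak_deriv 2 (h 0)) x)) \<longlongrightarrow> 0) (at_right 0)
    \<and> second_order_expansion 1 h"
proof -
  define \<nu> where "\<nu> = noise_measure \<rho>"
  have \<rho>_int: "set_integrable lborel {-1..1} \<rho>" using assms(4) by (simp add: BV_space_def)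
  note nu = integral_noise_measure[OF \<rho>_int assms(5), folded \<nu>_def]
  obtain \<alpha> where "1 < inverse \<alpha>" "\<And>x. inverse \<alpha> \<le> \<bar>deriv T x\<bar>"
    using assms(3) by (auto simp: expanding_def)
  then have "expanding_circle_map T \<alpha> 7"
    using assms(1,2) by unfold_locales (simp_all add: numeral_eq_Suc)
  moreover have "jitter \<nu>"
    unfolding \<nu>_def by (rule jitter_noise_measure[OF \<rho>_int assms(5,6)])
  ultimately interpret noisy_circle_map T \<alpha> 7 \<nu>
    by (simp add: noisy_circle_map_def)
  have centred: "(LINT z|\<nu>. z) = 0"
    using assms(7) nu[of "\<lambda>z. z"] by (simp add: set_lebesgue_integral_def mult_ac)
  have variance: "variance_of \<rho> = (LINT z|\<nu>. z\<^sup>2)"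
    using nu[of "\<lambda>z. z\<^sup>2"] by (simp add: variance_of_def set_lebesgue_integral_def mult_ac)
  obtain H u C r where
    H: "\<And>\<delta>. H \<delta> \<in> periodic_C 4" "\<And>\<delta> x. 0 \<le> H \<delta> x" "\<And>\<delta>. circle_mean (H \<delta>) = 1"
      "\<And>\<delta>. avg \<delta> (L (H \<delta>)) = H \<delta>"
    and u: "u \<in> periodic_C 1" "circle_mean u = 0" and r: "0 \<le> r" "r < 1"
    and neumann: "\<And>n. C_norm_le 1 (\<lambda>x. u x - (\<Sum>i<n. (L ^^ i) ((deriv ^^ 2) (H 0)) x)) (C * r ^ n)"
    and response: "\<And>\<delta>. 0 < \<delta> \<Longrightarrow>
      C_norm_le 1 (\<lambda>x. (H \<delta> x - H 0 x) / \<delta>\<^sup>2 - (LINT z|\<nu>. z\<^sup>2) / 2 * u x) (C * \<delta>)"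
  proof (rule smooth_second_order_response[OF _ centred], goal_cases)
    case (2 H u C r)
    show ?case by (rule 2(1)[OF 2(2-)])
  qed simp
  \<comment> \<open>the smooth fixed density is a fixed density of the noisy transfer operator, hence almost everywhere
    equal to the given one\<close>
  have h: "represents 4 (h \<delta>) (H \<delta>)" if \<delta>: "\<delta> \<in> {0..1}" for \<delta>
  proof -
    have fixed: "unique_fixed_density (noisy_transfer T \<rho> \<delta>) (h \<delta>)" using assms(9) \<delta> .
    have tr: "represents 4 (transfer T (H \<delta>)) (L (H \<delta>))"
      by (rule transfer_represents[OF represents_self[OF H(1)]]) simp
    have "AE x in lborel. noisy_transfer T \<rho> \<delta> (H \<delta>) x = H \<delta> x"
    proof (cases "\<delta> = 0")
      case True
      then show ?thesis using tr H(4)[of 0] by (simp add: noisy_transfer_def represents_def avg_0)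
    next
      case False
      then have "0 < \<delta>" using \<delta> by simp
      have "noisy_transfer T \<rho> \<delta> (H \<delta>) x = H \<delta> x" for x
        using circle_conv_represents[OF \<rho>_int assms(5) \<open>0 < \<delta>\<close> tr, of x, folded \<nu>_def] False
          fun_cong[OF H(4)[of \<delta>], of x]
        by (simp add: noisy_transfer_def avg_def)
      then show ?thesis by simp
    qed
    moreover have "circle_density (H \<delta>)"
      using H(2,3) periodic_C_circle_L1[OF H(1)] by (simp add: circle_density_def circle_mean_def)
    ultimately have "AE x in lborel. H \<delta> x = h \<delta> x"
      using fixed by (auto simp: unique_fixed_density_def)
    then have "AE x in lborel. h \<delta> x = H \<delta> x" by eventually_elim simp
    then show ?thesis
      using fixed H(1) by (simp add: represents_def unique_fixed_density_def circle_density_def)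
  qed
  have h1: "represents 1 (h \<delta>) (H \<delta>)" if "\<delta> \<in> {0..1}" for \<delta>
    using h[OF that] periodic_C_le[of _ 4 1] by (simp add: represents_def)
  define g where "g = weak_deriv 2 (h 0)"
  define U where "U = resolvent T g"
  have "represents (4 - 2) g ((deriv ^^ 2) (H 0))"
    unfolding g_def by (rule represents_weak_deriv[OF h]) auto
  then have g: "represents 1 g ((deriv ^^ 2) (H 0))"
    using periodic_C_le[of _ 2 1] by (simp add: represents_def)
  have S: "represents 1 (neumann_sum T g n) (\<lambda>x. \<Sum>i<n. (L ^^ i) ((deriv ^^ 2) (H 0)) x)" for n
    by (rule neumann_sum_represents[OF g]) simp
  have zero_avg: "f \<in> zero_average_W11" if "represents 1 f F" "circle_mean F = 0" for f F
    using represents_sobolev[OF that(1)] represents_mean[OF that(1)] that(2)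
    by (simp add: zero_average_W11_def)
  have g_mean: "circle_mean ((deriv ^^ 2) (H 0)) = 0"
    using circle_mean_deriv[of "deriv (H 0)" 2] periodic_C_deriv[of "H 0" 3] H(1)[of 0]
    by (simp add: eval_nat_numeral)
  have S_mean: "circle_mean (\<lambda>x. \<Sum>i<n. (L ^^ i) ((deriv ^^ 2) (H 0)) x) = 0" for n
  proof (induction n)
    case 0
    then show ?case by (simp add: circle_mean_const)
  next
    case (Suc n)
    have it: "(L ^^ i) ((deriv ^^ 2) (H 0)) \<in> periodic_C 1" for i
      using transfer_iterate_represents[OF g] by (simp add: represents_def)
    have "circle_mean ((L ^^ n) ((deriv ^^ 2) (H 0))) = 0"
      using g_mean by (induction n) (simp_all add: L_mean[OF it])
    moreover have "(\<lambda>x. \<Sum>i<n. (L ^^ i) ((deriv ^^ 2) (H 0)) x) \<in> periodic_C 1"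
      by (intro periodic_C_sum it)
    ultimately show ?case
      using circle_mean_add[OF _ it[of n]] Suc by simp
  qed
  have "is_resolvent T g u"
    unfolding is_resolvent_def
  proof (intro conjI allI)
    show "g \<in> zero_average_W11" using g g_mean by (rule zero_avg)
    show "u \<in> zero_average_W11" using represents_self[OF u(1)] u(2) by (rule zero_avg)
    show "neumann_sum T g n \<in> zero_average_W11" for n using S S_mean by (rule zero_avg)
    have le: "sobolev_norm 1 (\<lambda>x. neumann_sum T g n x - u x) \<le> 2 * (C * r ^ n)" for n
    proof -
      have "C_norm_le 1 (\<lambda>x. 1 * (\<Sum>i<n. (L ^^ i) ((deriv ^^ 2) (H 0)) x) + (-1) * u x) (C * r ^ n)"
      proof -
        note Sn = S[of n, unfolded represents_def, THEN conjunct2, THEN conjunct1]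
        have eq: "(deriv ^^ j) (\<lambda>x. 1 * (\<Sum>i<n. (L ^^ i) ((deriv ^^ 2) (H 0)) x) + (-1) * u x) y
            = - (deriv ^^ j) (\<lambda>x. u x - (\<Sum>i<n. (L ^^ i) ((deriv ^^ 2) (H 0)) x)) y" if "j \<le> 1" for j y
          unfolding periodic_C_deriv_iterate_lincomb[OF Sn u(1) that]
            periodic_C_deriv_iterate_diff[OF u(1) Sn that] by simp
        show ?thesis
          unfolding C_norm_le_def
        proof (intro allI impI)
          fix j y assume j: "j \<le> (1::nat)"
          show "\<bar>(deriv ^^ j) (\<lambda>x. 1 * (\<Sum>i<n. (L ^^ i) ((deriv ^^ 2) (H 0)) x) + (-1) * u x) y\<bar>
              \<le> C * r ^ n"
            unfolding eq[OF j] abs_minus_cancel using j by (rule C_norm_leD[OF neumann])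
        qed
      qed
      then show ?thesis
        using represents_sobolev_norm_le[OF represents_lincomb[OF S represents_self[OF u(1)], of 1 n "-1"]]
        by simp
    qed
    have "(\<lambda>n. 2 * (C * r ^ n)) \<longlonglongrightarrow> 0"
      using r by (intro tendsto_mult_right_zero LIMSEQ_realpow_zero)
    then show "(\<lambda>n. sobolev_norm 1 (\<lambda>x. neumann_sum T g n x - u x)) \<longlonglongrightarrow> 0"
      by (rule tendsto_sandwich[OF _ _ tendsto_const, rotated 2])
        (simp_all only: sobolev_norm_nonneg le eventually_True)
  qed
  then have U: "is_resolvent T g U"
    unfolding U_def resolvent_def by (rule someI[of "is_resolvent T g"])
  then have "U \<in> circle_L1" by (simp add: is_resolvent_def zero_average_W11_def sobolev_def)
  then have Uu: "represents 1 U u"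
    using is_resolvent_unique[OF U \<open>is_resolvent T g u\<close>] u(1) by (simp add: represents_def)
  have quotient: "represents 1 (\<lambda>x. (h \<delta> x - h 0 x) / \<delta>\<^sup>2 - variance_of \<rho> / 2 * U x)
      (\<lambda>x. (H \<delta> x - H 0 x) / \<delta>\<^sup>2 - (LINT z|\<nu>. z\<^sup>2) / 2 * u x)" if "\<delta> \<in> {0..1}" for \<delta>
  proof -
    have "represents 1 (\<lambda>x. 1 * h \<delta> x + (-1) * h 0 x) (\<lambda>x. 1 * H \<delta> x + (-1) * H 0 x)"
      using that by (intro represents_lincomb h1) auto
    from represents_lincomb[OF this Uu, of "1 / \<delta>\<^sup>2" "- (variance_of \<rho> / 2)"]
    show ?thesis by (simp add: variance)
  qed
  have norm_le: "sobolev_norm 1 (\<lambda>x. (h \<delta> x - h 0 x) / \<delta>\<^sup>2 - variance_of \<rho> / 2 * U x) \<le> 2 * (C * \<delta>)"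
    if "0 < \<delta>" "\<delta> < 1" for \<delta>
    using represents_sobolev_norm_le[OF quotient response] that by simp
  have small: "\<forall>\<^sub>F \<delta> in at_right 0. 0 < \<delta> \<and> \<delta> < (1::real)"
    using eventually_at_right_real[of 0 "1::real"] by simp
  have "((\<lambda>\<delta>. 2 * (C * \<delta>)) \<longlongrightarrow> 2 * (C * 0)) (at_right 0)"
    by (intro tendsto_intros)
  then have lin: "((\<lambda>\<delta>. 2 * (C * \<delta>)) \<longlongrightarrow> 0) (at_right 0)" by simp
  have lim: "((\<lambda>\<delta>. sobolev_norm 1 (\<lambda>x. (h \<delta> x - h 0 x) / \<delta>\<^sup>2 - variance_of \<rho> / 2 * U x)) \<longlongrightarrow> 0) (at_right 0)"
  proof (rule tendsto_sandwich[OF _ _ tendsto_const lin])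
    show "\<forall>\<^sub>F \<delta> in at_right 0. sobolev_norm 1 (\<lambda>x. (h \<delta> x - h 0 x) / \<delta>\<^sup>2 - variance_of \<rho> / 2 * U x)
        \<le> 2 * (C * \<delta>)"
      using small by (rule eventually_mono) (blast intro: norm_le)
  qed (simp add: sobolev_norm_nonneg)
  have "second_order_expansion 1 h"
    unfolding second_order_expansion_def
  proof (rule bexI[of _ "\<lambda>x. 0"], rule bexI[of _ "\<lambda>x. variance_of \<rho> / 2 * U x"])
    show "(\<lambda>x. 0) \<in> sobolev 1"
      by (rule represents_sobolev[OF represents_self[OF periodic_C_const]])
    show "(\<lambda>x. variance_of \<rho> / 2 * U x) \<in> sobolev 1"
      using represents_sobolev[OF represents_lincomb[OF Uu Uu, of "variance_of \<rho> / 2" 0]] by simp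
    have le: "sobolev_norm 1 (\<lambda>x. h \<delta> x - (h 0 x + \<delta> * 0 + \<delta>\<^sup>2 * (variance_of \<rho> / 2 * U x))) / \<delta>\<^sup>2 \<le> 2 * (C * \<delta>)"
      if \<delta>: "0 < \<delta>" "\<delta> < 1" for \<delta>
    proof -
      define v V where "v = (\<lambda>x. (h \<delta> x - h 0 x) / \<delta>\<^sup>2 - variance_of \<rho> / 2 * U x)"
        and "V = (\<lambda>x. (H \<delta> x - H 0 x) / \<delta>\<^sup>2 - (LINT z|\<nu>. z\<^sup>2) / 2 * u x)"
      have v: "represents 1 v V" unfolding v_def V_def using quotient \<delta> by simp
      then have V: "V \<in> periodic_C 1" by (simp add: represents_def)
      have "C_norm_le 1 V (C * \<delta>)" unfolding V_def using response \<delta> by simp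
      then have "C_norm_le 1 (\<lambda>x. \<delta>\<^sup>2 * V x + 0 * V x) (\<bar>\<delta>\<^sup>2\<bar> * (C * \<delta>) + \<bar>0\<bar> * (C * \<delta>))"
        by (intro C_norm_le_lincomb V)
      from represents_sobolev_norm_le[OF represents_lincomb[OF v v] this]
      have "sobolev_norm 1 (\<lambda>x. \<delta>\<^sup>2 * v x) \<le> 2 * (\<delta>\<^sup>2 * (C * \<delta>))" by simp
      moreover have "(\<lambda>x. \<delta>\<^sup>2 * v x) = (\<lambda>x. h \<delta> x - (h 0 x + \<delta> * 0 + \<delta>\<^sup>2 * (variance_of \<rho> / 2 * U x)))"
        using \<delta> by (simp add: v_def fun_eq_iff field_simps)
      ultimately show ?thesis using \<delta> by (simp add: field_simps)
    qed
    show "((\<lambda>\<delta>. sobolev_norm 1 (\<lambda>x. h \<delta> x - (h 0 x + \<delta> * 0 + \<delta>\<^sup>2 * (variance_of \<rho> / 2 * U x))) / \<delta>\<^sup>2)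
        \<longlongrightarrow> 0) (at_right 0)"
    proof (rule tendsto_sandwich[OF _ _ tendsto_const lin])
      show "\<forall>\<^sub>F \<delta> in at_right 0. sobolev_norm 1
          (\<lambda>x. h \<delta> x - (h 0 x + \<delta> * 0 + \<delta>\<^sup>2 * (variance_of \<rho> / 2 * U x))) / \<delta>\<^sup>2 \<le> 2 * (C * \<delta>)"
        using small by (rule eventually_mono) (blast intro: le)
    qed (simp add: sobolev_norm_nonneg)
  qed
  then show ?thesis using U lim by (simp add: U_def g_def)
qed

end
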